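(* The satisfiability problem of the prefix class $[\exists\forall\exists^*, \mathrm{all}]_{=}$ is in $\textsc{ExpTime}$. That is, there is a deterministic algorithm running in time $2^{p(|\varphi|)}$ for some polynomial $p$ which, given a first-order sentence $\varphi$ of the form \[\varphi = \exists z\, \forall x\, \exists y_1 \cdots \exists y_n\, \psi(z,x,y_1,\dots,y_n),\] where $n\ge 0$ and $\psi$ is a quantifier-free formula built from relation symbols of arbitrary arities and equality (no function symbols), decides whether $\varphi$ has a model.
   Context: $[\exists\forall\exists^*, \mathrm{all}]_{=}$ denotes the class of first-order sentences in prenex form with quantifier prefix $\exists\forall\exists^*$ (one existential quantifier, then one universal quantifier, then any finite number of existential quantifiers), over a signature containing arbitrary relation symbols of arbitrary arities, with equality allowed and without function or constant symbols. Satisfiability means having a model (of any cardinality). $|\varphi|$ denotes the length of $\varphi$. *)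

theory Defs
  imports "HOL-Library.Countable_Set" "HOL-Computational_Algebra.Polynomial"
begin

section \<open>First-order logic with equality over relational signatures\<close>

text \<open>Variables are natural numbers. The relation symbol of an atom \<open>Rel r vs\<close> is the pair of its
  name \<open>r\<close> and its arity \<open>length vs\<close>: there are infinitely many symbols of every arity, including 0,
  and atoms with the same name and different numbers of arguments have different symbols.\<close>

datatype fm =
    Eq nat nat
  | Rel nat "nat list"
  | Neg fm
  | Conj fm fm
  | Disj fm fm
  | Imp fm fm
  | Iff fm fm
  | Ex nat fm
  | All nat fm

instance fm :: countable
  by countable_datatype

primrec fv :: "fm \<Rightarrow> nat set" where
  "fv (Eq x y) = {x, y}"
| "fv (Rel r vs) = set vs"
| "fv (Neg p) = fv p"
| "fv (Conj p q) = fv p \<union> fv q"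
| "fv (Disj p q) = fv p \<union> fv q"
| "fv (Imp p q) = fv p \<union> fv q"
| "fv (Iff p q) = fv p \<union> fv q"
| "fv (Ex v p) = fv p - {v}"
| "fv (All v p) = fv p - {v}"

primrec qfree :: "fm \<Rightarrow> bool" where
  "qfree (Eq x y) = True"
| "qfree (Rel r vs) = True"
| "qfree (Neg p) = qfree p"
| "qfree (Conj p q) = (qfree p \<and> qfree q)"
| "qfree (Disj p q) = (qfree p \<and> qfree q)"
| "qfree (Imp p q) = (qfree p \<and> qfree q)"
| "qfree (Iff p q) = (qfree p \<and> qfree q)"
| "qfree (Ex v p) = False"
| "qfree (All v p) = False"

text \<open>The structure has domain \<open>D\<close> and interprets the \<open>n\<close>-ary symbol named \<open>r\<close> by the tuples
  \<open>as\<close> of length \<open>n\<close> over \<open>D\<close> with \<open>I r as\<close>.\<close>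

primrec eval :: "'u set \<Rightarrow> (nat \<Rightarrow> 'u list \<Rightarrow> bool) \<Rightarrow> (nat \<Rightarrow> 'u) \<Rightarrow> fm \<Rightarrow> bool" where
  "eval D I e (Eq x y) = (e x = e y)"
| "eval D I e (Rel r vs) = I r (map e vs)"
| "eval D I e (Neg p) = (\<not> eval D I e p)"
| "eval D I e (Conj p q) = (eval D I e p \<and> eval D I e q)"
| "eval D I e (Disj p q) = (eval D I e p \<or> eval D I e q)"
| "eval D I e (Imp p q) = (eval D I e p \<longrightarrow> eval D I e q)"
| "eval D I e (Iff p q) = (eval D I e p \<longleftrightarrow> eval D I e q)"
| "eval D I e (Ex v p) = (\<exists>a\<in>D. eval D I (e(v := a)) p)"
| "eval D I e (All v p) = (\<forall>a\<in>D. eval D I (e(v := a)) p)"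

text \<open>A model of a sentence, with its domain taken inside the type \<open>'u\<close>. HOL cannot quantify over
  types within a formula, so the universe is a parameter. Lemma \<open>satisfiable_universe\<close> below
  shows that for sentences all infinite universes give the same notion, and that a model in any type
  whatsoever yields one in every infinite universe.\<close>

definition satisfiable :: "'u itself \<Rightarrow> fm \<Rightarrow> bool" where
  "satisfiable U p \<longleftrightarrow>
    (\<exists>(D :: 'u set) I. D \<noteq> {} \<and> (\<forall>e. range e \<subseteq> D \<longrightarrow> eval D I e p))"

text \<open>The prefix class \<open>[\<exists>\<forall>\<exists>\<^sup>*, all]\<close> with equality. The quantified variables need
  not be distinct; an inner quantifier shadows an outer one with the same variable.\<close>

definition prefix_EAEs :: "fm set" where
  "prefix_EAEs =
    {p. fv p = {} \<and> (\<exists>z x ys q. p = Ex z (All x (foldr Ex ys q)) \<and> qfree q)}"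

section \<open>Formulas as words\<close>

text \<open>Formulas are written in Polish notation over a finite alphabet, with indices of variables and
  relation symbols in binary (least significant bit first, no redundant zeros, and 0 as the empty
  word). The length of a formula is the length of this word.\<close>

datatype letter =
  LEq | LRel | LNeg | LConj | LDisj | LImp | LIff | LEx | LAll | LVar | LBit bool

fun bits :: "nat \<Rightarrow> bool list" where
  "bits n = (if n = 0 then [] else odd n # bits (n div 2))"

declare bits.simps [simp del]

definition encode_nat :: "nat \<Rightarrow> letter list" where
  "encode_nat n = map LBit (bits n)"

definition encode_var :: "nat \<Rightarrow> letter list" where
  "encode_var v = LVar # encode_nat v"

primrec encode :: "fm \<Rightarrow> letter list" where
  "encode (Eq x y) = LEq # encode_var x @ encode_var y"
| "encode (Rel r vs) = LRel # encode_nat r @ concat (map encode_var vs)"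
| "encode (Neg p) = LNeg # encode p"
| "encode (Conj p q) = LConj # encode p @ encode q"
| "encode (Disj p q) = LDisj # encode p @ encode q"
| "encode (Imp p q) = LImp # encode p @ encode q"
| "encode (Iff p q) = LIff # encode p @ encode q"
| "encode (Ex v p) = LEx # encode_var v @ encode p"
| "encode (All v p) = LAll # encode_var v @ encode p"

instance letter :: finite
proof
  have "x \<in> {LEq, LRel, LNeg, LConj, LDisj, LImp, LIff, LEx, LAll, LVar, LBit True, LBit False}"
    for x :: letter
    by (cases x) auto
  then have "(UNIV :: letter set) \<subseteq>
    {LEq, LRel, LNeg, LConj, LDisj, LImp, LIff, LEx, LAll, LVar, LBit True, LBit False}"
    by blast
  then show "finite (UNIV :: letter set)"
    by (rule finite_subset) simp
qed

section \<open>Deterministic Turing machines and exponential time\<close>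

text \<open>Deterministic machines with finitely many two-way infinite tapes. The cells contain a blank, a
  letter of the input alphabet \<open>'a\<close>, or one of finitely many work symbols. States are the numbers below
  \<open>tm_states\<close>; state 0 is initial, and the machine halts in \<open>tm_accept\<close> or \<open>tm_reject\<close>.\<close>

datatype 'a cell = Blank | Input 'a | Work nat

datatype dir = GoLeft | Stay | GoRight

record 'a tm =
  tm_tapes :: nat
  tm_states :: nat
  tm_works :: nat
  tm_accept :: nat
  tm_reject :: nat
  tm_delta :: "nat \<Rightarrow> 'a cell list \<Rightarrow> nat \<times> ('a cell \<times> dir) list"

definition cells :: "'a tm \<Rightarrow> 'a cell set" where
  "cells M = {Blank} \<union> range Input \<union> Work ` {..<tm_works M}"

definition turing_machine :: "'a tm \<Rightarrow> bool" where
  "turing_machine M \<longleftrightarrow>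
    tm_tapes M \<ge> 1 \<and> 0 < tm_states M \<and>
    tm_accept M < tm_states M \<and> tm_reject M < tm_states M \<and> tm_accept M \<noteq> tm_reject M \<and>
    (\<forall>q cs. q < tm_states M \<and> length cs = tm_tapes M \<and> set cs \<subseteq> cells M \<longrightarrow>
      fst (tm_delta M q cs) < tm_states M \<and>
      length (snd (tm_delta M q cs)) = tm_tapes M \<and>
      fst ` set (snd (tm_delta M q cs)) \<subseteq> cells M)"

text \<open>A tape is its contents together with the position of its head.\<close>

type_synonym 'a tape = "(int \<Rightarrow> 'a cell) \<times> int"

type_synonym 'a config = "nat \<times> 'a tape list"

fun act :: "'a tape \<Rightarrow> 'a cell \<times> dir \<Rightarrow> 'a tape" where
  "act (t, h) (c, d) =
    (t(h := c), case d of GoLeft \<Rightarrow> h - 1 | Stay \<Rightarrow> h | GoRight \<Rightarrow> h + 1)"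

fun step :: "'a tm \<Rightarrow> 'a config \<Rightarrow> 'a config" where
  "step M (q, ts) =
    (if q = tm_accept M \<or> q = tm_reject M then (q, ts)
     else let (q', as) = tm_delta M q (map (\<lambda>(t, h). t h) ts) in (q', map2 act ts as))"

definition input_tape :: "'a list \<Rightarrow> 'a tape" where
  "input_tape w =
    (\<lambda>i. if 0 \<le> i \<and> i < int (length w) then Input (w ! nat i) else Blank, 0)"

definition initial :: "'a tm \<Rightarrow> 'a list \<Rightarrow> 'a config" where
  "initial M w = (0, input_tape w # replicate (tm_tapes M - 1) (\<lambda>_. Blank, 0))"

definition decides_in_time :: "'a tm \<Rightarrow> 'a list set \<Rightarrow> (nat \<Rightarrow> nat) \<Rightarrow> bool" where
  "decides_in_time M L T \<longleftrightarrow>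
    (\<forall>w. \<exists>t \<le> T (length w).
      fst ((step M ^^ t) (initial M w)) = (if w \<in> L then tm_accept M else tm_reject M))"

definition EXPTIME :: "'a::finite list set set" where
  "EXPTIME =
    {L. \<exists>M (p :: nat poly). turing_machine M \<and> decides_in_time M L (\<lambda>n. 2 ^ poly p n)}"

section \<open>Unique readability\<close>

lemma bits_0: "bits 0 = []"
  by (subst bits.simps) simp

lemma bits_pos: "n \<noteq> 0 \<Longrightarrow> bits n = odd n # bits (n div 2)"
  by (subst bits.simps) simp

lemma bits_inject: "bits m = bits n \<Longrightarrow> m = n"
proof (induction m arbitrary: n rule: less_induct)
  case (less m)
  consider "m = 0" | "m \<noteq> 0" "n = 0" | "m \<noteq> 0" "n \<noteq> 0" by blast
  then show ?case
  proof cases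
    case 1
    then show ?thesis using less.prems by (cases "n = 0") (auto simp: bits_0 bits_pos)
  next
    case 2
    then show ?thesis using less.prems by (simp add: bits_0 bits_pos)
  next
    case 3
    then have "odd m = odd n" and eq: "bits (m div 2) = bits (n div 2)"
      using less.prems by (simp_all add: bits_pos)
    moreover have "m div 2 = n div 2"
      using 3 by (intro less.IH eq) simp
    ultimately show ?thesis by presburger
  qed
qed

definition no_bit :: "letter list \<Rightarrow> bool" where
  "no_bit u \<longleftrightarrow> (\<forall>b u'. u \<noteq> LBit b # u')"

definition no_arg :: "letter list \<Rightarrow> bool" where
  "no_arg u \<longleftrightarrow> no_bit u \<and> (\<forall>u'. u \<noteq> LVar # u')"

lemma LBits_append_inject:
  "map LBit bs @ u = map LBit cs @ v \<Longrightarrow> no_bit u \<Longrightarrow> no_bit v \<Longrightarrow> bs = cs \<and> u = v"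
proof (induction bs arbitrary: cs)
  case Nil
  then show ?case by (cases cs) (auto simp: no_bit_def)
next
  case (Cons b bs)
  then show ?case by (cases cs) (auto simp: no_bit_def)
qed

lemma encode_nat_append_inject:
  "encode_nat m @ u = encode_nat n @ v \<Longrightarrow> no_bit u \<Longrightarrow> no_bit v \<Longrightarrow> m = n \<and> u = v"
  unfolding encode_nat_def by (drule (2) LBits_append_inject) (auto dest: bits_inject)

lemma encode_var_append_inject:
  "encode_var m @ u = encode_var n @ v \<Longrightarrow> no_bit u \<Longrightarrow> no_bit v \<Longrightarrow> m = n \<and> u = v"
  unfolding encode_var_def append_Cons list.inject by (elim conjE) (rule encode_nat_append_inject)

lemma no_bit_encode_var: "no_bit (encode_var v @ u)"
  by (simp add: no_bit_def encode_var_def)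

lemma no_bit_encode_vars: "no_bit u \<Longrightarrow> no_bit (concat (map encode_var vs) @ u)"
  by (cases vs) (auto simp: no_bit_encode_var)

lemma encode_vars_append_inject:
  "concat (map encode_var vs) @ u = concat (map encode_var ws) @ v \<Longrightarrow> no_arg u \<Longrightarrow> no_arg v \<Longrightarrow>
    vs = ws \<and> u = v"
proof (induction vs arbitrary: ws)
  case Nil
  then show ?case by (cases ws) (auto simp: no_arg_def encode_var_def)
next
  case (Cons x vs)
  show ?case
  proof (cases ws)
    case Nil
    then show ?thesis using Cons.prems by (auto simp: no_arg_def encode_var_def)
  next
    case (Cons y ws')
    have "encode_var x @ (concat (map encode_var vs) @ u)
        = encode_var y @ (concat (map encode_var ws') @ v)"
      using Cons.prems(1) local.Cons by simp
    from encode_var_append_inject[OF this] have xy: "x = y"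
      and eq: "concat (map encode_var vs) @ u = concat (map encode_var ws') @ v"
      using no_bit_encode_vars Cons.prems(2,3) by (simp_all add: no_arg_def)
    show ?thesis using Cons.IH[OF eq Cons.prems(2,3)] xy local.Cons by simp
  qed
qed

lemma no_arg_encode: "no_arg (encode p @ u)"
  by (cases p) (auto simp: no_arg_def no_bit_def)

lemma no_bit_encode: "no_bit (encode p @ u)"
  using no_arg_encode unfolding no_arg_def by blast

lemma encode_append_inject:
  "encode p @ u = encode q @ v \<Longrightarrow> no_arg u \<Longrightarrow> no_arg v \<Longrightarrow> p = q \<and> u = v"
proof (induction p arbitrary: q u v)
  case (Eq x y)
  obtain x' y' where q: "q = Eq x' y'" using Eq.prems(1) by (cases q) auto
  have "encode_var x @ (encode_var y @ u) = encode_var x' @ (encode_var y' @ v)"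
    using Eq.prems q by simp
  from encode_var_append_inject[OF this no_bit_encode_var no_bit_encode_var]
  have "x = x'" "encode_var y @ u = encode_var y' @ v" by simp_all
  moreover have "y = y' \<and> u = v"
    using encode_var_append_inject[OF calculation(2)] Eq.prems(2,3) by (simp add: no_arg_def)
  ultimately show ?case using q by simp
next
  case (Rel r vs)
  obtain r' vs' where q: "q = Rel r' vs'" using Rel.prems(1) by (cases q) auto
  have "encode_nat r @ (concat (map encode_var vs) @ u)
      = encode_nat r' @ (concat (map encode_var vs') @ v)"
    using Rel.prems q by simp
  from encode_nat_append_inject[OF this]
  have "r = r'" and eq: "concat (map encode_var vs) @ u = concat (map encode_var vs') @ v"
    using no_bit_encode_vars Rel.prems(2,3) by (simp_all add: no_arg_def)
  then show ?case using encode_vars_append_inject[OF eq Rel.prems(2,3)] q by simp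
next
  case (Neg p)
  obtain q' where q: "q = Neg q'" using Neg.prems(1) by (cases q) auto
  then have "encode p @ u = encode q' @ v" using Neg.prems(1) by simp
  from Neg.IH[OF this Neg.prems(2,3)] show ?case using q by simp
next
  case (Conj p1 p2)
  obtain q1 q2 where q: "q = Conj q1 q2" using Conj.prems(1) by (cases q) auto
  then have "encode p1 @ (encode p2 @ u) = encode q1 @ (encode q2 @ v)"
    using Conj.prems(1) by simp
  from Conj.IH(1)[OF this no_arg_encode no_arg_encode]
  have "p1 = q1" and eq: "encode p2 @ u = encode q2 @ v" by simp_all
  then show ?case using Conj.IH(2)[OF eq Conj.prems(2,3)] q by simp
next
  case (Disj p1 p2)
  obtain q1 q2 where q: "q = Disj q1 q2" using Disj.prems(1) by (cases q) auto
  then have "encode p1 @ (encode p2 @ u) = encode q1 @ (encode q2 @ v)"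
    using Disj.prems(1) by simp
  from Disj.IH(1)[OF this no_arg_encode no_arg_encode]
  have "p1 = q1" and eq: "encode p2 @ u = encode q2 @ v" by simp_all
  then show ?case using Disj.IH(2)[OF eq Disj.prems(2,3)] q by simp
next
  case (Imp p1 p2)
  obtain q1 q2 where q: "q = Imp q1 q2" using Imp.prems(1) by (cases q) auto
  then have "encode p1 @ (encode p2 @ u) = encode q1 @ (encode q2 @ v)"
    using Imp.prems(1) by simp
  from Imp.IH(1)[OF this no_arg_encode no_arg_encode]
  have "p1 = q1" and eq: "encode p2 @ u = encode q2 @ v" by simp_all
  then show ?case using Imp.IH(2)[OF eq Imp.prems(2,3)] q by simp
next
  case (Iff p1 p2)
  obtain q1 q2 where q: "q = Iff q1 q2" using Iff.prems(1) by (cases q) auto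
  then have "encode p1 @ (encode p2 @ u) = encode q1 @ (encode q2 @ v)"
    using Iff.prems(1) by simp
  from Iff.IH(1)[OF this no_arg_encode no_arg_encode]
  have "p1 = q1" and eq: "encode p2 @ u = encode q2 @ v" by simp_all
  then show ?case using Iff.IH(2)[OF eq Iff.prems(2,3)] q by simp
next
  case (Ex x p)
  obtain y q' where q: "q = Ex y q'" using Ex.prems(1) by (cases q) auto
  then have "encode_var x @ (encode p @ u) = encode_var y @ (encode q' @ v)"
    using Ex.prems(1) by simp
  from encode_var_append_inject[OF this no_bit_encode no_bit_encode]
  have "x = y" and eq: "encode p @ u = encode q' @ v" by simp_all
  then show ?case using Ex.IH[OF eq Ex.prems(2,3)] q by simp
next
  case (All x p)
  obtain y q' where q: "q = All y q'" using All.prems(1) by (cases q) auto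
  then have "encode_var x @ (encode p @ u) = encode_var y @ (encode q' @ v)"
    using All.prems(1) by simp
  from encode_var_append_inject[OF this no_bit_encode no_bit_encode]
  have "x = y" and eq: "encode p @ u = encode q' @ v" by simp_all
  then show ?case using All.IH[OF eq All.prems(2,3)] q by simp
qed

theorem inj_encode: "inj encode"
proof (rule injI)
  fix p q
  assume "encode p = encode q"
  then show "p = q"
    using encode_append_inject[of p "[]" q "[]"] by (simp add: no_arg_def no_bit_def)
qed

section \<open>Independence of the universe\<close>

lemma finite_fv: "finite (fv p)"
  by (induction p) auto

lemma eval_cong: "(\<And>v. v \<in> fv p \<Longrightarrow> e v = e' v) \<Longrightarrow> eval D I e p = eval D I e' p"
proof (induction p arbitrary: e e')
  case (Rel r vs)
  then have "map e vs = map e' vs" by simp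
  then show ?case by (simp only: eval.simps)
next
  case (Conj p1 p2)
  have "eval D I e p1 = eval D I e' p1" "eval D I e p2 = eval D I e' p2"
    by (rule Conj.IH, simp add: Conj.prems)+
  then show ?case by simp
next
  case (Disj p1 p2)
  have "eval D I e p1 = eval D I e' p1" "eval D I e p2 = eval D I e' p2"
    by (rule Disj.IH, simp add: Disj.prems)+
  then show ?case by simp
next
  case (Imp p1 p2)
  have "eval D I e p1 = eval D I e' p1" "eval D I e p2 = eval D I e' p2"
    by (rule Imp.IH, simp add: Imp.prems)+
  then show ?case by simp
next
  case (Iff p1 p2)
  have "eval D I e p1 = eval D I e' p1" "eval D I e p2 = eval D I e' p2"
    by (rule Iff.IH, simp add: Iff.prems)+
  then show ?case by simp
next
  case (Ex x p)
  have "eval D I (e(x := a)) p = eval D I (e'(x := a)) p" for a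
    by (rule Ex.IH) (simp add: Ex.prems)
  then show ?case by simp
next
  case (All x p)
  have "eval D I (e(x := a)) p = eval D I (e'(x := a)) p" for a
    by (rule All.IH) (simp add: All.prems)
  then show ?case by simp
next
  case (Neg p)
  have "eval D I e p = eval D I e' p"
    by (rule Neg.IH) (simp add: Neg.prems)
  then show ?case by simp
qed simp

lemma range_upd: "range e \<subseteq> C \<Longrightarrow> a \<in> C \<Longrightarrow> range (e(x := a)) \<subseteq> C"
  by auto

lemma tarski_vaught:
  assumes sub: "C \<subseteq> D"
    and wit: "\<And>p x e. range e \<subseteq> C \<Longrightarrow> eval D I e (Ex x p) \<Longrightarrow> \<exists>a\<in>C. eval D I (e(x := a)) p"
  shows "range e \<subseteq> C \<Longrightarrow> eval C I e p = eval D I e p"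
proof (induction p arbitrary: e)
  case (Ex x p)
  have "eval C I (e(x := a)) p = eval D I (e(x := a)) p" if "a \<in> C" for a
    by (rule Ex.IH) (rule range_upd[OF Ex.prems that])
  then show ?case using wit[OF Ex.prems, of x p] sub by auto
next
  case (All x p)
  have "eval C I (e(x := a)) p = eval D I (e(x := a)) p" if "a \<in> C" for a
    by (rule All.IH) (rule range_upd[OF All.prems that])
  then show ?case using wit[OF All.prems, of x "Neg p"] sub by auto
qed auto

lemma lowenheim_skolem:
  fixes D :: "'u set"
  assumes "D \<noteq> {}"
  obtains C where "C \<subseteq> D" "C \<noteq> {}" "countable C"
    "\<forall>e p. range e \<subseteq> C \<longrightarrow> eval C I e p = eval D I e p"
proof -
  obtain d where d: "d \<in> D" using assms by blast
  define env where "env xs = (\<lambda>i. if i < length xs then xs ! i else d)" for xs :: "'u list"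
  define w where "w = (\<lambda>(p, x, xs).
    if eval D I (env xs) (Ex x p) then SOME a. a \<in> D \<and> eval D I ((env xs)(x := a)) p else d)"
  have w: "w (p, x, xs) \<in> D"
    "eval D I (env xs) (Ex x p) \<Longrightarrow> eval D I ((env xs)(x := w (p, x, xs))) p" for p x xs
  proof -
    have "w (p, x, xs) \<in> D \<and>
      (eval D I (env xs) (Ex x p) \<longrightarrow> eval D I ((env xs)(x := w (p, x, xs))) p)"
    proof (cases "eval D I (env xs) (Ex x p)")
      case True
      then have "\<exists>a. a \<in> D \<and> eval D I ((env xs)(x := a)) p" by auto
      from someI_ex[OF this] show ?thesis using True unfolding w_def by simp
    next
      case False
      then show ?thesis using d unfolding w_def by simp
    qed
    then show "w (p, x, xs) \<in> D"
      "eval D I (env xs) (Ex x p) \<Longrightarrow> eval D I ((env xs)(x := w (p, x, xs))) p"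
      by blast+
  qed
  define S where "S = rec_nat {d} (\<lambda>_ A. A \<union> w ` (UNIV \<times> UNIV \<times> lists A))"
  have S0: "S 0 = {d}" and SS: "S (Suc n) = S n \<union> w ` (UNIV \<times> UNIV \<times> lists (S n))" for n
    unfolding S_def by simp_all
  have mono: "m \<le> n \<Longrightarrow> S m \<subseteq> S n" for m n
    by (rule lift_Suc_mono_le[of S]) (auto simp: SS)
  have "countable (S n)" for n
  proof (induction n)
    case 0
    then show ?case by (simp add: S0)
  next
    case (Suc n)
    then show ?case unfolding SS
      by (intro countable_Un countable_image countable_SIGMA countable_lists) auto
  qed
  moreover have "S n \<subseteq> D" for n
  proof (induction n)
    case 0
    then show ?case using d by (simp add: S0)
  next
    case (Suc n)
    have "w y \<in> D" for y using w(1) by (cases y) auto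
    then show ?case using Suc unfolding SS by blast
  qed
  moreover define C where "C = (\<Union>n. S n)"
  ultimately have C: "countable C" "C \<subseteq> D" by auto
  have dC: "d \<in> C" unfolding C_def using S0 by blast
  have lst: "\<exists>n. set xs \<subseteq> S n" if "set xs \<subseteq> C" for xs
    using that
  proof (induction xs)
    case (Cons a xs)
    then obtain n m where "set xs \<subseteq> S n" "a \<in> S m" unfolding C_def by auto
    then have "set (a # xs) \<subseteq> S (max n m)" using mono[of n "max n m"] mono[of m "max n m"] by auto
    then show ?case by blast
  qed simp
  have "\<exists>a\<in>C. eval D I (e(x := a)) p" if e: "range e \<subseteq> C" and ex: "eval D I e (Ex x p)" for e x p
  proof -
    obtain n where n: "\<And>v. v \<in> fv p \<Longrightarrow> v < n"
      using finite_fv[of p] by (metis finite_nat_set_iff_bounded)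
    define xs where "xs = map e [0..<n]"
    have eq: "env xs v = e v" if "v \<in> fv p" for v
      using n[OF that] by (simp add: env_def xs_def)
    have "eval D I e (Ex x p) = eval D I (env xs) (Ex x p)"
      by (rule eval_cong) (simp add: eq)
    then have "eval D I ((env xs)(x := w (p, x, xs))) p" using ex w(2) by blast
    also have "eval D I ((env xs)(x := w (p, x, xs))) p = eval D I (e(x := w (p, x, xs))) p"
      by (rule eval_cong) (simp add: eq)
    finally have ev: "eval D I (e(x := w (p, x, xs))) p" .
    have "set xs \<subseteq> C" using e by (auto simp: xs_def)
    then obtain m where "set xs \<subseteq> S m" using lst by blast
    then have "w (p, x, xs) \<in> S (Suc m)" unfolding SS by (auto intro!: imageI)
    then show ?thesis using ev unfolding C_def by blast
  qed
  then have "range e \<subseteq> C \<Longrightarrow> eval C I e p = eval D I e p" for e p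
    by (rule tarski_vaught[OF C(2)])
  then have "\<forall>e p. range e \<subseteq> C \<longrightarrow> eval C I e p = eval D I e p" by simp
  moreover have "C \<noteq> {}" using dC by auto
  ultimately show thesis using C by (intro that)
qed

lemma eval_image:
  assumes "inj_on f C"
  shows "range e \<subseteq> C \<Longrightarrow>
    eval (f ` C) (\<lambda>r bs. I r (map (inv_into C f) bs)) (f \<circ> e) p = eval C I e p"
proof (induction p arbitrary: e)
  case (Eq x y)
  then have "e x \<in> C" "e y \<in> C" by auto
  then show ?case using assms by (simp add: inj_on_eq_iff)
next
  case (Rel r vs)
  then have "inv_into C f (f (e v)) = e v" for v
    using assms by (intro inv_into_f_f) auto
  then have "map (inv_into C f) (map (f \<circ> e) vs) = map e vs" by simp
  then show ?case by (simp only: eval.simps)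
next
  case (Ex x p)
  have "eval (f ` C) (\<lambda>r bs. I r (map (inv_into C f) bs)) ((f \<circ> e)(x := f a)) p
      = eval C I (e(x := a)) p" if "a \<in> C" for a
    using Ex.IH[OF range_upd[OF Ex.prems that, of x]] by (simp only: fun_upd_comp)
  then show ?case by (simp only: eval.simps bex_simps ball_simps cong: bex_cong ball_cong)
next
  case (All x p)
  have "eval (f ` C) (\<lambda>r bs. I r (map (inv_into C f) bs)) ((f \<circ> e)(x := f a)) p
      = eval C I (e(x := a)) p" if "a \<in> C" for a
    using All.IH[OF range_upd[OF All.prems that, of x]] by (simp only: fun_upd_comp)
  then show ?case by (simp only: eval.simps bex_simps ball_simps cong: bex_cong ball_cong)
qed simp_all

theorem satisfiable_universe:
  assumes "infinite (UNIV :: 'v set)" and "fv p = {}" and "satisfiable TYPE('u) p"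
  shows "satisfiable TYPE('v) p"
proof -
  obtain D :: "'u set" and I where D: "D \<noteq> {}" "\<And>e. range e \<subseteq> D \<Longrightarrow> eval D I e p"
    using assms(3) unfolding satisfiable_def by auto
  obtain C where C: "C \<subseteq> D" "C \<noteq> {}" "countable C"
    and ev: "\<forall>e p. range e \<subseteq> C \<longrightarrow> eval C I e p = eval D I e p"
    by (rule lowenheim_skolem[OF D(1), of I])
  obtain g :: "nat \<Rightarrow> 'v" where g: "inj g"
    using infinite_countable_subset[OF assms(1)] by auto
  obtain h :: "'u \<Rightarrow> nat" where h: "inj_on h C"
    using C(3) by (auto simp: countable_def)
  have inj: "inj_on (g \<circ> h) C"
    using h g by (intro comp_inj_on) (auto intro: inj_on_subset)
  obtain c where c: "c \<in> C" using C(2) by blast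
  define J where "J = (\<lambda>r bs. I r (map (inv_into C (g \<circ> h)) bs))"
  have c': "range (\<lambda>_. c) \<subseteq> C" using c by auto
  have "eval C I (\<lambda>_. c) p"
    unfolding ev[rule_format, OF c'] using c C(1) by (intro D(2)) auto
  then have m: "eval ((g \<circ> h) ` C) J ((g \<circ> h) \<circ> (\<lambda>_. c)) p"
    unfolding J_def eval_image[OF inj c'] .
  have "eval ((g \<circ> h) ` C) J e p" for e
    by (rule iffD1[OF eval_cong m]) (simp add: assms(2))
  moreover have "(g \<circ> h) ` C \<noteq> {}" using c by (auto simp del: o_apply)
  ultimately show ?thesis
    unfolding satisfiable_def by (intro exI[of _ "(g \<circ> h) ` C"] exI[of _ J]) simp
qed

end

theory Submission
  imports Defs
begin

text \<open>An element \<open>a\<close> of a model, together with the element \<open>c\<close> chosen for \<open>z\<close> and with witnesses for the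
  inner existential quantifiers, determines a configuration: which variables have equal values, and
  which atoms of the formula hold. The configuration of a witness of \<open>a\<close> need only agree with that of
  \<open>a\<close> on the atoms whose arguments are this witness and \<open>c\<close>. Conversely, let \<open>S\<close> be a set of
  configurations that agree on the atoms about \<open>c\<close> alone and in which every witness has a matching
  configuration; then \<open>S\<close> unfolds into a tree whose branches share only \<open>c\<close>, and this tree is a model.
  As a configuration has polynomial size, there are exponentially many of them. For each choice of the
  atoms about \<open>c\<close>, those that lack a match for a witness are eliminated until none is left to eliminate.

  All of this is expressed by tables over numbers up to \<open>2 ^ (length w + 1)\<^sup>2\<close>, each defined by a
  first-order formula over the earlier tables and over the earlier stages of itself. A machine computes
  any fixed system of such tables entry by entry, the time being polynomial in the number bound.\<close>

section \<open>A programming language for Turing machines\<close>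

text \<open>The unfolding works because there is just one universal variable: an instance of the
  matrix speaks of one element, its own witnesses and the value of \<open>z\<close>, so two
  instances constrain each other only where they overlap. The value of \<open>z\<close> is the only
  element shared by all branches. Over one shared element a symbol has a single tuple, so a choice
  of the facts about it is one bit per symbol, and all choices can be tried. Over two shared
  elements an n-ary symbol would have 2^n tuples, and trying all choices would be doubly
  exponential. For a fixed choice, the admissible sets of configurations are closed under union, so
  there is a largest one, and elimination reaches it. The defining formulas of the tables must not
  depend on the word, since their arities and quantifier depths enter the exponent of the running
  time. Hence parsing the word and evaluating its matrix are themselves expressed by tables.\<close>

datatype 'a com =
    Skip
  | Act nat "'a cell \<Rightarrow> 'a cell \<times> dir"
  | Seq "'a com" "'a com"  (infixr \<open>;;\<close> 60)
  | Cond "(nat \<Rightarrow> 'a cell) \<Rightarrow> bool" "'a com" "'a com"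
  | While "(nat \<Rightarrow> 'a cell) \<Rightarrow> bool" "'a com"

text \<open>The control state of a running program is the program that remains to be run;
  \<open>h\<close> gives the scanned symbols. Discarding a finished left part of a sequence takes a
  step of its own.\<close>

primrec ctl :: "(nat \<Rightarrow> 'a cell) \<Rightarrow> 'a com \<Rightarrow> 'a com" where
  "ctl h Skip = Skip"
| "ctl h (Act j f) = Skip"
| "ctl h (c ;; d) = (if c = Skip then d else ctl h c ;; d)"
| "ctl h (Cond b c d) = (if b h then c else d)"
| "ctl h (While b c) = (if b h then c ;; While b c else Skip)"

primrec emit :: "(nat \<Rightarrow> 'a cell) \<Rightarrow> 'a com \<Rightarrow> nat \<Rightarrow> 'a cell \<times> dir" where
  "emit h Skip = (\<lambda>i. (h i, Stay))"
| "emit h (Act j f) = (\<lambda>i. if i = j then f (h i) else (h i, Stay))"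
| "emit h (c ;; d) = emit h c"
| "emit h (Cond b c d) = (\<lambda>i. (h i, Stay))"
| "emit h (While b c) = (\<lambda>i. (h i, Stay))"

definition heads :: "(nat \<Rightarrow> 'a tape) \<Rightarrow> nat \<Rightarrow> 'a cell" where
  "heads T j = fst (T j) (snd (T j))"

fun sstep :: "'a com \<times> (nat \<Rightarrow> 'a tape) \<Rightarrow> 'a com \<times> (nat \<Rightarrow> 'a tape)" where
  "sstep (c, T) = (ctl (heads T) c, \<lambda>j. act (T j) (emit (heads T) c j))"

declare sstep.simps [simp del]

lemma act_Stay: "act (T j) (heads T j, Stay) = T j"
  by (cases "T j") (simp add: heads_def)

lemma sstep_simps [simp]:
  "sstep (Skip, T) = (Skip, T)"
  "sstep (Act j f, T) = (Skip, T(j := act (T j) (f (heads T j))))"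
  "sstep (c ;; d, T) =
    (if c = Skip then (d, T) else (fst (sstep (c, T)) ;; d, snd (sstep (c, T))))"
  "sstep (Cond b c d, T) = (if b (heads T) then c else d, T)"
  "sstep (While b c, T) = (if b (heads T) then c ;; While b c else Skip, T)"
  by (auto simp: sstep.simps act_Stay fun_eq_iff)

section \<open>Timed runs of programs\<close>

definition runs :: "nat \<Rightarrow> 'a com \<Rightarrow> (nat \<Rightarrow> 'a tape) \<Rightarrow> (nat \<Rightarrow> 'a tape) \<Rightarrow> bool" where
  "runs n c T T' \<longleftrightarrow> (\<exists>t\<le>n. (sstep ^^ t) (c, T) = (Skip, T'))"

lemma runs_mono: "runs n c T T' \<Longrightarrow> n \<le> m \<Longrightarrow> runs m c T T'"
  by (meson runs_def order_trans)

lemma runs_Skip: "runs 0 Skip T T"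
  by (simp add: runs_def)

lemma runs_step: "runs n c' T' T'' \<Longrightarrow> sstep (c, T) = (c', T') \<Longrightarrow> runs (Suc n) c T T''"
  unfolding runs_def by (metis Suc_le_mono comp_apply funpow_Suc_right)

lemma runs_Act: "runs 1 (Act j f) T (T(j := act (T j) (f (heads T j))))"
  by (simp, rule runs_step[OF runs_Skip]) simp

lemma runs_Seq:
  assumes "runs n c T T'" and "runs m d T' T''"
  shows "runs (n + m + 1) (c ;; d) T T''"
proof -
  obtain t where "t \<le> n" and t: "(sstep ^^ t) (c, T) = (Skip, T')"
    using assms(1) by (auto simp: runs_def)
  have "runs (t + m + 1) (c ;; d) T T''" using t
  proof (induction t arbitrary: c T)
    case 0
    then show ?case using runs_step[OF assms(2), of "c ;; d" T] by simp
  next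
    case (Suc t)
    show ?case
    proof (cases "c = Skip")
      case True
      have "(sstep ^^ k) (Skip, T) = (Skip, T)" for k by (induction k) auto
      then have "T' = T" using Suc.prems True by (metis prod.inject)
      then have "runs (Suc m) (c ;; d) T T''" using True by (intro runs_step[OF assms(2)]) simp
      then show ?thesis by (rule runs_mono) simp
    next
      case False
      obtain c1 T1 where s: "sstep (c, T) = (c1, T1)" by fastforce
      then have "runs (t + m + 1) (c1 ;; d) T1 T''"
        using Suc.prems by (intro Suc.IH) (simp add: funpow_Suc_right del: funpow.simps)
      then have "runs (Suc (t + m + 1)) (c ;; d) T T''"
        by (rule runs_step) (simp add: False s)
      then show ?thesis by simp
    qed
  qed
  then show ?thesis by (rule runs_mono) (use \<open>t \<le> n\<close> in simp)
qed

lemma runs_Cond: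
  "runs n (if b (heads T) then c else d) T T' \<Longrightarrow> runs (Suc n) (Cond b c d) T T'"
  by (erule runs_step) simp

lemma runs_While_False: "\<not> b (heads T) \<Longrightarrow> runs 1 (While b c) T T"
  by (simp, rule runs_step[OF runs_Skip]) simp

lemma runs_While_True:
  assumes "b (heads T)" and "runs n c T T'" and "runs m (While b c) T' T''"
  shows "runs (n + m + 2) (While b c) T T''"
  using runs_step[OF runs_Seq[OF assms(2,3)], of "While b c" T] assms(1) by simp

subsection \<open>Compilation\<close>

text \<open>Contains all remainders that a run can reach. A remainder of a loop body is always
  followed by the same loop, so nothing grows and the set is finite, much as for partial derivatives
  of regular expressions.\<close>

primrec conts :: "'a com \<Rightarrow> 'a com set" where
  "conts Skip = {Skip}"
| "conts (Act j f) = {Act j f, Skip}"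
| "conts (c ;; d) = (\<lambda>c'. c' ;; d) ` conts c \<union> conts d"
| "conts (Cond b c d) = insert (Cond b c d) (conts c \<union> conts d)"
| "conts (While b c) = {While b c, Skip} \<union> (\<lambda>c'. c' ;; While b c) ` conts c"

lemma finite_conts: "finite (conts c)"
  by (induction c) auto

lemma conts_refl: "c \<in> conts c"
  by (induction c) auto

lemma ctl_conts: "c' \<in> conts c \<Longrightarrow> ctl h c' \<in> conts c"
proof (induction c arbitrary: c')
  case (While b c)
  then show ?case using conts_refl[of c] by (auto split: if_splits)
qed (auto simp: conts_refl split: if_splits)

primrec wf_com :: "nat \<Rightarrow> 'a cell set \<Rightarrow> 'a com \<Rightarrow> bool" where
  "wf_com K C Skip = True"
| "wf_com K C (Act j f) = (j < K \<and> (\<forall>x\<in>C. fst (f x) \<in> C))"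
| "wf_com K C (c ;; d) = (wf_com K C c \<and> wf_com K C d)"
| "wf_com K C (Cond b c d) = (wf_com K C c \<and> wf_com K C d)"
| "wf_com K C (While b c) = wf_com K C c"

lemma wf_conts: "c' \<in> conts c \<Longrightarrow> wf_com K C c \<Longrightarrow> wf_com K C c'"
  by (induction c arbitrary: c') auto

lemma emit_in: "wf_com K C c \<Longrightarrow> (\<And>i. i < K \<Longrightarrow> h i \<in> C) \<Longrightarrow> i < K \<Longrightarrow> fst (emit h c i) \<in> C"
  by (induction c) auto

lemma emit_ge: "wf_com K C c \<Longrightarrow> K \<le> i \<Longrightarrow> emit h c i = (h i, Stay)"
  by (induction c) auto

definition start_tapes :: "'a list \<Rightarrow> nat \<Rightarrow> 'a tape" where
  "start_tapes w j = (if j = 0 then input_tape w else (\<lambda>_. Blank, 0))"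

text \<open>The remainders of \<open>main\<close> are the states of the machine, shifted by 3 to
  leave 0 for the start and 1, 2 for the verdicts. Once \<open>Skip\<close> is reached, one further
  step evaluates \<open>acc\<close> on the scanned symbols.\<close>

lemma EXPTIME_I:
  fixes main :: "'a::finite com" and p :: "nat poly"
  assumes K: "1 \<le> K" and wf: "wf_com K ({Blank} \<union> range Input \<union> Work ` {..<W}) main"
    and run: "\<And>w. \<exists>T. runs (2 ^ poly p (length w)) main (start_tapes w) T \<and>
      (acc (heads T) \<longleftrightarrow> w \<in> L)"
  shows "L \<in> EXPTIME"
proof -
  define C where "C = ({Blank} \<union> range Input \<union> Work ` {..<W} :: 'a cell set)"
  obtain idx where bij: "bij_betw idx (conts main) {0..<card (conts main)}"
    using ex_bij_betw_finite_nat[OF finite_conts] by blast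
  define code where "code c = idx c + 3" for c
  define dec where "dec q = inv_into (conts main) idx (q - 3)" for q
  have dec_code: "dec (code c) = c" if "c \<in> conts main" for c
    using that bij by (simp add: dec_def code_def bij_betw_def)
  have code_lt: "code c < card (conts main) + 3" if "c \<in> conts main" for c
    using that bij by (auto simp: code_def bij_betw_def)
  have dec_in: "dec q \<in> conts main" if "3 \<le> q" "q < card (conts main) + 3" for q
  proof -
    have "q - 3 \<in> idx ` conts main" using that bij by (auto simp: bij_betw_def)
    then show ?thesis unfolding dec_def by (rule inv_into_into)
  qed
  \<comment> \<open>Tests in programs may inspect infinitely many tapes, whereas the machine sees
    \<open>K\<close> symbols. Padding with \<open>Blank\<close> is right as long as the tapes from
    \<open>K\<close> on stay empty, which \<open>fin\<close> expresses below.\<close>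
  define ext where "ext cs = (\<lambda>j. if j < K then cs ! j else Blank)" for cs :: "'a cell list"
  define \<delta> where "\<delta> q cs =
    (if q < 3 then (code main, map (\<lambda>c. (c, Stay)) cs)
     else if dec q = Skip then (if acc (ext cs) then 1 else 2, map (\<lambda>c. (c, Stay)) cs)
     else (code (ctl (ext cs) (dec q)), map (emit (ext cs) (dec q)) [0..<K]))" for q cs
  define M where "M = \<lparr>tm_tapes = K, tm_states = card (conts main) + 3, tm_works = W,
    tm_accept = 1, tm_reject = 2, tm_delta = \<delta>\<rparr>"
  have cellsM: "cells M = C" by (simp add: cells_def M_def C_def)
  have tm: "turing_machine M"
    unfolding turing_machine_def cellsM
  proof (intro conjI allI impI)
    fix q cs assume *: "q < tm_states M \<and> length cs = tm_tapes M \<and> set cs \<subseteq> C"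
    have ext: "ext cs i \<in> C" if "i < K" for i
      using * that by (auto simp: ext_def M_def)
    have "ctl (ext cs) (dec q) \<in> conts main" if "\<not> q < 3"
      using ctl_conts[OF dec_in] that * by (simp add: M_def)
    then show "fst (tm_delta M q cs) < tm_states M"
      using code_lt[OF conts_refl] code_lt by (auto simp: M_def \<delta>_def)
    show "length (snd (tm_delta M q cs)) = tm_tapes M"
      using * by (auto simp: M_def \<delta>_def)
    have "wf_com K C (dec q)" if "\<not> q < 3"
      using wf_conts[OF dec_in wf[folded C_def]] that * by (simp add: M_def)
    then show "fst ` set (snd (tm_delta M q cs)) \<subseteq> C"
      using * emit_in[of K C "dec q" "ext cs"] ext by (auto simp: M_def \<delta>_def)
  qed (use K in \<open>auto simp: M_def\<close>)
  define fin where "fin T \<longleftrightarrow> (\<forall>j\<ge>K. T j = (\<lambda>_. Blank, 0))" for T :: "nat \<Rightarrow> 'a tape"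
  have hd: "map (\<lambda>(t, h). t h) (map T [0..<K]) = map (heads T) [0..<K]" for T :: "nat \<Rightarrow> 'a tape"
    by (simp add: heads_def case_prod_beta)
  have ext_heads: "ext (map (heads T) [0..<K]) = heads T" if "fin T" for T
    using that by (auto simp: ext_def fin_def heads_def)
  have stay: "map2 act (map T [0..<K]) (map (\<lambda>c. (c, Stay)) (map (heads T) [0..<K])) = map T [0..<K]"
    for T :: "nat \<Rightarrow> 'a tape"
    by (auto simp: act_Stay intro!: nth_equalityI)
  have main1: "step M (0, map T [0..<K]) = (code main, map T [0..<K])" for T
    using stay[of T] by (simp add: M_def \<delta>_def hd del: map_map)
  have halt: "fst (step M (code Skip, map T [0..<K])) = (if acc (heads T) then 1 else 2)"
    if "Skip \<in> conts main" "fin T" for T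
    using that dec_code[of Skip] ext_heads[of T]
    by (simp add: M_def \<delta>_def hd code_def del: map_map split: prod.splits)
  have step1: "step M (code c, map T [0..<K]) =
      (code (fst (sstep (c, T))), map (snd (sstep (c, T))) [0..<K]) \<and> fin (snd (sstep (c, T)))"
    if c: "c \<in> conts main" "c \<noteq> Skip" and T: "fin T" for c T
  proof
    have "\<delta> (code c) (map (heads T) [0..<K]) = (code (ctl (heads T) c), map (emit (heads T) c) [0..<K])"
      using dec_code[OF c(1)] c(2) ext_heads[OF T] by (simp add: \<delta>_def code_def)
    moreover have "map2 act (map T [0..<K]) (map (emit (heads T) c) [0..<K]) =
        map (\<lambda>j. act (T j) (emit (heads T) c j)) [0..<K]"
      by (auto intro!: nth_equalityI)
    ultimately show "step M (code c, map T [0..<K]) =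
        (code (fst (sstep (c, T))), map (snd (sstep (c, T))) [0..<K])"
      by (simp add: hd M_def sstep.simps code_def del: map_map)
    show "fin (snd (sstep (c, T)))"
      unfolding fin_def
    proof (intro allI impI)
      fix j assume j: "K \<le> j"
      have "emit (heads T) c j = (heads T j, Stay)"
        by (rule emit_ge[OF wf_conts[OF c(1) wf] j])
      then have "snd (sstep (c, T)) j = T j" by (simp add: sstep.simps act_Stay)
      then show "snd (sstep (c, T)) j = (\<lambda>_. Blank, 0)" using T j by (simp add: fin_def)
    qed
  qed
  \<comment> \<open>The machine may need fewer steps: \<open>sstep\<close> idles at
    \<open>Skip\<close>, while the machine must stop there to give its verdict.\<close>
  have sim: "\<exists>t'\<le>t. (step M ^^ t') (code c, map T [0..<K]) = (code Skip, map T' [0..<K])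
      \<and> fin T' \<and> Skip \<in> conts main"
    if "(sstep ^^ t) (c, T) = (Skip, T')" "c \<in> conts main" "fin T" for t c T T'
    using that
  proof (induction t arbitrary: c T)
    case 0
    then show ?case by simp
  next
    case (Suc t)
    show ?case
    proof (cases "c = Skip")
      case True
      have "(sstep ^^ k) (Skip, T) = (Skip, T)" for k by (induction k) auto
      then have "T' = T" using Suc.prems True by (metis prod.inject)
      then show ?thesis using True Suc.prems by (intro exI[of _ 0]) auto
    next
      case False
      obtain c1 T1 where s: "sstep (c, T) = (c1, T1)" by fastforce
      have "c1 \<in> conts main" using s ctl_conts[OF Suc.prems(2)] by (auto simp: sstep.simps)
      moreover have "fin T1" using step1[OF Suc.prems(2) False Suc.prems(3)] s by simp
      moreover have "(sstep ^^ t) (c1, T1) = (Skip, T')"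
        using Suc.prems(1) s by (simp add: funpow_Suc_right del: funpow.simps)
      ultimately obtain t' where t': "t' \<le> t"
        "(step M ^^ t') (code c1, map T1 [0..<K]) = (code Skip, map T' [0..<K])" "fin T'" "Skip \<in> conts main"
        using Suc.IH by blast
      have "(step M ^^ Suc t') (code c, map T [0..<K]) = (code Skip, map T' [0..<K])"
        using step1[OF Suc.prems(2) False Suc.prems(3)] s t'(2)
        by (simp add: funpow_Suc_right del: funpow.simps step.simps)
      then show ?thesis using t' by (intro exI[of _ "Suc t'"]) auto
    qed
  qed
  \<comment> \<open>Adding 2 to the polynomial multiplies the bound by 4, which pays for the first
    step and for the verdict.\<close>
  have "decides_in_time M L (\<lambda>n. 2 ^ poly (p + 2) n)"
    unfolding decides_in_time_def
  proof
    fix w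
    obtain T t where t: "t \<le> 2 ^ poly p (length w)" "(sstep ^^ t) (main, start_tapes w) = (Skip, T)"
      and acc: "acc (heads T) \<longleftrightarrow> w \<in> L"
      using run[of w] by (auto simp: runs_def)
    have init: "initial M w = (0, map (start_tapes w) [0..<K])"
      using K by (auto simp: initial_def M_def start_tapes_def nth_Cons split: nat.splits
        intro!: nth_equalityI)
    have "fin (start_tapes w)" using K by (auto simp: fin_def start_tapes_def)
    from sim[OF t(2) conts_refl this] obtain t' where t': "t' \<le> t" "Skip \<in> conts main" "fin T"
      "(step M ^^ t') (code main, map (start_tapes w) [0..<K]) = (code Skip, map T [0..<K])" by blast
    have "(step M ^^ Suc (t' + 1)) (initial M w) = step M (code Skip, map T [0..<K])"
      unfolding init funpow_add funpow.simps(2)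
      using main1[of "start_tapes w"] t'(4) by (simp del: step.simps)
    then have "fst ((step M ^^ Suc (t' + 1)) (initial M w)) = (if w \<in> L then tm_accept M else tm_reject M)"
      using halt[OF t'(2,3)] acc by (simp add: M_def)
    moreover have "Suc (t' + 1) \<le> 2 ^ poly (p + 2) (length w)"
    proof -
      have "1 \<le> (2::nat) ^ poly p (length w)" by simp
      moreover have "(2::nat) ^ poly (p + 2) (length w) = 2 ^ poly p (length w) * 4"
        by (simp add: power_add)
      ultimately show ?thesis using t(1) t'(1) by linarith
    qed
    ultimately show "\<exists>t\<le>2 ^ poly (p + 2) (length w). fst ((step M ^^ t) (initial M w)) =
        (if w \<in> L then tm_accept M else tm_reject M)" by blast
  qed
  then show ?thesis unfolding EXPTIME_def using tm by blast
qed

subsection \<open>Tapes as counters and bit arrays\<close>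

text \<open>A tape is used as a counter, the position of its head, and as an array of bits, its contents. The
  symbols 2 and 3 stand for the bits in cell 0, so that the counter can be tested for 0. Tape 0 keeps
  the input.\<close>

type_synonym store = "(nat \<Rightarrow> nat) \<times> (nat \<Rightarrow> nat \<Rightarrow> bool)"

definition cell_of :: "bool \<Rightarrow> bool \<Rightarrow> 'a cell" where
  "cell_of orig v = (if orig then Work (if v then 3 else 2) else if v then Work 1 else Blank)"

definition conc :: "nat \<Rightarrow> 'a list \<Rightarrow> store \<Rightarrow> nat \<Rightarrow> 'a tape" where
  "conc K w s j =
    (if j = 0 then (fst (input_tape w), int (fst s 0))
     else if j < K then
       (\<lambda>i. if i < 0 then Blank else cell_of (i = 0) (snd s j (nat i)), int (fst s j))
     else (\<lambda>_. Blank, 0))"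

definition nz :: "nat \<Rightarrow> (nat \<Rightarrow> 'a cell) \<Rightarrow> bool" where
  "nz j h \<longleftrightarrow> h j \<noteq> Work 2 \<and> h j \<noteq> Work 3"

definition bt :: "nat \<Rightarrow> (nat \<Rightarrow> 'a cell) \<Rightarrow> bool" where
  "bt j h \<longleftrightarrow> h j = Work 1 \<or> h j = Work 3"

definition inp :: "'a \<Rightarrow> (nat \<Rightarrow> 'a cell) \<Rightarrow> bool" where
  "inp a h \<longleftrightarrow> h 0 = Input a"

text \<open>Tape 0 is excluded: its cell 0 carries no origin mark, so its head position cannot be
  tested for 0. The input head is therefore always moved in step with a counter.\<close>

lemma heads_conc:
  assumes "0 < j" "j < K"
  shows "nz j (heads (conc K w (p, b))) \<longleftrightarrow> p j \<noteq> 0"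
    and "bt j (heads (conc K w (p, b))) \<longleftrightarrow> b j (p j)"
  using assms by (auto simp: nz_def bt_def heads_def conc_def cell_of_def)

lemma inp_conc: "inp a (heads (conc K w (p, b))) \<longleftrightarrow> p 0 < length w \<and> w ! p 0 = a"
  by (auto simp: inp_def heads_def conc_def input_tape_def)

definition inc :: "nat \<Rightarrow> 'a com" where "inc j = Act j (\<lambda>c. (c, GoRight))"
definition dec :: "nat \<Rightarrow> 'a com" where "dec j = Act j (\<lambda>c. (c, GoLeft))"
definition setb :: "nat \<Rightarrow> bool \<Rightarrow> 'a com" where
  "setb j v = Act j (\<lambda>c. (cell_of (c = Work 2 \<or> c = Work 3) v, Stay))"

text \<open>Sequencing, and loops with at most a power of \<open>N + 2\<close> many rounds, only add to the exponent \<open>k\<close>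
  of the time bound.\<close>

definition R :: "nat \<Rightarrow> nat \<Rightarrow> 'a list \<Rightarrow> nat \<Rightarrow> 'a com \<Rightarrow> store \<Rightarrow> store \<Rightarrow> bool" where
  "R K N w k c s s' \<longleftrightarrow> runs ((N + 2) ^ k) c (conc K w s) (conc K w s')"

lemma R_mono: "R K N w k c s s' \<Longrightarrow> k \<le> l \<Longrightarrow> R K N w l c s s'"
  unfolding R_def by (erule runs_mono) (simp add: power_increasing)

lemma R_Skip: "R K N w k Skip s s"
  unfolding R_def by (rule runs_mono[OF runs_Skip]) simp

lemma R_Act:
  "(conc K w s)(j := act (conc K w s j) (f (heads (conc K w s) j))) = conc K w s' \<Longrightarrow>
    R K N w k (Act j f) s s'"
  unfolding R_def using runs_Act[of j f "conc K w s"] by (auto intro: runs_mono[of 1])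

lemma R_inc: "j < K \<Longrightarrow> R K N w k (inc j) (p, b) (p(j := p j + 1), b)"
  unfolding inc_def by (rule R_Act) (auto simp: fun_eq_iff conc_def heads_def)

lemma R_dec: "j < K \<Longrightarrow> 0 < p j \<Longrightarrow> R K N w k (dec j) (p, b) (p(j := p j - 1), b)"
  unfolding dec_def by (rule R_Act) (auto simp: fun_eq_iff conc_def heads_def)

lemma R_setb:
  "0 < j \<Longrightarrow> j < K \<Longrightarrow> R K N w k (setb j v) (p, b) (p, b(j := (b j)(p j := v)))"
  unfolding setb_def by (rule R_Act) (auto simp: fun_eq_iff conc_def heads_def cell_of_def)

text \<open>Both times are at least 1, so their sum plus 1 is at most three times their product, and
  3 is at most \<open>(N + 2) ^ 2\<close>.\<close>

lemma R_Seq: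
  assumes "R K N w k c s s'" and "R K N w l d s' s''"
  shows "R K N w (k + l + 2) (c ;; d) s s''"
proof -
  let ?M = "N + 2"
  have "?M ^ k * 1 + 1 * ?M ^ l + 1 \<le> ?M ^ k * ?M ^ l + ?M ^ k * ?M ^ l + ?M ^ k * ?M ^ l"
    by (intro add_mono mult_mono) (auto simp: Suc_leI)
  also have "\<dots> = ?M ^ k * ?M ^ l * 3" by simp
  also have "\<dots> \<le> ?M ^ k * ?M ^ l * (?M * ?M)"
    using mult_le_mono[of 2 ?M 2 ?M] by (intro mult_left_mono) auto
  also have "\<dots> = ?M ^ (k + l + 2)" by (simp only: power_add power2_eq_square)
  finally have "?M ^ k + ?M ^ l + 1 \<le> ?M ^ (k + l + 2)" by (simp only: mult_1 mult_1_right)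
  then show ?thesis
    using runs_Seq[OF assms[unfolded R_def]] unfolding R_def by (rule runs_mono[rotated])
qed

lemma R_Cond:
  assumes "R K N w k (if t (heads (conc K w s)) then c else d) s s'"
  shows "R K N w (k + 1) (Cond t c d) s s'"
proof -
  have "Suc ((N + 2) ^ k) \<le> (N + 2) ^ k + (N + 2) ^ k" by (simp add: Suc_leI)
  also have "\<dots> \<le> (N + 2) ^ (k + 1)" by simp
  finally show ?thesis
    using runs_Cond[where b = t and T = "conc K w s", OF assms[unfolded R_def]] unfolding R_def
    by (rule runs_mono[rotated])
qed

text \<open>\<open>S i\<close> is the store after \<open>i\<close> rounds. With
  \<open>A = (N + 2) ^ k\<close> and \<open>B = (N + 2) ^ l\<close> the loop costs at most
  \<open>4 * A * B\<close>, and the constant 4 is absorbed by the three extra factors.\<close>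

lemma R_While:
  assumes step: "\<And>i. i < a \<Longrightarrow> t (heads (conc K w (S i))) \<and> R K N w k c (S i) (S (Suc i))"
    and stop: "\<not> t (heads (conc K w (S a)))" and a: "a \<le> (N + 2) ^ l"
  shows "R K N w (k + l + 3) (While t c) (S 0) (S a)"
proof -
  let ?M = "N + 2"
  \<comment> \<open>A run of a loop is assembled from its end, so \<open>i\<close> counts the rounds
    still to come.\<close>
  have "runs (i * (?M ^ k + 2) + 1) (While t c) (conc K w (S (a - i))) (conc K w (S a))"
    if "i \<le> a" for i
    using that
  proof (induction i)
    case 0
    then show ?case using runs_While_False[of t "conc K w (S a)" c] stop by simp
  next
    case (Suc i)
    have "runs (?M ^ k) c (conc K w (S (a - Suc i))) (conc K w (S (a - i)))"
      using step[of "a - Suc i"] Suc.prems by (simp add: R_def Suc_diff_Suc)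
    from runs_While_True[OF _ this Suc.IH] show ?case
      using step[of "a - Suc i"] Suc.prems by (simp add: algebra_simps)
  qed
  from this[of a] have "runs (a * (?M ^ k + 2) + 1) (While t c) (conc K w (S 0)) (conc K w (S a))"
    by simp
  moreover have "a * (?M ^ k + 2) + 1 \<le> ?M ^ (k + l + 3)"
  proof -
    have arith: "a * (A + 2) + 1 \<le> B * A * 4" if "a \<le> B" "1 \<le> A" "1 \<le> B" for A B :: nat
    proof -
      have "a * (A + 2) \<le> B * (A * 3)" using that by (intro mult_mono) auto
      moreover have "1 * 1 \<le> B * A" using that by (intro mult_mono) auto
      ultimately show ?thesis by linarith
    qed
    have "a * (?M ^ k + 2) + 1 \<le> ?M ^ l * ?M ^ k * 4"
      using a by (intro arith) auto
    also have "\<dots> \<le> ?M ^ l * ?M ^ k * ?M ^ 3"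
      using power_mono[of 2 ?M 3] by (intro mult_left_mono) auto
    also have "\<dots> = ?M ^ (k + l + 3)" by (simp add: power_add)
    finally show ?thesis .
  qed
  ultimately show ?thesis unfolding R_def by (rule runs_mono)
qed

section \<open>Loops driven by counters\<close>

definition put :: "nat \<Rightarrow> nat \<Rightarrow> store \<Rightarrow> store" where
  "put j v s = ((fst s)(j := v), snd s)"

lemma put_Pair [simp]: "put j v (p, b) = (p(j := v), b)"
  by (simp add: put_def)

lemma put_put: "put j v (put j v' s) = put j v s"
  and put_commute: "i \<noteq> j \<Longrightarrow> put i u (put j v s) = put j v (put i u s)"
  by (auto simp: put_def fun_upd_twist)

lemma fst_put: "fst (put j v s) = (fst s)(j := v)" and snd_put [simp]: "snd (put j v s) = snd s"
  by (auto simp: put_def)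

lemma heads_conc':
  assumes "0 < j" "j < K"
  shows "nz j (heads (conc K w s)) \<longleftrightarrow> fst s j \<noteq> 0"
    and "bt j (heads (conc K w s)) \<longleftrightarrow> snd s j (fst s j)"
  using heads_conc[OF assms, of w "fst s" "snd s"] by simp_all

lemma R_inc': "j < K \<Longrightarrow> R K N w k (inc j) s (put j (fst s j + 1) s)"
  using R_inc[of j K N w k "fst s" "snd s"] by (cases s) simp

lemma R_dec': "j < K \<Longrightarrow> 0 < fst s j \<Longrightarrow> R K N w k (dec j) s (put j (fst s j - 1) s)"
  using R_dec[of j K "fst s" N w k "snd s"] by (cases s) simp

definition move :: "nat \<Rightarrow> nat \<Rightarrow> 'a com" where
  "move x u = While (nz x) (dec x ;; inc u)"

lemma R_move:
  assumes "x \<noteq> u" "0 < x" "x < K" "u < K" "a \<le> (N + 2) ^ l"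
  shows "R K N w (l + 5) (move x u) (put x a (put u c s)) (put x 0 (put u (c + a) s))"
proof -
  let ?S = "\<lambda>i. put x (a - i) (put u (c + i) s)"
  have "R K N w (2 + l + 3) (move x u) (?S 0) (?S a)"
    unfolding move_def
  proof (rule R_While, intro conjI)
    fix i assume i: "i < a"
    show "nz x (heads (conc K w (?S i)))" using i assms by (simp add: heads_conc' fst_put)
    have "R K N w (0 + 0 + 2) (dec x ;; inc u) (?S i) (put u (fst (put x (a - i - 1) (?S i)) u + 1) (put x (a - i - 1) (?S i)))"
      using R_Seq[OF R_dec'[of x K "?S i" N w 0] R_inc'[of u K N w 0 "put x (fst (?S i) x - 1) (?S i)"]]
        assms i by (simp add: fst_put)
    moreover have "put u (fst (put x (a - i - 1) (?S i)) u + 1) (put x (a - i - 1) (?S i)) = ?S (Suc i)"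
      using assms by (auto simp: put_def fun_eq_iff)
    ultimately show "R K N w 2 (dec x ;; inc u) (?S i) (?S (Suc i))" by (simp only: add_0)
  qed (use assms in \<open>auto simp: heads_conc' fst_put\<close>)
  then show ?thesis by (simp add: add.commute)
qed

definition rewind :: "nat \<Rightarrow> 'a com" where
  "rewind x = While (nz x) (dec x)"

lemma R_rewind:
  assumes "0 < x" "x < K" "fst s x \<le> (N + 2) ^ l"
  shows "R K N w (l + 3) (rewind x) s (put x 0 s)"
proof -
  let ?a = "fst s x"
  let ?S = "\<lambda>i. put x (?a - i) s"
  have "R K N w (0 + l + 3) (rewind x) (?S 0) (?S ?a)"
    unfolding rewind_def
  proof (rule R_While, intro conjI)
    fix i assume i: "i < ?a"
    show "nz x (heads (conc K w (?S i)))" using i assms by (simp add: heads_conc' fst_put)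
    show "R K N w 0 (dec x) (?S i) (?S (Suc i))"
      using R_dec'[of x K "?S i" N w 0] assms i by (simp add: fst_put put_put)
  qed (use assms in \<open>auto simp: heads_conc' fst_put\<close>)
  moreover have "?S 0 = s" by (simp add: put_def)
  ultimately show ?thesis by simp
qed

text \<open>Reading a counter means counting it down. Its value is therefore carried over to
  \<open>u\<close> while \<open>c\<close> runs and is brought back afterwards; in between,
  \<open>c\<close> sees the value split between the two registers.\<close>

definition rep :: "nat \<Rightarrow> nat \<Rightarrow> 'a com \<Rightarrow> 'a com" where
  "rep x u c = While (nz x) (dec x ;; inc u ;; c) ;; move u x"

lemma R_rep:
  assumes "x \<noteq> u" "0 < x" "x < K" "0 < u" "u < K" "a \<le> (N + 2) ^ l"
    and body: "\<And>i. i < a \<Longrightarrow>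
      R K N w k c (put x (a - Suc i) (put u (Suc i) (S i))) (put x (a - Suc i) (put u (Suc i) (S (Suc i))))"
  shows "R K N w (k + 2 * l + 14) (rep x u c) (put x a (put u 0 (S 0))) (put x a (put u 0 (S a)))"
proof -
  let ?S = "\<lambda>i. put x (a - i) (put u i (S i))"
  have 1: "R K N w (k + 4 + l + 3) (While (nz x) (dec x ;; inc u ;; c)) (?S 0) (?S a)"
  proof (rule R_While, intro conjI)
    fix i assume i: "i < a"
    show "nz x (heads (conc K w (?S i)))" using i assms by (simp add: heads_conc' fst_put)
    have 1: "R K N w 0 (dec x) (?S i) (put x (a - Suc i) (put u i (S i)))"
      using R_dec'[of x K "?S i" N w 0] assms i by (simp add: fst_put put_put)
    have 2: "R K N w 0 (inc u) (put x (a - Suc i) (put u i (S i))) (put x (a - Suc i) (put u (Suc i) (S i)))"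
      using R_inc'[of u K N w 0 "put x (a - Suc i) (put u i (S i))"] assms
      by (simp add: fst_put put_commute[of u x] put_put)
    show "R K N w (k + 4) (dec x ;; inc u ;; c) (?S i) (?S (Suc i))"
      using R_Seq[OF 1 R_Seq[OF 2 body[OF i]]] by (rule R_mono) simp
  qed (use assms in \<open>auto simp: heads_conc' fst_put\<close>)
  have 2: "R K N w (l + 5) (move u x) (?S a) (put x a (put u 0 (S a)))"
    using R_move[of u x K a N l w 0 "S a"] assms by (simp add: put_commute[of u x])
  show ?thesis
    using R_mono[OF R_Seq[OF 1 2], of "k + 2 * l + 14"] unfolding rep_def by simp
qed

text \<open>The body comes before the test because the round for \<open>u = N\<close> must still be
  run. As the mark on the tape ends the loop, the program itself does not depend on
  \<open>N\<close>.\<close>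

definition repall :: "nat \<Rightarrow> 'a com \<Rightarrow> 'a com" where
  "repall u c = c ;; While (\<lambda>h. \<not> bt u h) (inc u ;; c) ;; rewind u"

lemma R_repall:
  assumes "0 < u" "u < K"
    and marks: "\<And>i. i \<le> Suc N \<Longrightarrow> snd (S i) u = (\<lambda>x. x = N)"
    and body: "\<And>i. i \<le> N \<Longrightarrow> R K N w k c (put u i (S i)) (put u i (S (Suc i)))"
  shows "R K N w (2 * k + 14) (repall u c) (put u 0 (S 0)) (put u 0 (S (Suc N)))"
proof -
  let ?S = "\<lambda>i. put u i (S (Suc i))"
  have 1: "R K N w (k + 2 + 1 + 3) (While (\<lambda>h. \<not> bt u h) (inc u ;; c)) (?S 0) (?S N)"
  proof (rule R_While, intro conjI)
    fix i assume i: "i < N"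
    show "\<not> bt u (heads (conc K w (?S i)))" using i assms by (simp add: heads_conc' fst_put)
    have 1: "R K N w 0 (inc u) (?S i) (put u (Suc i) (S (Suc i)))"
      using R_inc'[of u K N w 0 "?S i"] assms by (simp add: fst_put put_put)
    show "R K N w (k + 2) (inc u ;; c) (?S i) (?S (Suc i))"
      using R_Seq[OF 1 body[of "Suc i"]] i by simp
  qed (use assms in \<open>auto simp: heads_conc' fst_put\<close>)
  have 2: "R K N w (1 + 3) (rewind u) (?S N) (put u 0 (S (Suc N)))"
    using R_rewind[of u K "?S N" N 1 w] assms by (simp add: fst_put put_put)
  show ?thesis
    using R_mono[OF R_Seq[OF body[of 0] R_Seq[OF 1 2]], of "2 * k + 14"]
    unfolding repall_def by simp
qed

section \<open>Bounded first-order formulas over tables\<close>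

datatype 'a fo =
    FLt nat nat
  | FIn 'a nat
  | FCall nat "nat list"
  | FRec "nat list"
  | FNeg "'a fo"
  | FAnd "'a fo" "'a fo"
  | FEx "'a fo"

text \<open>Variables are de Bruijn levels: variable \<open>i\<close> is entry \<open>i\<close> of the environment, and a quantifier
  appends its variable at the end. Recursive calls are admissible only at an earlier stage, the stage
  being variable 0.\<close>

primrec sem :: "'a list \<Rightarrow> nat \<Rightarrow> (nat \<Rightarrow> nat list \<Rightarrow> bool) \<Rightarrow> nat \<Rightarrow> 'a fo \<Rightarrow> nat list \<Rightarrow> bool" where
  "sem w N A k (FLt x y) e = (e ! x < e ! y)"
| "sem w N A k (FIn a x) e = (e ! x < length w \<and> w ! (e ! x) = a)"
| "sem w N A k (FCall j vs) e = A j (map ((!) e) vs)"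
| "sem w N A k (FRec vs) e = (e ! hd vs < e ! 0 \<and> A k (map ((!) e) vs))"
| "sem w N A k (FNeg f) e = (\<not> sem w N A k f e)"
| "sem w N A k (FAnd f g) e = (sem w N A k f e \<and> sem w N A k g e)"
| "sem w N A k (FEx f) e = (\<exists>a\<le>N. sem w N A k f (e @ [a]))"

primrec wf_fo :: "(nat \<Rightarrow> nat) \<Rightarrow> nat \<Rightarrow> 'a fo \<Rightarrow> nat \<Rightarrow> bool" where
  "wf_fo ar k (FLt x y) d = (x < d \<and> y < d)"
| "wf_fo ar k (FIn a x) d = (x < d)"
| "wf_fo ar k (FCall j vs) d = (j < k \<and> length vs = ar j \<and> set vs \<subseteq> {..<d})"
| "wf_fo ar k (FRec vs) d = (0 < d \<and> vs \<noteq> [] \<and> length vs = ar k \<and> set vs \<subseteq> {..<d})"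
| "wf_fo ar k (FNeg f) d = wf_fo ar k f d"
| "wf_fo ar k (FAnd f g) d = (wf_fo ar k f d \<and> wf_fo ar k g d)"
| "wf_fo ar k (FEx f) d = wf_fo ar k f (Suc d)"

text \<open>Tape 1 holds the value of the last evaluated formula in cell 0, tape \<open>2 + k\<close> table \<open>k\<close>, whose entry
  for \<open>vs\<close> is in cell \<open>addr N vs\<close>, and tape \<open>cr m i\<close> is the register of variable \<open>i\<close>, where \<open>m\<close> is the
  number of tables. The only bit set in a register is that of cell \<open>N\<close>, which delimits the loops.\<close>

primrec addr :: "nat \<Rightarrow> nat list \<Rightarrow> nat" where
  "addr N [] = 0"
| "addr N (v # vs) = v + (N + 1) * addr N vs"

lemma addr_less: "set vs \<subseteq> {..N} \<Longrightarrow> addr N vs < (N + 1) ^ length vs"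
proof (induction vs)
  case (Cons v vs)
  then have "v + (N + 1) * addr N vs < (N + 1) + (N + 1) * addr N vs" by simp
  also have "\<dots> = (N + 1) * Suc (addr N vs)" by simp
  also have "\<dots> \<le> (N + 1) * (N + 1) ^ length vs" using Cons by (intro mult_left_mono) auto
  finally show ?case by simp
qed simp

lemma addr_inject:
  "length vs = length us \<Longrightarrow> set vs \<subseteq> {..N} \<Longrightarrow> set us \<subseteq> {..N} \<Longrightarrow> addr N vs = addr N us \<Longrightarrow> vs = us"
proof (induction vs us rule: list_induct2)
  case (Cons x xs y ys)
  have eq: "x + (N + 1) * addr N xs = y + (N + 1) * addr N ys" using Cons.prems by simp
  have lt: "x < N + 1" "y < N + 1" using Cons.prems by auto
  have "(x + (N + 1) * addr N xs) mod (N + 1) = x" "(y + (N + 1) * addr N ys) mod (N + 1) = y"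
    using lt by (simp_all only: mod_mult_self2 mod_less)
  then have "x = y" using eq by simp
  then have "(N + 1) * addr N xs = (N + 1) * addr N ys" using eq by linarith
  then have "addr N xs = addr N ys" unfolding mult_cancel1 by simp
  then show ?case using Cons \<open>x = y\<close> by simp
qed simp

section \<open>Table addresses and the evaluation of formulas\<close>

definition cr :: "nat \<Rightarrow> nat \<Rightarrow> nat" where "cr m i = m + 2 + i"

lemma cr_eq [simp]: "cr m i = cr m j \<longleftrightarrow> i = j" by (simp add: cr_def)
lemma cr_gt [simp]: "0 < cr m i" "t < m + 2 \<Longrightarrow> t \<noteq> cr m i" "t < m + 2 \<Longrightarrow> cr m i \<noteq> t" "cr m i < m + 2 + r \<longleftrightarrow> i < r"
  "cr m i < Suc (Suc (m + r)) \<longleftrightarrow> i < r"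
  by (auto simp: cr_def)

text \<open>Moves the head of tape \<open>t\<close> by \<open>(N + 1) ^ l\<close>, the weight of
  digit \<open>l\<close> in an address. No arithmetic is involved: \<open>l\<close> nested loops of
  \<open>N + 1\<close> rounds each surround a single \<open>inc\<close>.\<close>

primrec shiftN :: "nat \<Rightarrow> nat \<Rightarrow> nat \<Rightarrow> nat \<Rightarrow> 'a com" where
  "shiftN m 0 u t = inc t"
| "shiftN m (Suc l) u t = repall (cr m u) (shiftN m l (Suc u) t)"

text \<open>The order of the quantifiers matters: the exponent is chosen before \<open>N\<close>,
  the word and the contents of the tapes. The later time bounds have the same form, and so the total
  time is a fixed power of \<open>N + 2\<close>.\<close>

lemma R_shiftN:
  "\<exists>k. \<forall>r u N (w :: 'a list) p b. u + l \<le> r \<longrightarrow>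
    (\<forall>i. u \<le> i \<longrightarrow> i < u + l \<longrightarrow> p (cr m i) = 0 \<and> b (cr m i) = (\<lambda>x. x = N)) \<longrightarrow> t < m + 2 \<longrightarrow>
    R (m + 2 + r) N w k (shiftN m l u t) (p, b) (p(t := p t + (N + 1) ^ l), b)"
proof (induction l)
  case 0
  show ?case
  proof (intro exI[of _ 0] allI impI)
    fix r u N and w :: "'a list" and p :: "nat \<Rightarrow> nat" and b :: "nat \<Rightarrow> nat \<Rightarrow> bool"
    assume "t < m + 2"
    then show "R (m + 2 + r) N w 0 (shiftN m 0 u t) (p, b) (p(t := p t + (N + 1) ^ 0), b)"
      using R_inc[of t "m + 2 + r" N w 0 p b] by simp
  qed
next
  case (Suc l)
  from Suc.IH obtain k where "\<forall>r u N (w :: 'a list) p b. u + l \<le> r \<longrightarrow>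
    (\<forall>i. u \<le> i \<longrightarrow> i < u + l \<longrightarrow> p (cr m i) = 0 \<and> b (cr m i) = (\<lambda>x. x = N)) \<longrightarrow> t < m + 2 \<longrightarrow>
    R (m + 2 + r) N w k (shiftN m l u t) (p, b) (p(t := p t + (N + 1) ^ l), b)"
    by (rule exE)
  note IH = this[rule_format]
  show ?case
  proof (intro exI[of _ "2 * k + 14"] allI impI)
    fix r u N and w :: "'a list" and p :: "nat \<Rightarrow> nat" and b :: "nat \<Rightarrow> nat \<Rightarrow> bool"
    assume r: "u + Suc l \<le> r" and t: "t < m + 2"
      and z: "\<forall>i. u \<le> i \<longrightarrow> i < u + Suc l \<longrightarrow> p (cr m i) = 0 \<and> b (cr m i) = (\<lambda>x. x = N)"
    define S where "S i = (p(t := p t + i * (N + 1) ^ l), b)" for i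
    have "R (m + 2 + r) N w (2 * k + 14) (shiftN m (Suc l) u t) (put (cr m u) 0 (S 0)) (put (cr m u) 0 (S (Suc N)))"
      unfolding shiftN.simps
    proof (rule R_repall)
      fix i assume "i \<le> N"
      have "R (m + 2 + r) N w k (shiftN m l (Suc u) t) (fst (put (cr m u) i (S i)), b)
        ((fst (put (cr m u) i (S i)))(t := fst (put (cr m u) i (S i)) t + (N + 1) ^ l), b)"
        using r t z by (intro IH) (auto simp: S_def)
      moreover have "(fst (put (cr m u) i (S i)))(t := fst (put (cr m u) i (S i)) t + (N + 1) ^ l)
          = fst (put (cr m u) i (S (Suc i)))"
        using t by (auto simp: S_def fun_eq_iff)
      ultimately show "R (m + 2 + r) N w k (shiftN m l (Suc u) t) (put (cr m u) i (S i)) (put (cr m u) i (S (Suc i)))"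
        by (simp only:) (simp add: S_def)
    qed (use r z in \<open>auto simp: S_def\<close>)
    moreover have "put (cr m u) 0 (S 0) = (p, b)"
      using z by (auto simp: S_def)
    moreover have "put (cr m u) 0 (S (Suc N)) = (p(t := p t + (N + 1) ^ Suc l), b)"
      using z t by (auto simp: S_def fun_eq_iff)
    ultimately show "R (m + 2 + r) N w (2 * k + 14) (shiftN m (Suc l) u t) (p, b) (p(t := p t + (N + 1) ^ Suc l), b)"
      by simp
  qed
qed

text \<open>For each argument, the weight of its digit is added as often as the digit says. Register
  \<open>u\<close> takes the units of the argument in \<open>rep\<close>, and the registers above
  \<open>u\<close> drive the loops of \<open>shiftN\<close>.\<close>

primrec goto :: "nat \<Rightarrow> nat \<Rightarrow> nat \<Rightarrow> nat list \<Rightarrow> nat \<Rightarrow> 'a com" where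
  "goto m u t [] = (\<lambda>l. Skip)"
| "goto m u t (v # vs) = (\<lambda>l. rep (cr m v) (cr m u) (shiftN m l (Suc u) t) ;; goto m u t vs (Suc l))"

lemma R_goto:
  "\<exists>k. \<forall>r N (w :: 'a list) p b. Suc u + l + length vs \<le> r \<longrightarrow>
    (\<forall>i. u \<le> i \<longrightarrow> i < r \<longrightarrow> p (cr m i) = 0 \<and> b (cr m i) = (\<lambda>x. x = N)) \<longrightarrow> t < m + 2 \<longrightarrow>
    (\<forall>v\<in>set vs. v < u \<and> p (cr m v) \<le> N) \<longrightarrow>
    R (m + 2 + r) N w k (goto m u t vs l) (p, b)
      (p(t := p t + (N + 1) ^ l * addr N (map (\<lambda>v. p (cr m v)) vs)), b)"
proof (induction vs arbitrary: l)
  case Nil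
  show ?case by (auto intro!: exI[of _ 0] R_Skip)
next
  case (Cons v vs)
  obtain k1 where "\<forall>r u N (w :: 'a list) p b. u + l \<le> r \<longrightarrow>
    (\<forall>i. u \<le> i \<longrightarrow> i < u + l \<longrightarrow> p (cr m i) = 0 \<and> b (cr m i) = (\<lambda>x. x = N)) \<longrightarrow> t < m + 2 \<longrightarrow>
    R (m + 2 + r) N w k1 (shiftN m l u t) (p, b) (p(t := p t + (N + 1) ^ l), b)"
    using R_shiftN by (rule exE)
  note k1 = this[rule_format]
  obtain k2 where "\<forall>r N (w :: 'a list) p b. Suc u + Suc l + length vs \<le> r \<longrightarrow>
    (\<forall>i. u \<le> i \<longrightarrow> i < r \<longrightarrow> p (cr m i) = 0 \<and> b (cr m i) = (\<lambda>x. x = N)) \<longrightarrow> t < m + 2 \<longrightarrow>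
    (\<forall>v\<in>set vs. v < u \<and> p (cr m v) \<le> N) \<longrightarrow>
    R (m + 2 + r) N w k2 (goto m u t vs (Suc l)) (p, b)
      (p(t := p t + (N + 1) ^ Suc l * addr N (map (\<lambda>v. p (cr m v)) vs)), b)"
    using Cons.IH by (rule exE)
  note k2 = this[rule_format]
  show ?case
  proof (intro exI[of _ "k1 + 2 * 1 + 14 + k2 + 2"] allI impI)
    fix r N and w :: "'a list" and p :: "nat \<Rightarrow> nat" and b :: "nat \<Rightarrow> nat \<Rightarrow> bool"
    assume r: "Suc u + l + length (v # vs) \<le> r" and t: "t < m + 2"
      and z: "\<forall>i. u \<le> i \<longrightarrow> i < r \<longrightarrow> p (cr m i) = 0 \<and> b (cr m i) = (\<lambda>x. x = N)"
      and vs: "\<forall>v\<in>set (v # vs). v < u \<and> p (cr m v) \<le> N"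
    define S where "S i = (p(t := p t + i * (N + 1) ^ l), b)" for i
    let ?x = "cr m v" and ?u = "cr m u"
    let ?a = "p ?x"
    have "R (m + 2 + r) N w (k1 + 2 * 1 + 14) (rep ?x ?u (shiftN m l (Suc u) t))
      (put ?x ?a (put ?u 0 (S 0))) (put ?x ?a (put ?u 0 (S ?a)))"
    proof (rule R_rep)
      fix i
      let ?q = "\<lambda>i'. put ?x (?a - Suc i) (put ?u (Suc i) (S i'))"
      have "R (m + 2 + r) N w k1 (shiftN m l (Suc u) t) (fst (?q i), b)
        ((fst (?q i))(t := fst (?q i) t + (N + 1) ^ l), b)"
        using r t z vs by (intro k1) (auto simp: S_def)
      moreover have "(fst (?q i))(t := fst (?q i) t + (N + 1) ^ l) = fst (?q (Suc i))"
        using t by (auto simp: S_def fun_eq_iff)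
      ultimately show "R (m + 2 + r) N w k1 (shiftN m l (Suc u) t) (?q i) (?q (Suc i))"
        by (simp only:) (simp add: S_def)
    qed (use r vs in auto)
    moreover have "put ?x ?a (put ?u 0 (S 0)) = (p, b)"
      using z r by (auto simp: S_def fun_eq_iff)
    moreover have "put ?x ?a (put ?u 0 (S ?a)) = (p(t := p t + ?a * (N + 1) ^ l), b)"
      using z r t by (auto simp: S_def fun_eq_iff)
    ultimately have 1: "R (m + 2 + r) N w (k1 + 2 * 1 + 14) (rep ?x ?u (shiftN m l (Suc u) t))
      (p, b) (p(t := p t + ?a * (N + 1) ^ l), b)" by simp
    let ?p = "p(t := p t + ?a * (N + 1) ^ l)"
    have 2: "R (m + 2 + r) N w k2 (goto m u t vs (Suc l)) (?p, b)
      (?p(t := ?p t + (N + 1) ^ Suc l * addr N (map (\<lambda>v. ?p (cr m v)) vs)), b)"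
      using r t z vs by (intro k2) auto
    have 3: "?p(t := ?p t + (N + 1) ^ Suc l * addr N (map (\<lambda>v. ?p (cr m v)) vs)) =
      p(t := p t + (N + 1) ^ l * addr N (map (\<lambda>v. p (cr m v)) (v # vs)))"
      using t by (simp add: algebra_simps)
    show "R (m + 2 + r) N w (k1 + 2 * 1 + 14 + k2 + 2) (goto m u t (v # vs) l) (p, b)
      (p(t := p t + (N + 1) ^ l * addr N (map (\<lambda>v. p (cr m v)) (v # vs))), b)"
      using R_Seq[OF 1 2[unfolded 3]] by simp
  qed
qed

text \<open>The invariant between evaluations: all heads other than those of the first
  \<open>d\<close> registers rest on cell 0, so the registers from \<open>d\<close> on are free as
  scratch space.\<close>

definition ok :: "nat \<Rightarrow> nat \<Rightarrow> nat \<Rightarrow> nat \<Rightarrow> (nat \<Rightarrow> nat) \<Rightarrow> (nat \<Rightarrow> nat \<Rightarrow> bool) \<Rightarrow> bool" where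
  "ok m r N d p b \<longleftrightarrow> (\<forall>i<r. b (cr m i) = (\<lambda>x. x = N)) \<and> (\<forall>i<d. p (cr m i) \<le> N) \<and>
    (\<forall>j. (\<forall>i<d. j \<noteq> cr m i) \<longrightarrow> p j = 0)"

definition lev :: "nat \<Rightarrow> nat \<Rightarrow> (nat \<Rightarrow> nat) \<Rightarrow> nat list" where
  "lev m d p = map (\<lambda>i. p (cr m i)) [0..<d]"

definition flag :: "(nat \<Rightarrow> nat \<Rightarrow> bool) \<Rightarrow> bool \<Rightarrow> nat \<Rightarrow> nat \<Rightarrow> bool" where
  "flag b v = b(1 := (b 1)(0 := v))"

definition tab :: "nat \<Rightarrow> (nat \<Rightarrow> nat \<Rightarrow> bool) \<Rightarrow> nat \<Rightarrow> nat list \<Rightarrow> bool" where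
  "tab N b k vs = b (2 + k) (addr N vs)"

lemma flag_simps [simp]: "flag (flag b v) v' = flag b v'" "flag b v (cr m i) = b (cr m i)"
  "flag b v (Suc (Suc j)) = b (Suc (Suc j))" "flag b v (Suc 0) 0 = v"
  "tab N (flag b v) = tab N b"
  by (auto simp: flag_def cr_def tab_def fun_eq_iff)

lemma ok_flag [simp]: "ok m r N d p (flag b v) = ok m r N d p b"
  by (simp add: ok_def)

lemma lev_nth [simp]: "x < d \<Longrightarrow> lev m d p ! x = p (cr m x)"
  by (simp add: lev_def)

lemma lev_Suc: "lev m (Suc d) (p(cr m d := a)) = lev m d p @ [a]"
  by (simp add: lev_def)

lemma ok_Suc: "ok m r N d p b \<Longrightarrow> a \<le> N \<Longrightarrow> ok m r N (Suc d) (p(cr m d := a)) b"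
  by (auto simp: ok_def less_Suc_eq)

lemma ok_zero:
  assumes "ok m r N d p b"
  shows "p 0 = 0" "p (Suc 0) = 0" "d \<le> i \<Longrightarrow> p (cr m i) = 0" "k < m \<Longrightarrow> p (2 + k) = 0"
  using assms unfolding ok_def by (auto simp: cr_def)

definition decide :: "((nat \<Rightarrow> 'a cell) \<Rightarrow> bool) \<Rightarrow> 'a com" where
  "decide t = Cond t (setb 1 True) (setb 1 False)"

lemma R_decide:
  assumes "p 1 = 0" "1 < K" "t (heads (conc K w (p, b))) \<longleftrightarrow> v"
  shows "R K N w 1 (decide t) (p, b) (p, flag b v)"
proof -
  have "R K N w 0 (setb 1 v) (p, b) (p, flag b v)"
    using R_setb[of 1 K N w 0 v p b] assms by (simp add: flag_def)
  then have "R K N w 0 (if t (heads (conc K w (p, b))) then setb 1 True else setb 1 False) (p, b) (p, flag b v)"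
    using assms by (cases v) simp_all
  from R_Cond[where t = t, OF this] show ?thesis by (simp add: decide_def)
qed

definition lookup :: "nat \<Rightarrow> nat \<Rightarrow> nat \<Rightarrow> nat list \<Rightarrow> 'a com" where
  "lookup m d j vs = goto m d (2 + j) vs 0 ;; decide (bt (2 + j)) ;; rewind (2 + j)"

text \<open>Both counters go down until one of them is 0, \<open>u\<close> recording the number of
  rounds so that they can be restored. If both arguments are the same register, a round would
  decrement it twice, whence the separate case.\<close>

definition less_com :: "nat \<Rightarrow> nat \<Rightarrow> nat \<Rightarrow> 'a com" where
  "less_com x y u = (if x = y then decide (\<lambda>_. False) else
    While (\<lambda>h. nz x h \<and> nz y h) (dec x ;; dec y ;; inc u) ;; decide (nz y) ;;
    While (nz u) (dec u ;; inc x ;; inc y))"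

primrec compile :: "nat \<Rightarrow> nat \<Rightarrow> 'a fo \<Rightarrow> nat \<Rightarrow> 'a com" where
  "compile m k (FLt x y) = (\<lambda>d. less_com (cr m x) (cr m y) (cr m d))"
| "compile m k (FIn a x) = (\<lambda>d. rep (cr m x) (cr m d) (inc 0) ;; decide (inp a) ;;
    rep (cr m x) (cr m d) (dec 0))"
| "compile m k (FCall j vs) = (\<lambda>d. lookup m d j vs)"
| "compile m k (FRec vs) = (\<lambda>d. less_com (cr m (hd vs)) (cr m 0) (cr m d) ;;
    Cond (bt 1) (lookup m d k vs) Skip)"
| "compile m k (FNeg f) = (\<lambda>d. compile m k f d ;; Cond (bt 1) (setb 1 False) (setb 1 True))"
| "compile m k (FAnd f g) = (\<lambda>d. compile m k f d ;; Cond (bt 1) (compile m k g d) Skip)"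
| "compile m k (FEx f) = (\<lambda>d. compile m k f (Suc d) ;;
    While (\<lambda>h. \<not> bt 1 h \<and> \<not> bt (cr m d) h) (inc (cr m d) ;; compile m k f (Suc d)) ;;
    rewind (cr m d))"

lemma R_less_com:
  assumes "x < d" "y < d" "d < r" and ok: "ok m r N d p b"
  shows "R (m + 2 + r) N w 21 (less_com (cr m x) (cr m y) (cr m d)) (p, b)
    (p, flag b (p (cr m x) < p (cr m y)))"
proof (cases "x = y")
  case True
  have "R (m + 2 + r) N w 1 (decide (\<lambda>_. False)) (p, b) (p, flag b False)"
    using ok_zero[OF ok] by (intro R_decide) auto
  then show ?thesis using True by (auto simp: less_com_def elim: R_mono)
next
  case False
  let ?K = "m + 2 + r" and ?X = "cr m x" and ?Y = "cr m y" and ?U = "cr m d"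
  define a where "a = min (p ?X) (p ?Y)"
  define q where "q i = p(?X := p ?X - i, ?Y := p ?Y - i, ?U := i)" for i
  have U: "p ?U = 0" using ok_zero[OF ok] by simp
  have q0: "q 0 = p" using U by (auto simp: q_def)
  have lt: "?X < ?K" "?Y < ?K" "?U < ?K" using assms by auto
  have ne: "?X \<noteq> ?Y" "?X \<noteq> ?U" "?Y \<noteq> ?U" using assms False by auto
  have aN: "a \<le> (N + 2) ^ 1" using assms by (auto simp: ok_def a_def)
  have 1: "R ?K N w (4 + 1 + 3) (While (\<lambda>h. nz ?X h \<and> nz ?Y h) (dec ?X ;; dec ?Y ;; inc ?U))
      (q 0, b) (q a, b)"
  proof (rule R_While, intro conjI)
    fix i assume i: "i < a"
    show "nz ?X (heads (conc ?K w (q i, b)))" "nz ?Y (heads (conc ?K w (q i, b)))"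
      using i lt ne by (auto simp: heads_conc q_def a_def)
    have 1: "R ?K N w 0 (dec ?X) (q i, b) ((q i)(?X := q i ?X - 1), b)"
      using i lt ne by (intro R_dec) (auto simp: q_def a_def)
    have 2: "R ?K N w 0 (dec ?Y) ((q i)(?X := q i ?X - 1), b) ((q i)(?X := q i ?X - 1, ?Y := ((q i)(?X := q i ?X - 1)) ?Y - 1), b)"
      using i lt ne by (intro R_dec) (auto simp: q_def a_def)
    have 3: "R ?K N w 0 (inc ?U) ((q i)(?X := q i ?X - 1, ?Y := ((q i)(?X := q i ?X - 1)) ?Y - 1), b) (q (Suc i), b)"
      using R_inc[of ?U ?K N w 0 "(q i)(?X := q i ?X - 1, ?Y := ((q i)(?X := q i ?X - 1)) ?Y - 1)" b] i lt ne
      by (auto simp: q_def a_def fun_upd_twist)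
    show "R ?K N w 4 (dec ?X ;; dec ?Y ;; inc ?U) (q i, b) (q (Suc i), b)"
      using R_Seq[OF 1 R_Seq[OF 2 3]] by (rule R_mono) simp
  qed (use lt ne aN in \<open>auto simp: heads_conc q_def a_def\<close>)
  have 2: "R ?K N w 1 (decide (nz ?Y)) (q a, b) (q a, flag b (p ?X < p ?Y))"
    using lt ne ok_zero[OF ok] by (intro R_decide) (auto simp: heads_conc q_def a_def)
  have "R ?K N w (4 + 1 + 3) (While (nz ?U) (dec ?U ;; inc ?X ;; inc ?Y))
      (q (a - 0), flag b (p ?X < p ?Y)) (q (a - a), flag b (p ?X < p ?Y))"
  proof (rule R_While, intro conjI)
    fix i assume i: "i < a"
    let ?b = "flag b (p ?X < p ?Y)" and ?q = "q (a - i)"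
    show "nz ?U (heads (conc ?K w (?q, ?b)))"
      using i lt ne by (auto simp: heads_conc q_def a_def)
    have 1: "R ?K N w 0 (dec ?U) (?q, ?b) (?q(?U := ?q ?U - 1), ?b)"
      using i lt ne by (intro R_dec) (auto simp: q_def a_def)
    note 2 = R_inc[of ?X ?K N w 0 "?q(?U := ?q ?U - 1)" ?b, OF lt(1)]
    note 3 = R_inc[of ?Y ?K N w 0 _ ?b, OF lt(2)]
    have "?q(?U := ?q ?U - 1, ?X := (?q(?U := ?q ?U - 1)) ?X + 1,
      ?Y := (?q(?U := ?q ?U - 1, ?X := (?q(?U := ?q ?U - 1)) ?X + 1)) ?Y + 1) = q (a - Suc i)"
      using i ne by (auto simp: q_def a_def fun_eq_iff)
    then show "R ?K N w 4 (dec ?U ;; inc ?X ;; inc ?Y) (?q, ?b) (q (a - Suc i), ?b)"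
      using R_Seq[OF 1 R_Seq[OF 2 3]] by (simp add: numeral_eq_Suc)
  qed (use lt ne aN in \<open>auto simp: heads_conc q_def\<close>)
  then have 3: "R ?K N w (4 + 1 + 3) (While (nz ?U) (dec ?U ;; inc ?X ;; inc ?Y))
      (q a, flag b (p ?X < p ?Y)) (p, flag b (p ?X < p ?Y))" by (simp add: q0)
  show ?thesis
    using R_Seq[OF 1[unfolded q0] R_Seq[OF 2 3]] ne by (simp add: less_com_def)
qed

lemma R_lookup:
  assumes "j < m" and vs: "set vs \<subseteq> {..<d}"
  shows "\<exists>k. \<forall>r N (w :: 'a list) p b. Suc d + length vs \<le> r \<longrightarrow> ok m r N d p b \<longrightarrow>
    R (m + 2 + r) N w k (lookup m d j vs) (p, b) (p, flag b (tab N b j (map ((!) (lev m d p)) vs)))"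
proof -
  obtain k where "\<forall>r N (w :: 'a list) p b. Suc d + 0 + length vs \<le> r \<longrightarrow>
    (\<forall>i. d \<le> i \<longrightarrow> i < r \<longrightarrow> p (cr m i) = 0 \<and> b (cr m i) = (\<lambda>x. x = N)) \<longrightarrow> 2 + j < m + 2 \<longrightarrow>
    (\<forall>v\<in>set vs. v < d \<and> p (cr m v) \<le> N) \<longrightarrow>
    R (m + 2 + r) N w k (goto m d (2 + j) vs 0) (p, b)
      (p((2 + j) := p (2 + j) + (N + 1) ^ 0 * addr N (map (\<lambda>v. p (cr m v)) vs)), b)"
    using R_goto by (rule exE)
  note goto = this[rule_format]
  show ?thesis
  proof (intro exI[of _ "k + (1 + (length vs + 3) + 2) + 2"] allI impI)
    fix r N and w :: "'a list" and p :: "nat \<Rightarrow> nat" and b :: "nat \<Rightarrow> nat \<Rightarrow> bool"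
    assume r: "Suc d + length vs \<le> r" and ok: "ok m r N d p b"
    let ?K = "m + 2 + r" and ?t = "2 + j"
    define us where "us = map (\<lambda>v. p (cr m v)) vs"
    have us: "map ((!) (lev m d p)) vs = us" using vs by (auto simp: us_def)
    have "set us \<subseteq> {..N}" using vs ok by (auto simp: us_def ok_def)
    from addr_less[OF this] have "addr N us \<le> (N + 1) ^ length vs" by (simp add: us_def)
    also have "\<dots> \<le> (N + 2) ^ length vs" by (intro power_mono) auto
    finally have le: "addr N us \<le> (N + 2) ^ length vs" .
    let ?p = "p(?t := addr N us)"
    have 1: "R ?K N w k (goto m d ?t vs 0) (p, b) (?p, b)"
      using goto[of r p b N w] ok_zero[OF ok] r vs ok assms(1)
      by (auto simp: us_def ok_def subset_eq)
    have 2: "R ?K N w 1 (decide (bt ?t)) (?p, b) (?p, flag b (tab N b j us))"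
      using ok_zero[OF ok] assms by (intro R_decide) (auto simp: heads_conc tab_def)
    have "put ?t 0 (?p, flag b (tab N b j us)) = (p, flag b (tab N b j us))"
      using ok_zero[OF ok] assms by (auto simp: fun_eq_iff)
    then have 3: "R ?K N w (length vs + 3) (rewind ?t) (?p, flag b (tab N b j us)) (p, flag b (tab N b j us))"
      using R_rewind[of ?t ?K "(?p, flag b (tab N b j us))" N "length vs" w] assms le by simp
    show "R ?K N w (k + (1 + (length vs + 3) + 2) + 2) (lookup m d j vs) (p, b)
      (p, flag b (tab N b j (map ((!) (lev m d p)) vs)))"
      using R_Seq[OF 1 R_Seq[OF 2 3]] unfolding lookup_def us .
  qed
qed

text \<open>The truth value ends up in the flag on tape 1. A quantifier at depth \<open>d\<close>
  owns register \<open>d\<close> and adds a loop of at most \<open>N + 1\<close> rounds, so both the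
  exponent \<open>c\<close> and the number \<open>r0\<close> of registers are determined by the
  formula.\<close>

theorem R_comp:
  assumes "wf_fo ar k f d" "k < m"
  shows "\<exists>c r0. \<forall>r N w p b. r0 \<le> r \<longrightarrow> ok m r N d p b \<longrightarrow>
    R (m + 2 + r) N w c (compile m k f d) (p, b) (p, flag b (sem w N (tab N b) k f (lev m d p)))"
  using assms
proof (induction f arbitrary: d)
  case (FLt x y)
  show ?case
  proof (rule exI[of _ 21], rule exI[of _ "Suc d"], intro allI impI)
    fix r N and w :: "'a list" and p :: "nat \<Rightarrow> nat" and b :: "nat \<Rightarrow> nat \<Rightarrow> bool"
    assume *: "Suc d \<le> r" "ok m r N d p b"
    show "R (m + 2 + r) N w 21 (compile m k (FLt x y) d) (p, b)
      (p, flag b (sem w N (tab N b) k (FLt x y) (lev m d p)))"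
      using R_less_com[of x d y r m N p b w] * FLt by simp
  qed
next
  case (FIn a x)
  show ?case
  proof (rule exI[of _ "(0 + 2 * 1 + 14) + (1 + (0 + 2 * 1 + 14) + 2) + 2"], rule exI[of _ "Suc d"], intro allI impI)
    fix r N and w :: "'a list" and p :: "nat \<Rightarrow> nat" and b :: "nat \<Rightarrow> nat \<Rightarrow> bool"
    assume r: "Suc d \<le> r" and ok: "ok m r N d p b"
    let ?K = "m + 2 + r" and ?x = "cr m x" and ?u = "cr m d"
    let ?a = "p ?x" and ?b = "flag b (p ?x < length w \<and> w ! p ?x = a)"
    have x: "x < d" using FIn by simp
    have lt: "?x < ?K" "?u < ?K" "?x \<noteq> ?u" using x r by auto
    have a: "?a \<le> (N + 2) ^ 1" using ok x by (auto simp: ok_def)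
    have zero: "p 0 = 0" "p 1 = 0" "p ?u = 0" using ok_zero[OF ok] by auto
    define S where "S i b' = (p(0 := i), b')" for i and b' :: "nat \<Rightarrow> nat \<Rightarrow> bool"
    have 1: "R ?K N w (0 + 2 * 1 + 14) (rep ?x ?u (inc 0)) (put ?x ?a (put ?u 0 (S 0 b))) (put ?x ?a (put ?u 0 (S ?a b)))"
    proof (rule R_rep)
      fix i
      show "R ?K N w 0 (inc 0) (put ?x (?a - Suc i) (put ?u (Suc i) (S i b)))
         (put ?x (?a - Suc i) (put ?u (Suc i) (S (Suc i) b)))"
        using R_inc'[of 0 ?K N w 0 "put ?x (?a - Suc i) (put ?u (Suc i) (S i b))"]
        by (simp add: S_def fun_upd_twist fun_upd_def fun_eq_iff cong: if_cong)
          (auto simp: cr_def elim!: back_subst[of "R _ _ _ _ _ _"] intro!: ext)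
    qed (use lt a in auto)
    have e0: "put ?x ?a (put ?u 0 (S 0 b)) = (p, b)" using zero by (auto simp: S_def fun_eq_iff)
    have e1: "put ?x ?a (put ?u 0 (S ?a b')) = (p(0 := ?a), b')" for b'
      using zero by (auto simp: S_def fun_eq_iff)
    have 2: "R ?K N w 1 (decide (inp a)) (p(0 := ?a), b) (p(0 := ?a), ?b)"
      using zero by (intro R_decide) (auto simp: inp_conc)
    have 3: "R ?K N w (0 + 2 * 1 + 14) (rep ?x ?u (dec 0)) (put ?x ?a (put ?u 0 (S (?a - 0) ?b))) (put ?x ?a (put ?u 0 (S (?a - ?a) ?b)))"
    proof (rule R_rep)
      fix i assume i: "i < ?a"
      show "R ?K N w 0 (dec 0) (put ?x (?a - Suc i) (put ?u (Suc i) (S (?a - i) ?b)))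
         (put ?x (?a - Suc i) (put ?u (Suc i) (S (?a - Suc i) ?b)))"
        using R_dec'[of 0 ?K "put ?x (?a - Suc i) (put ?u (Suc i) (S (?a - i) ?b))" N w 0] i
        by (simp add: S_def cr_def fun_upd_twist)
    qed (use lt a in auto)
    have e2: "put ?x ?a (put ?u 0 (S (?a - ?a) ?b)) = (p, ?b)" using zero by (auto simp: S_def fun_eq_iff)
    show "R ?K N w ((0 + 2 * 1 + 14) + (1 + (0 + 2 * 1 + 14) + 2) + 2) (compile m k (FIn a x) d) (p, b)
      (p, flag b (sem w N (tab N b) k (FIn a x) (lev m d p)))"
      using R_Seq[OF 1[unfolded e0 e1] R_Seq[OF 2 3[unfolded e1 e2 diff_zero]]] x by simp
  qed
next
  case (FCall j vs)
  then have "j < m" "set vs \<subseteq> {..<d}" by auto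
  from R_lookup[OF this] obtain c where "\<forall>r N (w :: 'a list) p b. Suc d + length vs \<le> r \<longrightarrow> ok m r N d p b \<longrightarrow>
    R (m + 2 + r) N w c (lookup m d j vs) (p, b) (p, flag b (tab N b j (map ((!) (lev m d p)) vs)))"
    by (rule exE)
  note c = this
  show ?case
    by (rule exI[of _ c], rule exI[of _ "Suc d + length vs"])
      (use c in \<open>simp only: compile.simps sem.simps\<close>)
next
  case (FRec vs)
  then have "set vs \<subseteq> {..<d}" and hd: "hd vs < d" "0 < d" by (auto simp: subset_eq)
  from R_lookup[OF \<open>k < m\<close> this(1)] obtain c where "\<forall>r N (w :: 'a list) p b. Suc d + length vs \<le> r \<longrightarrow> ok m r N d p b \<longrightarrow>
    R (m + 2 + r) N w c (lookup m d k vs) (p, b) (p, flag b (tab N b k (map ((!) (lev m d p)) vs)))"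
    by (rule exE)
  note c = this[rule_format]
  show ?case
  proof (rule exI[of _ "21 + (c + 1) + 2"], rule exI[of _ "Suc d + length vs"], intro allI impI)
    fix r N and w :: "'a list" and p :: "nat \<Rightarrow> nat" and b :: "nat \<Rightarrow> nat \<Rightarrow> bool"
    assume r: "Suc d + length vs \<le> r" and ok: "ok m r N d p b"
    let ?v = "p (cr m (hd vs)) < p (cr m 0)"
    have 1: "R (m + 2 + r) N w 21 (less_com (cr m (hd vs)) (cr m 0) (cr m d)) (p, b) (p, flag b ?v)"
      using R_less_com[OF hd _ ok] r by simp
    have t: "bt 1 (heads (conc (m + 2 + r) w (p, flag b ?v))) \<longleftrightarrow> ?v"
      using ok_zero[OF ok] by (simp add: heads_conc)
    have "R (m + 2 + r) N w c (if bt 1 (heads (conc (m + 2 + r) w (p, flag b ?v))) then lookup m d k vs else Skip)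
      (p, flag b ?v) (p, flag b (sem w N (tab N b) k (FRec vs) (lev m d p)))"
      unfolding t using c[OF r, of N p "flag b ?v" w] ok hd by (auto simp: R_Skip)
    from R_Seq[OF 1 R_Cond[where t = "bt 1", OF this]]
    show "R (m + 2 + r) N w (21 + (c + 1) + 2) (compile m k (FRec vs) d) (p, b)
      (p, flag b (sem w N (tab N b) k (FRec vs) (lev m d p)))" by simp
  qed
next
  case (FNeg f)
  from FNeg.IH[OF FNeg.prems(1)[unfolded wf_fo.simps] FNeg.prems(2)]
  obtain c r0 where "\<forall>r N w p b. r0 \<le> r \<longrightarrow> ok m r N d p b \<longrightarrow>
    R (m + 2 + r) N w c (compile m k f d) (p, b) (p, flag b (sem w N (tab N b) k f (lev m d p)))"
    by (elim exE)
  note c = this[rule_format]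
  show ?case
  proof (rule exI[of _ "c + (0 + 1) + 2"], rule exI[of _ r0], intro allI impI)
    fix r N and w :: "'a list" and p :: "nat \<Rightarrow> nat" and b :: "nat \<Rightarrow> nat \<Rightarrow> bool"
    assume r: "r0 \<le> r" and ok: "ok m r N d p b"
    let ?v = "sem w N (tab N b) k f (lev m d p)"
    have t: "bt 1 (heads (conc (m + 2 + r) w (p, flag b ?v))) \<longleftrightarrow> ?v"
      using ok_zero[OF ok] by (simp add: heads_conc)
    have "R (m + 2 + r) N w 0 (if bt 1 (heads (conc (m + 2 + r) w (p, flag b ?v))) then setb 1 False else setb 1 True)
      (p, flag b ?v) (p, flag b (\<not> ?v))"
      unfolding t using R_setb[of 1 "m + 2 + r" N w 0 "\<not> ?v" p "flag b ?v"] ok_zero[OF ok]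
      by (auto simp: flag_def)
    from R_Seq[OF c[OF r ok] R_Cond[where t = "bt 1", OF this]]
    show "R (m + 2 + r) N w (c + (0 + 1) + 2) (compile m k (FNeg f) d) (p, b)
      (p, flag b (sem w N (tab N b) k (FNeg f) (lev m d p)))" by simp
  qed
next
  case (FAnd f g)
  obtain c1 r1 where "\<forall>r N w p b. r1 \<le> r \<longrightarrow> ok m r N d p b \<longrightarrow>
    R (m + 2 + r) N w c1 (compile m k f d) (p, b) (p, flag b (sem w N (tab N b) k f (lev m d p)))"
    using FAnd.IH(1)[OF FAnd.prems(1)[unfolded wf_fo.simps, THEN conjunct1] FAnd.prems(2)] by (elim exE)
  note c1 = this[rule_format]
  obtain c2 r2 where "\<forall>r N w p b. r2 \<le> r \<longrightarrow> ok m r N d p b \<longrightarrow>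
    R (m + 2 + r) N w c2 (compile m k g d) (p, b) (p, flag b (sem w N (tab N b) k g (lev m d p)))"
    using FAnd.IH(2)[OF FAnd.prems(1)[unfolded wf_fo.simps, THEN conjunct2] FAnd.prems(2)] by (elim exE)
  note c2 = this[rule_format]
  show ?case
  proof (rule exI[of _ "c1 + (c2 + 1) + 2"], rule exI[of _ "max r1 r2"], intro allI impI)
    fix r N and w :: "'a list" and p :: "nat \<Rightarrow> nat" and b :: "nat \<Rightarrow> nat \<Rightarrow> bool"
    assume r: "max r1 r2 \<le> r" and ok: "ok m r N d p b"
    let ?v = "sem w N (tab N b) k f (lev m d p)"
    have t: "bt 1 (heads (conc (m + 2 + r) w (p, flag b ?v))) \<longleftrightarrow> ?v"
      using ok_zero[OF ok] by (simp add: heads_conc)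
    have "R (m + 2 + r) N w c2 (if bt 1 (heads (conc (m + 2 + r) w (p, flag b ?v))) then compile m k g d else Skip)
      (p, flag b ?v) (p, flag b (?v \<and> sem w N (tab N b) k g (lev m d p)))"
      unfolding t using c2[of r N p "flag b ?v" w] r ok by (auto simp: R_Skip)
    from R_Seq[OF c1[OF _ ok] R_Cond[where t = "bt 1", OF this]]
    show "R (m + 2 + r) N w (c1 + (c2 + 1) + 2) (compile m k (FAnd f g) d) (p, b)
      (p, flag b (sem w N (tab N b) k (FAnd f g) (lev m d p)))" using r by simp
  qed
next
  case (FEx f)
  obtain c r0 where "\<forall>r N w p b. r0 \<le> r \<longrightarrow> ok m r N (Suc d) p b \<longrightarrow>
    R (m + 2 + r) N w c (compile m k f (Suc d)) (p, b) (p, flag b (sem w N (tab N b) k f (lev m (Suc d) p)))"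
    using FEx.IH[OF FEx.prems(1)[unfolded wf_fo.simps] FEx.prems(2)] by (elim exE)
  note c = this[rule_format]
  show ?case
  proof (rule exI[of _ "c + ((c + 2) + 1 + 3 + (1 + 3) + 2) + 2"], rule exI[of _ "max r0 (Suc d)"], intro allI impI)
    fix r N and w :: "'a list" and p :: "nat \<Rightarrow> nat" and b :: "nat \<Rightarrow> nat \<Rightarrow> bool"
    assume r: "max r0 (Suc d) \<le> r" and ok: "ok m r N d p b"
    let ?K = "m + 2 + r" and ?u = "cr m d"
    define v where "v i = sem w N (tab N b) k f (lev m d p @ [i])" for i
    have u: "?u < ?K" using r by simp
    have zero: "p 1 = 0" "p ?u = 0" using ok_zero[OF ok] by auto
    have marks: "b ?u = (\<lambda>x. x = N)" using ok r by (auto simp: ok_def)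
    have body: "R ?K N w c (compile m k f (Suc d)) (p(?u := i), flag b x) (p(?u := i), flag b (v i))"
      if "i \<le> N" for i x
      using c[of r N "p(?u := i)" "flag b x" w] r ok_Suc[OF ok that] by (simp add: lev_Suc v_def)
    have body0: "R ?K N w c (compile m k f (Suc d)) (p, b) (p(?u := 0), flag b (v 0))"
      using c[of r N "p(?u := 0)" b w] r ok_Suc[OF ok, of 0] zero
      by (simp add: lev_Suc v_def) (metis fun_upd_triv)
    \<comment> \<open>The loop stops at the least witness, or at \<open>N\<close> if there is none;
      in either case the last value of the flag is that of the quantified formula.\<close>
    define a where "a = (if \<exists>i\<le>N. v i then LEAST i. v i else N)"
    have aN: "a \<le> N" unfolding a_def by (auto intro: Least_le[THEN order_trans])
    have before: "\<not> v i \<and> i < N" if "i < a" for i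
      using that aN unfolding a_def by (auto split: if_splits dest: not_less_Least)
    have va: "v a \<longleftrightarrow> (\<exists>i\<le>N. v i)"
      unfolding a_def by (auto intro: LeastI)
    have 1: "R ?K N w (c + 2 + 1 + 3)
      (While (\<lambda>h. \<not> bt 1 h \<and> \<not> bt ?u h) (inc ?u ;; compile m k f (Suc d)))
      (p(?u := 0), flag b (v 0)) (p(?u := a), flag b (v a))"
    proof (rule R_While, intro conjI)
      fix i assume i: "i < a"
      show "\<not> bt 1 (heads (conc ?K w (p(?u := i), flag b (v i))))"
        "\<not> bt ?u (heads (conc ?K w (p(?u := i), flag b (v i))))"
        using before[OF i] zero u marks by (auto simp: heads_conc)
      have 1: "R ?K N w 0 (inc ?u) (p(?u := i), flag b (v i)) (p(?u := Suc i), flag b (v i))"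
        using R_inc[OF u, of N w 0 "p(?u := i)"] by simp
      show "R ?K N w (c + 2) (inc ?u ;; compile m k f (Suc d)) (p(?u := i), flag b (v i)) (p(?u := Suc i), flag b (v (Suc i)))"
        using R_Seq[OF 1 body[of "Suc i"]] i aN by simp
    next
      show "\<not> (\<not> bt 1 (heads (conc ?K w (p(?u := a), flag b (v a)))) \<and>
        \<not> bt ?u (heads (conc ?K w (p(?u := a), flag b (v a)))))"
        using zero u marks va by (auto simp: heads_conc a_def)
      show "a \<le> (N + 2) ^ 1" using aN by simp
    qed
    have 2: "R ?K N w (1 + 3) (rewind ?u) (p(?u := a), flag b (v a)) (p, flag b (v a))"
      using R_rewind[of ?u ?K "(p(?u := a), flag b (v a))" N 1 w] u aN zero
      by simp (metis fun_upd_triv)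
    show "R ?K N w (c + ((c + 2) + 1 + 3 + (1 + 3) + 2) + 2) (compile m k (FEx f) d) (p, b)
      (p, flag b (sem w N (tab N b) k (FEx f) (lev m d p)))"
      using R_Seq[OF body0 R_Seq[OF 1 2]] va by (simp add: v_def)
  qed
qed

subsection \<open>Filling the tables\<close>

definition tuples :: "nat \<Rightarrow> nat \<Rightarrow> nat list set" where
  "tuples n N = {vs. length vs = n \<and> set vs \<subseteq> {..N}}"

text \<open>The guard of \<open>FRec\<close> hides all entries of table \<open>k\<close> except
  those with a smaller first component. Hence a table can be filled in any order in which the first
  component never decreases.\<close>

lemma sem_cong:
  assumes "wf_fo ar k f d" "0 < d" "e \<in> tuples d N"
    and "\<And>j us. j < k \<Longrightarrow> us \<in> tuples (ar j) N \<Longrightarrow> A j us = A' j us"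
    and "\<And>us. us \<in> tuples (ar k) N \<Longrightarrow> hd us < e ! 0 \<Longrightarrow> A k us = A' k us"
  shows "sem w N A k f e = sem w N A' k f e"
  using assms
proof (induction f arbitrary: d e)
  case (FCall j vs)
  then have "map ((!) e) vs \<in> tuples (ar j) N" by (auto simp: tuples_def subset_eq)
  then show ?case using FCall by simp
next
  case (FRec vs)
  then have "map ((!) e) vs \<in> tuples (ar k) N" by (auto simp: tuples_def subset_eq)
  then show ?case using FRec by (auto simp: hd_map)
next
  case (FEx f)
  have "sem w N A k f (e @ [a]) = sem w N A' k f (e @ [a])" if "a \<le> N" for a
    using FEx.prems that by (intro FEx.IH[of "Suc d"]) (auto simp: tuples_def nth_append)
  then show ?case by auto
qed (simp; metis)+

text \<open>\<open>R_nest\<close> only asserts that some suitable store results, as the flag and the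
  entries outside \<open>D\<close> are left open, while \<open>R_repall\<close> expects a whole
  sequence of stores. This chooses them round by round.\<close>

lemma seq_choice:
  assumes "P 0 x0" and "\<And>a x. a \<le> N \<Longrightarrow> P a x \<Longrightarrow> \<exists>y. P (Suc a) y \<and> Q a x y"
  obtains S where "S 0 = x0" "\<And>a. a \<le> Suc N \<Longrightarrow> P a (S a)" "\<And>a. a \<le> N \<Longrightarrow> Q a (S a) (S (Suc a))"
proof -
  define S where "S = rec_nat x0 (\<lambda>a x. SOME y. P (Suc a) y \<and> Q a x y)"
  have S: "S 0 = x0" "S (Suc a) = (SOME y. P (Suc a) y \<and> Q a (S a) y)" for a
    by (simp_all add: S_def)
  have P: "P a (S a)" if "a \<le> Suc N" for a
    using that
  proof (induction a)
    case (Suc a)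
    then show ?case using someI_ex[OF assms(2)[of a "S a"]] by (simp add: S(2))
  qed (simp add: S(1) assms(1))
  have "Q a (S a) (S (Suc a))" if "a \<le> N" for a
    using someI_ex[OF assms(2)[OF that P]] that by (simp add: S(2))
  then show thesis using S(1) P that by blast
qed

definition leaf :: "nat \<Rightarrow> nat \<Rightarrow> nat \<Rightarrow> 'a fo \<Rightarrow> 'a com" where
  "leaf m n k f = compile m k f n ;; goto m n (2 + k) [0..<n] 0 ;;
    Cond (bt 1) (setb (2 + k) True) (setb (2 + k) False) ;; rewind (2 + k)"

lemma R_leaf:
  assumes wf: "wf_fo ar k f n" and k: "k < m"
  shows "\<exists>c r0. \<forall>r N (w :: 'a list) p b. r0 \<le> r \<longrightarrow> ok m r N n p b \<longrightarrow>
    R (m + 2 + r) N w c (leaf m n k f) (p, b)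
      (p, (flag b (sem w N (tab N b) k f (lev m n p)))
        (2 + k := (b (2 + k))(addr N (lev m n p) := sem w N (tab N b) k f (lev m n p))))"
proof -
  from R_comp[OF assms] obtain c1 r1 where "\<forall>r N (w :: 'a list) p b. r1 \<le> r \<longrightarrow> ok m r N n p b \<longrightarrow>
    R (m + 2 + r) N w c1 (compile m k f n) (p, b) (p, flag b (sem w N (tab N b) k f (lev m n p)))"
    by (elim exE)
  note c1 = this[rule_format]
  obtain c2 where "\<forall>r N (w :: 'a list) p b. Suc n + 0 + length [0..<n] \<le> r \<longrightarrow>
    (\<forall>i. n \<le> i \<longrightarrow> i < r \<longrightarrow> p (cr m i) = 0 \<and> b (cr m i) = (\<lambda>x. x = N)) \<longrightarrow> 2 + k < m + 2 \<longrightarrow>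
    (\<forall>v\<in>set [0..<n]. v < n \<and> p (cr m v) \<le> N) \<longrightarrow>
    R (m + 2 + r) N w c2 (goto m n (2 + k) [0..<n] 0) (p, b)
      (p((2 + k) := p (2 + k) + (N + 1) ^ 0 * addr N (map (\<lambda>v. p (cr m v)) [0..<n])), b)"
    using R_goto by (rule exE)
  note goto = this[rule_format]
  show ?thesis
  proof (rule exI[of _ "c1 + (c2 + (0 + 1 + (n + 3) + 2) + 2) + 2"], rule exI[of _ "max r1 (Suc n + n)"], intro allI impI)
    fix r N and w :: "'a list" and p :: "nat \<Rightarrow> nat" and b :: "nat \<Rightarrow> nat \<Rightarrow> bool"
    assume r: "max r1 (Suc n + n) \<le> r" and ok: "ok m r N n p b"
    let ?K = "m + 2 + r" and ?t = "2 + k"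
    define us where "us = lev m n p"
    define v where "v = sem w N (tab N b) k f us"
    let ?b = "flag b v"
    let ?b' = "?b(?t := (?b ?t)(addr N us := v))"
    have "set us \<subseteq> {..N}" using ok by (auto simp: us_def ok_def lev_def)
    from addr_less[OF this] have "addr N us \<le> (N + 1) ^ n" by (simp add: us_def lev_def)
    also have "\<dots> \<le> (N + 2) ^ n" by (intro power_mono) auto
    finally have le: "addr N us \<le> (N + 2) ^ n" .
    let ?p = "p(?t := addr N us)"
    have 0: "R ?K N w c1 (compile m k f n) (p, b) (p, ?b)"
      using c1[of r N p b w] r ok by (simp add: v_def us_def)
    have 1: "R ?K N w c2 (goto m n ?t [0..<n] 0) (p, ?b) (?p, ?b)"
      using goto[of r p ?b N w] ok_zero[OF ok] r ok k
      by (auto simp: us_def ok_def lev_def)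
    have t: "bt 1 (heads (conc ?K w (?p, ?b))) \<longleftrightarrow> v"
      using ok_zero[OF ok] by (simp add: heads_conc)
    have "R ?K N w 0 (setb ?t v) (?p, ?b) (?p, ?b')"
      using R_setb[of ?t ?K N w 0 v ?p ?b] k by simp
    then have "R ?K N w 0 (if bt 1 (heads (conc ?K w (?p, ?b))) then setb ?t True else setb ?t False)
      (?p, ?b) (?p, ?b')"
      unfolding t by (cases v) simp_all
    note 2 = R_Cond[where t = "bt 1", OF this]
    have "put ?t 0 (?p, ?b') = (p, ?b')"
      using ok_zero[OF ok] k by (auto simp: fun_eq_iff)
    then have 3: "R ?K N w (n + 3) (rewind ?t) (?p, ?b') (p, ?b')"
      using R_rewind[of ?t ?K "(?p, ?b')" N n w] k le by simp
    show "R ?K N w (c1 + (c2 + (0 + 1 + (n + 3) + 2) + 2) + 2) (leaf m n k f) (p, b)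
      (p, (flag b (sem w N (tab N b) k f (lev m n p)))
        (?t := (b ?t)(addr N (lev m n p) := sem w N (tab N b) k f (lev m n p))))"
      using R_Seq[OF 0 R_Seq[OF 1 R_Seq[OF 2 3]]] unfolding leaf_def us_def[symmetric] v_def[symmetric]
      by simp
  qed
qed

primrec nest :: "nat \<Rightarrow> 'a com \<Rightarrow> nat \<Rightarrow> nat \<Rightarrow> 'a com" where
  "nest m c 0 = (\<lambda>i. c)"
| "nest m c (Suc j) = (\<lambda>i. repall (cr m i) (nest m c j (Suc i)))"

text \<open>\<open>D\<close> holds the tuples whose entries are final. Tape 1 is exempt because the
  flag changes with every evaluation.\<close>

definition good :: "nat \<Rightarrow> nat \<Rightarrow> nat \<Rightarrow> (nat \<Rightarrow> nat \<Rightarrow> bool) \<Rightarrow> (nat list \<Rightarrow> bool) \<Rightarrow> nat list set \<Rightarrow>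
    (nat \<Rightarrow> nat \<Rightarrow> bool) \<Rightarrow> bool" where
  "good n N k b0 P D b \<longleftrightarrow> (\<forall>t. t \<noteq> 1 \<longrightarrow> t \<noteq> 2 + k \<longrightarrow> b t = b0 t) \<and>
    (\<forall>vs \<in> tuples n N \<inter> D. tab N b k vs = P vs)"

lemma lev_tuples: "ok m r N d p b \<Longrightarrow> lev m d p \<in> tuples d N"
  by (auto simp: lev_def tuples_def ok_def)

lemma take_Suc_eq: "i < length vs \<Longrightarrow> take (Suc i) vs = e @ [a] \<longleftrightarrow> take i vs = e \<and> vs ! i = a"
  by (simp add: take_Suc_conv_app_nth)

text \<open>Induction on the number \<open>j\<close> of loops still to be entered, with the current
  prefix of the tuple in the registers below \<open>i\<close>. Once the outermost loop is entered,
  the entries with a smaller first component must be final, for recursive calls may consult them.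
  \<open>A\<close> is the intended system of tables and \<open>b0\<close> the store before table
  \<open>k\<close> is begun.\<close>

lemma R_nest:
  assumes wf: "wf_fo ar k f n" and k: "k < m" and n: "n = ar k" "0 < n"
  shows "i + j = n \<Longrightarrow> \<exists>c r0. \<forall>r N (w :: 'a list) p b0 b D A. r0 \<le> r \<longrightarrow> ok m r N i p b0 \<longrightarrow>
    (\<forall>j<k. \<forall>us \<in> tuples (ar j) N. tab N b0 j us = A j us) \<longrightarrow>
    (\<forall>us \<in> tuples n N. A k us = sem w N A k f us) \<longrightarrow>
    (0 < i \<longrightarrow> (\<forall>us \<in> tuples n N. hd us < p (cr m 0) \<longrightarrow> us \<in> D)) \<longrightarrow>
    good n N k b0 (A k) D b \<longrightarrow>
    (\<exists>b'. good n N k b0 (A k) (D \<union> {us. take i us = lev m i p}) b' \<and>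
      R (m + 2 + r) N w c (nest m (leaf m n k f) j i) (p, b) (p, b'))"
proof (induction j arbitrary: i)
  case 0
  then have i: "i = n" by simp
  from R_leaf[OF wf k] obtain c r1 where "\<forall>r N (w :: 'a list) p b. r1 \<le> r \<longrightarrow> ok m r N n p b \<longrightarrow>
    R (m + 2 + r) N w c (leaf m n k f) (p, b)
      (p, (flag b (sem w N (tab N b) k f (lev m n p)))
        (2 + k := (b (2 + k))(addr N (lev m n p) := sem w N (tab N b) k f (lev m n p))))"
    by (elim exE)
  note leaf = this[rule_format]
  show ?case
  proof (rule exI[of _ c], rule exI[of _ r1], intro allI impI)
    fix r N and w :: "'a list" and p :: "nat \<Rightarrow> nat" and b0 b :: "nat \<Rightarrow> nat \<Rightarrow> bool" and D A
    assume r: "r1 \<le> r" and ok: "ok m r N i p b0"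
      and tabs: "\<forall>j<k. \<forall>us \<in> tuples (ar j) N. tab N b0 j us = A j us"
      and A: "\<forall>us \<in> tuples n N. A k us = sem w N A k f us"
      and D: "0 < i \<longrightarrow> (\<forall>us \<in> tuples n N. hd us < p (cr m 0) \<longrightarrow> us \<in> D)"
      and good: "good n N k b0 (A k) D b"
    define e where "e = lev m n p"
    have e: "e \<in> tuples n N" using lev_tuples[OF ok] i by (simp add: e_def)
    have b: "b (cr m i) = b0 (cr m i)" for i
      using good k unfolding good_def by (auto simp: cr_def)
    have okb: "ok m r N n p b" using ok i by (simp add: ok_def b)
    have "sem w N (tab N b) k f e = sem w N A k f e"
    proof (rule sem_cong[OF wf _ e])
      show "tab N b j us = A j us" if "j < k" "us \<in> tuples (ar j) N" for j us
        using tabs good that by (simp add: tab_def good_def)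
      show "tab N b k us = A k us" if "us \<in> tuples (ar k) N" "hd us < e ! 0" for us
        using D good that n i by (auto simp: good_def e_def)
    qed fact
    then have v: "sem w N (tab N b) k f e = A k e" using A e by simp
    let ?b = "(flag b (A k e))(2 + k := (b (2 + k))(addr N e := A k e))"
    have "R (m + 2 + r) N w c (leaf m n k f) (p, b) (p, ?b)"
      using leaf[OF r okb, of w] unfolding e_def[symmetric] v .
    moreover have "good n N k b0 (A k) (D \<union> {us. take i us = lev m i p}) ?b"
      unfolding good_def
    proof (intro conjI allI impI ballI)
      show "?b t = b0 t" if "t \<noteq> 1" "t \<noteq> 2 + k" for t
        using good that by (simp add: good_def flag_def)
      fix us assume us: "us \<in> tuples n N \<inter> (D \<union> {us. take i us = lev m i p})"
      then consider "us = e" | "us \<noteq> e" "us \<in> D" "us \<in> tuples n N"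
        using i by (auto simp: tuples_def e_def)
      then show "tab N ?b k us = A k us"
      proof cases
        case 2
        then have "addr N us \<noteq> addr N e"
          using addr_inject[of us e N] e by (auto simp: tuples_def)
        then show ?thesis using good 2 by (simp add: tab_def good_def)
      qed (simp add: tab_def)
    qed
    ultimately show "\<exists>b'. good n N k b0 (A k) (D \<union> {us. take i us = lev m i p}) b' \<and>
      R (m + 2 + r) N w c (nest m (leaf m n k f) 0 i) (p, b) (p, b')" by auto
  qed
next
  case (Suc j)
  then have "Suc i + j = n" and i: "i < n" by simp_all
  from Suc.IH[OF this(1)] obtain c r1 where "\<forall>r N (w :: 'a list) p b0 b D A. r1 \<le> r \<longrightarrow> ok m r N (Suc i) p b0 \<longrightarrow>
    (\<forall>j<k. \<forall>us \<in> tuples (ar j) N. tab N b0 j us = A j us) \<longrightarrow>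
    (\<forall>us \<in> tuples n N. A k us = sem w N A k f us) \<longrightarrow>
    (0 < Suc i \<longrightarrow> (\<forall>us \<in> tuples n N. hd us < p (cr m 0) \<longrightarrow> us \<in> D)) \<longrightarrow>
    good n N k b0 (A k) D b \<longrightarrow>
    (\<exists>b'. good n N k b0 (A k) (D \<union> {us. take (Suc i) us = lev m (Suc i) p}) b' \<and>
      R (m + 2 + r) N w c (nest m (leaf m n k f) j (Suc i)) (p, b) (p, b'))"
    by (elim exE)
  note IH = this[rule_format]
  show ?case
  proof (rule exI[of _ "2 * c + 14"], rule exI[of _ "max r1 (Suc i)"], intro allI impI)
    fix r N and w :: "'a list" and p :: "nat \<Rightarrow> nat" and b0 b :: "nat \<Rightarrow> nat \<Rightarrow> bool" and D A
    assume r: "max r1 (Suc i) \<le> r" and ok: "ok m r N i p b0"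
      and tabs: "\<forall>j<k. \<forall>us \<in> tuples (ar j) N. tab N b0 j us = A j us"
      and A: "\<forall>us \<in> tuples n N. A k us = sem w N A k f us"
      and D: "0 < i \<longrightarrow> (\<forall>us \<in> tuples n N. hd us < p (cr m 0) \<longrightarrow> us \<in> D)"
      and good: "good n N k b0 (A k) D b"
    let ?u = "cr m i" and ?body = "nest m (leaf m n k f) j (Suc i)" and ?K = "m + 2 + r"
    \<comment> \<open>The tuples whose entries are final before round \<open>a\<close> of this
      loop.\<close>
    define E where "E a = D \<union> {us. take i us = lev m i p \<and> us ! i < a}" for a
    have step: "\<exists>y. good n N k b0 (A k) (E (Suc a)) y \<and> R ?K N w c ?body (p(?u := a), x) (p(?u := a), y)"
      if a: "a \<le> N" and x: "good n N k b0 (A k) (E a) x" for a x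
    proof -
      have "\<exists>y. good n N k b0 (A k) (E a \<union> {us. take (Suc i) us = lev m (Suc i) (p(?u := a))}) y \<and>
        R ?K N w c ?body (p(?u := a), x) (p(?u := a), y)"
      proof (rule IH[where A = A, OF _ ok_Suc[OF ok a] _ _ _ x])
        show "us \<in> E a" if "us \<in> tuples n N" "hd us < (p(?u := a)) (cr m 0)" for us
        \<comment> \<open>In the outermost loop a smaller first component belongs to an earlier
          round; in an inner loop such entries were final before the loop was entered.\<close>
        proof (cases "i = 0")
          case True
          then show ?thesis using that n by (cases us) (auto simp: E_def tuples_def lev_def)
        next
          case False
          then show ?thesis using that D by (auto simp: E_def)
        qed
      qed (use r tabs A in auto)
      moreover have "tuples n N \<inter> (E a \<union> {us. take (Suc i) us = lev m (Suc i) (p(?u := a))}) = tuples n N \<inter> E (Suc a)"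
        using i by (auto simp: E_def lev_Suc tuples_def take_Suc_eq less_Suc_eq)
      ultimately show ?thesis unfolding good_def by simp
    qed
    have E0: "good n N k b0 (A k) (E 0) b" using good by (simp add: E_def)
    obtain B where B: "B 0 = b" "\<And>a. a \<le> Suc N \<Longrightarrow> good n N k b0 (A k) (E a) (B a)"
      "\<And>a. a \<le> N \<Longrightarrow> R ?K N w c ?body (p(?u := a), B a) (p(?u := a), B (Suc a))"
      by (rule seq_choice[where P = "\<lambda>a. good n N k b0 (A k) (E a)" and N = N and
            Q = "\<lambda>a x y. R ?K N w c ?body (p(?u := a), x) (p(?u := a), y)", OF E0]) (erule (1) step, rule that)
    have "R ?K N w (2 * c + 14) (repall ?u ?body) (put ?u 0 (p, B 0)) (put ?u 0 (p, B (Suc N)))"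
    proof (rule R_repall)
      fix a assume "a \<le> Suc N"
      then have "B a ?u = b0 ?u" using B(2)[of a] k unfolding good_def by (auto simp: cr_def)
      then show "snd (p, B a) ?u = (\<lambda>x. x = N)" using ok r by (simp add: ok_def)
    qed (use r B(3) in auto)
    moreover have "p(?u := 0) = p" using ok_zero(3)[OF ok, of i] by (metis fun_upd_triv order_refl)
    ultimately have "R ?K N w (2 * c + 14) (nest m (leaf m n k f) (Suc j) i) (p, b) (p, B (Suc N))"
      by (simp add: B(1))
    moreover have "tuples n N \<inter> (D \<union> {us. take i us = lev m i p}) = tuples n N \<inter> E (Suc N)"
      using i by (auto simp: E_def tuples_def less_Suc_eq_le subset_eq)
    then have "good n N k b0 (A k) (D \<union> {us. take i us = lev m i p}) (B (Suc N))"
      using B(2)[of "Suc N"] unfolding good_def by simp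
    ultimately show "\<exists>b'. good n N k b0 (A k) (D \<union> {us. take i us = lev m i p}) b' \<and>
      R ?K N w (2 * c + 14) (nest m (leaf m n k f) (Suc j) i) (p, b) (p, b')" by blast
  qed
qed

primrec fills :: "nat \<Rightarrow> (nat \<Rightarrow> nat) \<Rightarrow> (nat \<Rightarrow> 'a fo) \<Rightarrow> nat \<Rightarrow> 'a com" where
  "fills m ar fs 0 = Skip"
| "fills m ar fs (Suc k) = fills m ar fs k ;; nest m (leaf m (ar k) k (fs k)) (ar k) 0"

lemma R_fills:
  assumes "\<And>k. k < l \<Longrightarrow> wf_fo ar k (fs k) (ar k) \<and> 0 < ar k" and "l \<le> m"
  shows "\<exists>c r0. \<forall>r N (w :: 'a list) p b A. r0 \<le> r \<longrightarrow> ok m r N 0 p b \<longrightarrow>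
    (\<forall>k<l. \<forall>us \<in> tuples (ar k) N. A k us = sem w N A k (fs k) us) \<longrightarrow>
    (\<exists>b'. ok m r N 0 p b' \<and> (\<forall>k<l. \<forall>us \<in> tuples (ar k) N. tab N b' k us = A k us) \<and>
      R (m + 2 + r) N w c (fills m ar fs l) (p, b) (p, b'))"
  using assms
proof (induction l)
  case 0
  show ?case by (rule exI[of _ 0], rule exI[of _ 0]) (auto intro: R_Skip)
next
  case (Suc l)
  from Suc.IH[OF _ Suc_leD[OF Suc.prems(2)]] Suc.prems(1)
  have "\<exists>c r0. \<forall>r N (w :: 'a list) p b A. r0 \<le> r \<longrightarrow> ok m r N 0 p b \<longrightarrow>
    (\<forall>k<l. \<forall>us \<in> tuples (ar k) N. A k us = sem w N A k (fs k) us) \<longrightarrow>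
    (\<exists>b'. ok m r N 0 p b' \<and> (\<forall>k<l. \<forall>us \<in> tuples (ar k) N. tab N b' k us = A k us) \<and>
      R (m + 2 + r) N w c (fills m ar fs l) (p, b) (p, b'))" by simp
  then obtain c1 r1 where "\<forall>r N (w :: 'a list) p b A. r1 \<le> r \<longrightarrow> ok m r N 0 p b \<longrightarrow>
    (\<forall>k<l. \<forall>us \<in> tuples (ar k) N. A k us = sem w N A k (fs k) us) \<longrightarrow>
    (\<exists>b'. ok m r N 0 p b' \<and> (\<forall>k<l. \<forall>us \<in> tuples (ar k) N. tab N b' k us = A k us) \<and>
      R (m + 2 + r) N w c1 (fills m ar fs l) (p, b) (p, b'))" by (elim exE)
  note c1 = this[rule_format]
  have "wf_fo ar l (fs l) (ar l)" "l < m" "0 < ar l" using Suc.prems by auto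
  from R_nest[OF this(1,2) refl this(3) add_0]
  obtain c2 r2 where "\<forall>r N (w :: 'a list) p b0 b D A. r2 \<le> r \<longrightarrow> ok m r N 0 p b0 \<longrightarrow>
    (\<forall>j<l. \<forall>us \<in> tuples (ar j) N. tab N b0 j us = A j us) \<longrightarrow>
    (\<forall>us \<in> tuples (ar l) N. A l us = sem w N A l (fs l) us) \<longrightarrow>
    (0 < (0::nat) \<longrightarrow> (\<forall>us \<in> tuples (ar l) N. hd us < p (cr m 0) \<longrightarrow> us \<in> D)) \<longrightarrow>
    good (ar l) N l b0 (A l) D b \<longrightarrow>
    (\<exists>b'. good (ar l) N l b0 (A l) (D \<union> {us. take 0 us = lev m 0 p}) b' \<and>
      R (m + 2 + r) N w c2 (nest m (leaf m (ar l) l (fs l)) (ar l) 0) (p, b) (p, b'))"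
    by (elim exE)
  note c2 = this[rule_format]
  show ?case
  proof (rule exI[of _ "c1 + c2 + 2"], rule exI[of _ "max r1 r2"], intro allI impI)
    fix r N and w :: "'a list" and p :: "nat \<Rightarrow> nat" and b :: "nat \<Rightarrow> nat \<Rightarrow> bool" and A
    assume r: "max r1 r2 \<le> r" and ok: "ok m r N 0 p b"
      and A: "\<forall>k<Suc l. \<forall>us \<in> tuples (ar k) N. A k us = sem w N A k (fs k) us"
    obtain b1 where b1: "ok m r N 0 p b1" "\<forall>k<l. \<forall>us \<in> tuples (ar k) N. tab N b1 k us = A k us"
      "R (m + 2 + r) N w c1 (fills m ar fs l) (p, b) (p, b1)"
      using c1[of r N p b A w] r ok A by auto
    have "good (ar l) N l b1 (A l) {} b1" by (simp add: good_def)
    then obtain b2 where b2: "good (ar l) N l b1 (A l) ({} \<union> {us. take 0 us = lev m 0 p}) b2"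
      "R (m + 2 + r) N w c2 (nest m (leaf m (ar l) l (fs l)) (ar l) 0) (p, b1) (p, b2)"
      using c2[of r N p b1 A w "{}" b1] r b1 A by auto
    have "b2 (cr m i) = b1 (cr m i)" for i
      using b2(1) Suc.prems(2) unfolding good_def by (auto simp: cr_def)
    then have "ok m r N 0 p b2" using b1(1) by (simp add: ok_def)
    moreover have "tab N b2 k us = A k us" if "k < Suc l" "us \<in> tuples (ar k) N" for k us
    proof (cases "k = l")
      case True
      then show ?thesis using b2(1) that by (simp add: good_def lev_def)
    next
      case False
      then have "tab N b2 k us = tab N b1 k us" using b2(1) by (simp add: good_def tab_def)
      then show ?thesis using b1(2) that False by simp
    qed
    ultimately show "\<exists>b'. ok m r N 0 p b' \<and> (\<forall>k<Suc l. \<forall>us \<in> tuples (ar k) N. tab N b' k us = A k us) \<and>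
      R (m + 2 + r) N w (c1 + c2 + 2) (fills m ar fs (Suc l)) (p, b) (p, b')"
      using R_Seq[OF b1(3) b2(2)] by (intro exI[of _ b2]) auto
  qed
qed

subsection \<open>Initialisation\<close>

text \<open>A configuration has \<open>length w\<close> digits to the base
  \<open>length w + 1\<close>, so its value is below 2 to the power
  \<open>(length w + 1) * length w\<close>. The square is slightly larger and can be produced by two
  nested loops of \<open>length w + 1\<close> rounds around a doubling.\<close>

definition size_bound :: "'a list \<Rightarrow> nat" where
  "size_bound w = 2 ^ ((length w + 1)\<^sup>2)"

lemma length_less_size_bound: "length w + 1 < size_bound w"
proof -
  have "length w + 1 < 2 ^ (length w + 1)" by (rule less_exp)
  also have "\<dots> \<le> size_bound w"
    unfolding size_bound_def by (intro power_increasing) (auto simp: power2_eq_square)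
  finally show ?thesis .
qed

text \<open>A blank tape already represents an array of zeros with its counter at 0, except that
  cell 0 lacks the origin mark. Until all marks are set the tapes do not have the form
  \<open>conc\<close>, so the run is stated with \<open>runs\<close> instead of
  \<open>R\<close>.\<close>

definition origins :: "nat list \<Rightarrow> 'a com" where
  "origins js = foldr (\<lambda>j c. Act j (\<lambda>_. (cell_of True False, Stay)) ;; c) js Skip"

lemma runs_origins:
  fixes w :: "'a list"
  defines "T S \<equiv> \<lambda>j. if j = 0 then input_tape w
    else if j \<in> S then (\<lambda>i. if i = 0 then cell_of True False else Blank, 0) else (\<lambda>_. Blank, 0)"
  shows "0 \<notin> set js \<Longrightarrow> runs (2 * length js) (origins js) (T S) (T (S \<union> set js))"
proof (induction js arbitrary: S)
  case Nil
  then show ?case using runs_Skip by (simp add: origins_def)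
next
  case (Cons j js)
  have "(T S)(j := act (T S j) (cell_of True False, Stay)) = T (insert j S)"
    using Cons.prems by (auto simp: T_def fun_eq_iff)
  then have 1: "runs 1 (Act j (\<lambda>_. (cell_of True False, Stay))) (T S) (T (insert j S))"
    using runs_Act[of j "\<lambda>_. (cell_of True False, Stay)" "T S"] by simp
  from runs_Seq[OF 1 Cons.IH] show ?case using Cons.prems by (simp add: origins_def)
qed

definition double :: "nat \<Rightarrow> nat \<Rightarrow> 'a com" where
  "double v u = While (nz v) (dec v ;; inc u ;; inc u) ;; move u v"

lemma R_double:
  assumes "v \<noteq> u" "0 < v" "0 < u" "v < K" "u < K" "fst s u = 0" "2 * fst s v \<le> N"
  shows "R K N w 16 (double v u) s (put v (2 * fst s v) s)"
proof -
  let ?x = "fst s v"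
  let ?S = "\<lambda>i. put v (?x - i) (put u (2 * i) s)"
  have 1: "R K N w (4 + 1 + 3) (While (nz v) (dec v ;; inc u ;; inc u)) (?S 0) (?S ?x)"
  proof (rule R_While, intro conjI)
    fix i assume i: "i < ?x"
    show "nz v (heads (conc K w (?S i)))" using i assms by (simp add: heads_conc' fst_put)
    have 1: "R K N w 0 (dec v) (?S i) (put v (?x - Suc i) (?S i))"
      using R_dec'[of v K "?S i" N w 0] assms i by (simp add: fst_put)
    have 2: "R K N w 0 (inc u) (put v (?x - Suc i) (?S i)) (put u (2 * i + 1) (put v (?x - Suc i) (?S i)))"
      using R_inc'[of u K N w 0 "put v (?x - Suc i) (?S i)"] assms by (simp add: fst_put)
    have 3: "R K N w 0 (inc u) (put u (2 * i + 1) (put v (?x - Suc i) (?S i))) (?S (Suc i))"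
      using R_inc'[of u K N w 0 "put u (2 * i + 1) (put v (?x - Suc i) (?S i))"] assms
      by (simp add: fst_put put_put put_commute[of u v])
    show "R K N w 4 (dec v ;; inc u ;; inc u) (?S i) (?S (Suc i))"
      using R_Seq[OF 1 R_Seq[OF 2 3]] by (simp add: numeral_eq_Suc)
  qed (use assms in \<open>auto simp: heads_conc' fst_put\<close>)
  have 2: "R K N w (1 + 5) (move u v) (?S ?x) (put v (2 * ?x) (put u 0 s))"
    using R_move[of u v K "2 * ?x" N 1 w 0 s] assms by (simp add: put_commute[of u v])
  have "?S 0 = s" "put v (2 * ?x) (put u 0 s) = put v (2 * ?x) s"
    using assms by (auto simp: put_def fun_eq_iff prod_eq_iff)
  then show ?thesis using R_Seq[OF 1 2] unfolding double_def by simp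
qed

definition mark :: "nat \<Rightarrow> nat \<Rightarrow> nat \<Rightarrow> 'a com" where
  "mark v u j = While (nz v) (dec v ;; inc u ;; inc j) ;; setb j True ;; rewind j ;; move u v"

lemma R_mark:
  assumes "v \<noteq> u" "v \<noteq> j" "u \<noteq> j" "0 < v" "0 < u" "0 < j" "v < K" "u < K" "j < K"
    and p: "p u = 0" "p j = 0" "p v = N"
  shows "R K N w 25 (mark v u j) (p, b) (p, b(j := (b j)(N := True)))"
proof -
  let ?q = "\<lambda>i. p(v := N - i, u := i, j := i)"
  let ?b = "b(j := (b j)(N := True))"
  have 1: "R K N w (4 + 1 + 3) (While (nz v) (dec v ;; inc u ;; inc j)) (?q 0, b) (?q N, b)"
  proof (rule R_While, intro conjI)
    fix i assume i: "i < N"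
    show "nz v (heads (conc K w (?q i, b)))" using i assms by (simp add: heads_conc)
    have 1: "R K N w 0 (dec v) (?q i, b) (p(v := N - Suc i, u := i, j := i), b)"
      using R_dec[of v K "?q i" N w 0 b] assms i by (simp add: fun_upd_twist)
    have 2: "R K N w 0 (inc u) (p(v := N - Suc i, u := i, j := i), b) (p(v := N - Suc i, u := Suc i, j := i), b)"
      using R_inc[of u K N w 0 "p(v := N - Suc i, u := i, j := i)" b] assms by (simp add: fun_upd_twist)
    have 3: "R K N w 0 (inc j) (p(v := N - Suc i, u := Suc i, j := i), b) (?q (Suc i), b)"
      using R_inc[of j K N w 0 "p(v := N - Suc i, u := Suc i, j := i)" b] assms by (simp add: fun_upd_twist)
    show "R K N w 4 (dec v ;; inc u ;; inc j) (?q i, b) (?q (Suc i), b)"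
      using R_Seq[OF 1 R_Seq[OF 2 3]] by (simp add: numeral_eq_Suc)
  qed (use assms in \<open>auto simp: heads_conc\<close>)
  have 2: "R K N w 0 (setb j True) (?q N, b) (?q N, ?b)"
    using R_setb[of j K N w 0 True "?q N" b] assms by simp
  have 3: "R K N w (1 + 3) (rewind j) (?q N, ?b) (put j 0 (?q N, ?b))"
    using R_rewind[of j K "(?q N, ?b)" N 1 w] assms by simp
  have 4: "R K N w (1 + 5) (move u v) (put u N (put v 0 (p, ?b))) (put u 0 (put v N (p, ?b)))"
    using R_move[of u v K N N 1 w 0 "(p, ?b)"] assms by simp
  have e: "put u N (put v 0 (p, ?b)) = put j 0 (?q N, ?b)" "put u 0 (put v N (p, ?b)) = (p, ?b)" "?q 0 = p"
    using assms by (auto simp: fun_eq_iff)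
  have "R K N w ((4 + 1 + 3) + (0 + ((1 + 3) + (1 + 5) + 2) + 2) + 2) (mark v u j) (p, b) (p, ?b)"
    using R_Seq[OF 1 R_Seq[OF 2 R_Seq[OF 3 4[unfolded e]]]] unfolding mark_def e .
  then show ?thesis by (rule R_mono) simp
qed

definition mark_all :: "nat \<Rightarrow> nat \<Rightarrow> nat list \<Rightarrow> 'a com" where
  "mark_all v u js = foldr (\<lambda>j c. mark v u j ;; c) js Skip"

lemma R_mark_all:
  assumes "v \<noteq> u" "0 < v" "0 < u" "v < K" "u < K" and p: "p u = 0" "p v = N"
  shows "(\<And>j. j \<in> set js \<Longrightarrow> v \<noteq> j \<and> u \<noteq> j \<and> 0 < j \<and> j < K \<and> p j = 0) \<Longrightarrow>
    R K N w (27 * length js) (mark_all v u js) (p, b)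
      (p, \<lambda>j. if j \<in> set js then (b j)(N := True) else b j)"
proof (induction js arbitrary: b)
  case Nil
  then show ?case by (simp add: mark_all_def R_Skip)
next
  case (Cons j js)
  let ?b = "b(j := (b j)(N := True))"
  have 1: "R K N w 25 (mark v u j) (p, b) (p, ?b)"
    using assms Cons.prems by (intro R_mark) auto
  have 2: "R K N w (27 * length js) (mark_all v u js) (p, ?b)
    (p, \<lambda>j. if j \<in> set js then (?b j)(N := True) else ?b j)"
    using Cons.prems by (intro Cons.IH) auto
  have "(\<lambda>i. if i \<in> set js then (?b i)(N := True) else ?b i) =
    (\<lambda>i. if i \<in> set (j # js) then (b i)(N := True) else b i)"
    by (auto simp: fun_eq_iff)
  from R_Seq[OF 1 2, unfolded this] show ?case
    by (simp add: mark_all_def add.commute)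
qed

text \<open>With counters \<open>v\<close>, \<open>u\<close>, \<open>a\<close>, \<open>d\<close>, \<open>c\<close>: scan the input to set \<open>a = d = length w + 1\<close>, double
  \<open>v = 1\<close> altogether \<open>a * d\<close> times, and mark the cell reached by \<open>v\<close> on all counters.\<close>

definition prepare :: "nat \<Rightarrow> nat \<Rightarrow> 'a com" where
  "prepare m r = (let v = cr m 0; u = cr m 1; a = cr m 2; d = cr m 3; c = cr m 4 in
    While (\<lambda>h. h 0 \<noteq> Blank) (inc 0 ;; inc a ;; inc d ;; inc c) ;;
    While (nz c) (dec c ;; dec 0) ;;
    inc a ;; inc d ;; inc v ;;
    While (nz a) (dec a ;; rep d c (double v u)) ;;
    rewind d ;;
    mark_all v u (map (cr m) [2..<r]) ;; mark_all v c [u] ;; setb v True ;; rewind v)"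

lemma R_prepare:
  fixes w :: "'a list"
  assumes r: "5 \<le> r" and N: "N = size_bound w"
  shows "R (m + 2 + r) N w (300 + 27 * r) (prepare m r) (\<lambda>_. 0, \<lambda>_ _. False)
    (\<lambda>_. 0, \<lambda>j x. x = N \<and> (\<exists>i<r. j = cr m i))"
proof -
  define n where "n = length w"
  define v u a d c where regs: "v = cr m 0" "u = cr m 1" "a = cr m 2" "d = cr m 3" "c = cr m 4"
  let ?K = "m + 2 + r"
  have lt: "v < ?K" "u < ?K" "a < ?K" "d < ?K" "c < ?K" "0 < ?K" using r by (auto simp: regs)
  have pos: "0 < v" "0 < u" "0 < a" "0 < d" "0 < c" by (auto simp: regs)
  have ne: "v \<noteq> u" "v \<noteq> a" "v \<noteq> d" "v \<noteq> c" "u \<noteq> a" "u \<noteq> d" "u \<noteq> c" "a \<noteq> d" "a \<noteq> c" "d \<noteq> c"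
    "u \<noteq> v" "a \<noteq> v" "d \<noteq> v" "c \<noteq> v" "a \<noteq> u" "d \<noteq> u" "c \<noteq> u" "d \<noteq> a" "c \<noteq> a" "c \<noteq> d"
    by (auto simp: regs)
  have nN: "n + 1 \<le> N" using length_less_size_bound[of w] N by (simp add: n_def)
  define b :: "nat \<Rightarrow> nat \<Rightarrow> bool" where "b = (\<lambda>_ _. False)"
  define z :: "nat \<Rightarrow> nat" where "z = (\<lambda>_. 0)"
  note facts = lt pos ne nN
  have 1: "R ?K N w (6 + 1 + 3) (While (\<lambda>h. h 0 \<noteq> Blank) (inc 0 ;; inc a ;; inc d ;; inc c))
    (z(0 := 0, a := 0, d := 0, c := 0), b) (z(0 := n, a := n, d := n, c := n), b)"
  proof (rule R_While[where S = "\<lambda>i. (z(0 := i, a := i, d := i, c := i), b)"], intro conjI)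
    fix i assume i: "i < n"
    show "heads (conc ?K w (z(0 := i, a := i, d := i, c := i), b)) 0 \<noteq> Blank"
      using i facts by (auto simp: heads_conc conc_def heads_def input_tape_def n_def)
    have 1: "R ?K N w 0 (inc 0) (z(0 := i, a := i, d := i, c := i), b) (z(0 := Suc i, a := i, d := i, c := i), b)"
      using R_inc[of 0 ?K N w 0 "z(0 := i, a := i, d := i, c := i)" b] facts by (simp add: fun_upd_twist)
    have 2: "R ?K N w 0 (inc a) (z(0 := Suc i, a := i, d := i, c := i), b) (z(0 := Suc i, a := Suc i, d := i, c := i), b)"
      using R_inc[of a ?K N w 0 "z(0 := Suc i, a := i, d := i, c := i)" b] facts by (simp add: fun_upd_twist)
    have 3: "R ?K N w 0 (inc d) (z(0 := Suc i, a := Suc i, d := i, c := i), b) (z(0 := Suc i, a := Suc i, d := Suc i, c := i), b)"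
      using R_inc[of d ?K N w 0 "z(0 := Suc i, a := Suc i, d := i, c := i)" b] facts by (simp add: fun_upd_twist)
    have 4: "R ?K N w 0 (inc c) (z(0 := Suc i, a := Suc i, d := Suc i, c := i), b) (z(0 := Suc i, a := Suc i, d := Suc i, c := Suc i), b)"
      using R_inc[of c ?K N w 0 "z(0 := Suc i, a := Suc i, d := Suc i, c := i)" b] facts by (simp add: fun_upd_twist)
    show "R ?K N w 6 (inc 0 ;; inc a ;; inc d ;; inc c) (z(0 := i, a := i, d := i, c := i), b)
      (z(0 := Suc i, a := Suc i, d := Suc i, c := Suc i), b)"
      using R_Seq[OF 1 R_Seq[OF 2 R_Seq[OF 3 4]]] by (simp add: numeral_eq_Suc)
  next
    show "\<not> heads (conc ?K w (z(0 := n, a := n, d := n, c := n), b)) 0 \<noteq> Blank"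
      using facts by (auto simp: conc_def heads_def input_tape_def n_def)
  qed (use nN in simp)
  have 2: "R ?K N w (2 + 1 + 3) (While (nz c) (dec c ;; dec 0))
    (z(0 := n - 0, a := n, d := n, c := n - 0), b) (z(0 := n - n, a := n, d := n, c := n - n), b)"
  proof (rule R_While[where S = "\<lambda>i. (z(0 := n - i, a := n, d := n, c := n - i), b)"], intro conjI)
    fix i assume i: "i < n"
    show "nz c (heads (conc ?K w (z(0 := n - i, a := n, d := n, c := n - i), b)))"
      using i facts by (simp add: heads_conc)
    have 1: "R ?K N w 0 (dec c) (z(0 := n - i, a := n, d := n, c := n - i), b)
        (z(0 := n - i, a := n, d := n, c := n - Suc i), b)"
      using R_dec[of c ?K "z(0 := n - i, a := n, d := n, c := n - i)" N w 0 b] i facts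
      by (simp add: fun_upd_twist)
    have 2: "R ?K N w 0 (dec 0) (z(0 := n - i, a := n, d := n, c := n - Suc i), b)
        (z(0 := n - Suc i, a := n, d := n, c := n - Suc i), b)"
      using R_dec[of 0 ?K "z(0 := n - i, a := n, d := n, c := n - Suc i)" N w 0 b] i facts
      by (simp add: fun_upd_twist)
    show "R ?K N w 2 (dec c ;; dec 0) (z(0 := n - i, a := n, d := n, c := n - i), b)
      (z(0 := n - Suc i, a := n, d := n, c := n - Suc i), b)"
      using R_Seq[OF 1 2] by (simp add: numeral_eq_Suc)
  qed (use facts in \<open>auto simp: heads_conc\<close>)
  let ?z2 = "z(a := n, d := n)"
  have z2: "z(0 := n - n, a := n, d := n, c := n - n) = ?z2" "z(0 := 0, a := 0, d := 0, c := 0) = z"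
    using facts by (auto simp: z_def fun_eq_iff)
  have 3: "R ?K N w 0 (inc a) (?z2, b) (z(a := n + 1, d := n), b)"
    using R_inc[of a ?K N w 0 ?z2 b] facts by (simp add: fun_upd_twist)
  have 4: "R ?K N w 0 (inc d) (z(a := n + 1, d := n), b) (z(a := n + 1, d := n + 1), b)"
    using R_inc[of d ?K N w 0 "z(a := n + 1, d := n)" b] facts by simp
  define s where "s = (z(d := n + 1), b)"
  have 5: "R ?K N w 0 (inc v) (z(a := n + 1, d := n + 1), b) (put v 1 (put a (n + 1) s))"
    using R_inc[of v ?K N w 0 "z(a := n + 1, d := n + 1)" b] facts
    by (simp add: s_def fun_upd_twist) (simp add: z_def)
  let ?V = "\<lambda>i. 2 ^ ((n + 1) * i) :: nat"
  let ?S = "\<lambda>i. put v (?V i) (put a (n + 1 - i) s)"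
  have "R ?K N w (36 + 1 + 3) (While (nz a) (dec a ;; rep d c (double v u))) (?S 0) (?S (n + 1))"
  proof (rule R_While, intro conjI)
    fix i assume i: "i < n + 1"
    show "nz a (heads (conc ?K w (?S i)))" using i facts by (simp add: heads_conc' fst_put)
    let ?s = "put v (?V i) (put a (n - i) s)"
    have A: "R ?K N w 0 (dec a) (?S i) ?s"
      using R_dec'[of a ?K "?S i" N w 0] i facts by (simp add: fst_put put_put put_commute[of a v])
    let ?Q = "\<lambda>i'. put v (?V i * 2 ^ i') (put a (n - i) s)"
    have "R ?K N w (16 + 2 * 1 + 14) (rep d c (double v u)) (put d (n + 1) (put c 0 (?Q 0))) (put d (n + 1) (put c 0 (?Q (n + 1))))"
    proof (rule R_rep)
      fix i' assume i': "i' < n + 1"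
      let ?t = "put d (n + 1 - Suc i') (put c (Suc i') (?Q i'))"
      \<comment> \<open>After \<open>i\<close> outer and \<open>i'\<close> inner rounds
        \<open>v\<close> holds 2 to the power \<open>(n + 1) * i + i'\<close>. Every doubling thus
        stays within \<open>N\<close>, which bounds the time that it takes.\<close>
      have "2 * fst ?t v = 2 ^ ((n + 1) * i + i' + 1)" using facts by (simp add: fst_put power_add)
      also have "\<dots> \<le> (2::nat) ^ ((n + 1) * i + (n + 1))" using i' by (intro power_increasing) auto
      also have "\<dots> = 2 ^ ((n + 1) * Suc i)" by (simp add: algebra_simps)
      also have "\<dots> \<le> 2 ^ ((n + 1) * (n + 1))" using i by (intro power_increasing mult_left_mono) auto
      also have "\<dots> = N" by (simp only: N size_bound_def n_def power2_eq_square)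
      finally have "R ?K N w 16 (double v u) ?t (put v (2 * fst ?t v) ?t)"
        using facts by (intro R_double) (auto simp: fst_put s_def z_def)
      also have "put v (2 * fst ?t v) ?t = put d (n + 1 - Suc i') (put c (Suc i') (?Q (Suc i')))"
        using facts by (simp add: fst_put put_put put_commute[of v d] put_commute[of v c] mult.left_commute)
      finally show "R ?K N w 16 (double v u) ?t (put d (n + 1 - Suc i') (put c (Suc i') (?Q (Suc i'))))" .
    qed (use facts in auto)
    moreover have "put d (n + 1) (put c 0 (put v x (put a y s))) = put v x (put a y s)" for x y
      using facts by (auto simp: put_def s_def z_def fun_eq_iff)
    ultimately have B: "R ?K N w (16 + 2 * 1 + 14) (rep d c (double v u)) ?s (?S (Suc i))"
      by (simp add: power_add algebra_simps)
    show "R ?K N w 36 (dec a ;; rep d c (double v u)) (?S i) (?S (Suc i))"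
      by (rule R_mono[OF R_Seq[OF A B]]) simp
  qed (use facts in \<open>auto simp: heads_conc' fst_put\<close>)
  moreover have "?V (n + 1) = N" by (simp only: N size_bound_def n_def power2_eq_square)
  ultimately have 6: "R ?K N w (36 + 1 + 3) (While (nz a) (dec a ;; rep d c (double v u)))
      (put v 1 (put a (n + 1) s)) (put v N (put a 0 s))" by simp
  have "put d 0 (put v N (put a 0 s)) = (z(v := N), b)"
    using facts by (auto simp: put_def s_def z_def fun_eq_iff)
  then have 7: "R ?K N w (1 + 3) (rewind d) (put v N (put a 0 s)) (z(v := N), b)"
    using R_rewind[of d ?K "put v N (put a 0 s)" N 1 w] facts by (simp add: fst_put s_def)
  let ?p = "z(v := N)"
  let ?js = "map (cr m) [2..<r]"
  define b1 where "b1 = (\<lambda>j. if j \<in> set ?js then (b j)(N := True) else b j)"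
  have 8: "R ?K N w (27 * length ?js) (mark_all v u ?js) (?p, b) (?p, b1)"
    unfolding b1_def using facts by (intro R_mark_all) (auto simp: regs z_def)
  \<comment> \<open>\<open>u\<close> was the scratch register for the other marks, so
    \<open>c\<close> takes its place for marking \<open>u\<close>. The head of \<open>v\<close>
    itself already stands on cell \<open>N\<close> and sets its own mark.\<close>
  define b2 where "b2 = (\<lambda>j. if j \<in> set [u] then (b1 j)(N := True) else b1 j)"
  have 9: "R ?K N w (27 * length [u]) (mark_all v c [u]) (?p, b1) (?p, b2)"
    unfolding b2_def using facts by (intro R_mark_all) (auto simp: z_def)
  define b3 where "b3 = b2(v := (b2 v)(N := True))"
  have 10: "R ?K N w 0 (setb v True) (?p, b2) (?p, b3)"
    using R_setb[of v ?K N w 0 True ?p b2] facts by (simp add: b3_def)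
  have 11: "R ?K N w (1 + 3) (rewind v) (?p, b3) (z, b3)"
  proof -
    have "z(v := 0) = z" by (auto simp: z_def)
    then show ?thesis using R_rewind[of v ?K "(?p, b3)" N 1 w] facts by simp
  qed
  have b3: "b3 = (\<lambda>j x. x = N \<and> (\<exists>i<r. j = cr m i))"
  proof (intro ext)
    fix j x
    have "(\<exists>i<r. j = cr m i) \<longleftrightarrow> j = v \<or> j = u \<or> j \<in> set ?js"
      unfolding regs using r
      by (auto simp: image_iff)
    then show "b3 j x = (x = N \<and> (\<exists>i<r. j = cr m i))"
      unfolding b3_def b2_def b1_def b_def by auto
  qed
  note R = R_Seq[OF 1[unfolded z2] R_Seq[OF 2[unfolded z2 diff_zero] R_Seq[OF 3 R_Seq[OF 4 R_Seq[OF 5 R_Seq[OF 6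
    R_Seq[OF 7 R_Seq[OF 8 R_Seq[OF 9 R_Seq[OF 10 11]]]]]]]]]]
  show ?thesis
    unfolding prepare_def Let_def regs[symmetric]
    using R_mono[OF R, of "300 + 27 * r"] unfolding b3 z_def b_def by simp
qed

subsection \<open>Definability in exponential time\<close>

definition cells4 :: "'a cell set" where
  "cells4 = {Blank} \<union> range Input \<union> Work ` {..<4}"

text \<open>Well-formedness for all sufficiently large numbers of tapes: programs can be combined
  without keeping account of the registers that each of them uses.\<close>

definition wfb :: "'a com \<Rightarrow> bool" where
  "wfb c \<longleftrightarrow> (\<exists>K0. \<forall>K\<ge>K0. wf_com K cells4 c)"

lemma wf_setb: "j < K \<Longrightarrow> wf_com K cells4 (setb j v)"
  by (auto simp: setb_def cell_of_def cells4_def)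

lemma wfb_basic [simp]: "wfb Skip" "wfb (inc j)" "wfb (dec j)" "wfb (setb j v)"
  unfolding wfb_def
  by (rule exI[of _ "Suc j"]; auto intro!: wf_setb simp: inc_def dec_def)+

lemma wfb_Seq [simp]: "wfb c \<Longrightarrow> wfb d \<Longrightarrow> wfb (c ;; d)"
  and wfb_Cond [simp]: "wfb c \<Longrightarrow> wfb d \<Longrightarrow> wfb (Cond t c d)"
  unfolding wfb_def by (metis wf_com.simps(3,4) max.bounded_iff)+

lemma wfb_While [simp]: "wfb c \<Longrightarrow> wfb (While t c)"
  by (simp add: wfb_def)

lemma wfb_loops [simp]: "wfb (move x u)" "wfb (rewind x)" "wfb c \<Longrightarrow> wfb (rep x u c)"
  "wfb c \<Longrightarrow> wfb (repall u c)"
  by (simp_all add: move_def rewind_def rep_def repall_def)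

lemma wfb_shiftN [simp]: "wfb (shiftN m l u t)"
  by (induction l arbitrary: u) simp_all

lemma wfb_goto [simp]: "wfb (goto m u t vs l)"
  by (induction vs arbitrary: l) simp_all

lemma wfb_compile [simp]: "wfb (compile m k f d)"
  by (induction f arbitrary: d) (simp_all add: less_com_def lookup_def decide_def)

lemma wfb_nest: "wfb c \<Longrightarrow> wfb (nest m c j i)"
  by (induction j arbitrary: i) simp_all

lemma wfb_fills: "wfb (fills m ar fs l)"
  by (induction l) (simp_all add: wfb_nest leaf_def)

lemma wf_origins:
  "(\<And>j. j \<in> set js \<Longrightarrow> j < K) \<Longrightarrow>
    wf_com K cells4 (origins js)"
  by (induction js) (auto simp: origins_def cell_of_def cells4_def)

lemma wf_mark_all:
  "v < K \<Longrightarrow> u < K \<Longrightarrow> (\<And>j. j \<in> set js \<Longrightarrow> j < K) \<Longrightarrow>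
    wf_com K cells4 (mark_all v u js)"
  by (induction js)
    (auto simp: mark_all_def mark_def move_def rewind_def inc_def dec_def intro!: wf_setb)

lemma wf_prepare:
  assumes "5 \<le> r"
  shows "wf_com (m + 2 + r) cells4 (prepare m r)"
proof -
  have "cr m i < m + 2 + r" if "i < r" for i using that by simp
  then show ?thesis using assms
    by (auto simp: prepare_def Let_def double_def rep_def move_def rewind_def inc_def dec_def
      intro!: wf_setb wf_mark_all)
qed

lemma add_le_mult: "2 \<le> x \<Longrightarrow> 2 \<le> y \<Longrightarrow> x + y \<le> x * (y :: nat)"
proof -
  assume "2 \<le> x" "2 \<le> y"
  then have "x * 2 \<le> x * y" "2 * y \<le> x * y" by simp_all
  then show ?thesis by linarith
qed

text \<open>The system is fixed, so one exponent covers the filling of all its tables, and a fixed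
  power of \<open>size_bound w + 2\<close> is 2 to a polynomial in the length of
  \<open>w\<close>.\<close>

theorem EXPTIME_tables:
  fixes A :: "'a::finite list \<Rightarrow> nat \<Rightarrow> nat list \<Rightarrow> bool" and fs :: "nat \<Rightarrow> 'a fo"
  assumes wf: "\<And>k. k < m \<Longrightarrow> wf_fo ar k (fs k) (ar k) \<and> 0 < ar k"
    and A: "\<And>w k us. k < m \<Longrightarrow> us \<in> tuples (ar k) (size_bound w) \<Longrightarrow>
      A w k us = sem w (size_bound w) (A w) k (fs k) us"
    and m: "0 < m" "ar (m - 1) = 1"
  shows "{w. \<exists>a\<le>size_bound w. A w (m - 1) [a]} \<in> EXPTIME"
proof -
  \<comment> \<open>One index more than there are tables: the final query is compiled as if it were
    to define table \<open>m\<close>, because a formula may call only tables with a smaller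
    index.\<close>
  define M where "M = m + 1"
  define f where "f = (FEx (FCall (m - 1) [0]) :: 'a fo)"
  have mM: "m \<le> M" "m < M" by (auto simp: M_def)
  obtain c1 r1 where "\<forall>r N (w :: 'a list) p b A. r1 \<le> r \<longrightarrow> ok M r N 0 p b \<longrightarrow>
    (\<forall>k<m. \<forall>us \<in> tuples (ar k) N. A k us = sem w N A k (fs k) us) \<longrightarrow>
    (\<exists>b'. ok M r N 0 p b' \<and> (\<forall>k<m. \<forall>us \<in> tuples (ar k) N. tab N b' k us = A k us) \<and>
      R (M + 2 + r) N w c1 (fills M ar fs m) (p, b) (p, b'))"
    by (rule exE[OF R_fills[OF wf mM(1)]], assumption, erule exE, rule that, assumption)
  note fills = this[rule_format]
  have "wf_fo ar m f 0" using m by (simp add: f_def)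
  from R_comp[OF this mM(2)] obtain c2 r2 where
    "\<forall>r N (w :: 'a list) p b. r2 \<le> r \<longrightarrow> ok M r N 0 p b \<longrightarrow>
      R (M + 2 + r) N w c2 (compile M m f 0) (p, b) (p, flag b (sem w N (tab N b) m f (lev M 0 p)))"
    by (elim exE)
  note final = this[rule_format]
  have "wfb (fills M ar fs m ;; compile M m f 0)" by (simp add: wfb_fills)
  then obtain r3 where r3: "\<forall>K\<ge>r3. wf_com K cells4
      (fills M ar fs m ;; compile M m f 0)"
    unfolding wfb_def by (rule exE)
  define r where "r = max 5 (max r1 (max r2 r3))"
  have r: "5 \<le> r" "r1 \<le> r" "r2 \<le> r" "r3 \<le> r" by (auto simp: r_def)
  define K where "K = M + 2 + r"
  define e where "e = (300 + 27 * r) + (c1 + c2 + 2) + 2"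
  define prog where "prog = origins [1..<K] ;; prepare M r ;; fills M ar fs m ;; compile M m f 0"
  \<comment> \<open>The first summand accounts for \<open>(N + 2) ^ e\<close>, the second for the
    steps of \<open>origins\<close>.\<close>
  define p :: "nat poly" where "p = [:e:] * ([:1, 1:]\<^sup>2 + 2) + [:2 * K:]"
  have wf_prog: "wf_com K cells4 prog"
  proof -
    have "wf_com K cells4 (origins [1..<K] :: 'a com)" by (rule wf_origins) simp
    moreover have "wf_com K cells4 (fills M ar fs m ;; compile M m f 0)"
      using r3 r(4) by (simp add: K_def)
    ultimately show ?thesis
      using wf_prepare[OF r(1), of M] unfolding prog_def K_def by simp
  qed
  show ?thesis
  proof (rule EXPTIME_I[of K 4 prog p "bt 1"])
    fix w :: "'a list"
    define N where "N = size_bound w"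
    define b0 where "b0 = (\<lambda>j x. x = N \<and> (\<exists>i<r. j = cr M i))"
    have ok0: "ok M r N 0 (\<lambda>_. 0) b0" by (auto simp: ok_def b0_def)
    then obtain b1 where b1: "ok M r N 0 (\<lambda>_. 0) b1"
      "\<forall>k<m. \<forall>us \<in> tuples (ar k) N. tab N b1 k us = A w k us"
      "R K N w c1 (fills M ar fs m) (\<lambda>_. 0, b0) (\<lambda>_. 0, b1)"
      using fills[OF r(2) ok0, of "A w" w] A[of _ _ w] by (auto simp: K_def N_def)
    have "R K N w c2 (compile M m f 0) (\<lambda>_. 0, b1) (\<lambda>_. 0, flag b1 (sem w N (tab N b1) m f []))"
      using final[OF r(3) b1(1), of w] by (simp add: K_def lev_def)
    from R_Seq[OF R_prepare[OF r(1) N_def, of M] R_Seq[OF b1(3)[unfolded b0_def, folded K_def] this, unfolded K_def]]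
    have "R K N w e (prepare M r ;; fills M ar fs m ;; compile M m f 0) (\<lambda>_. 0, \<lambda>_ _. False)
      (\<lambda>_. 0, flag b1 (sem w N (tab N b1) m f []))" by (simp add: K_def e_def)
    moreover have "start_tapes w = (\<lambda>j. if j = 0 then input_tape w
      else if j \<in> {} then (\<lambda>i. if i = 0 then cell_of True False else Blank, 0) else (\<lambda>_. Blank, 0))"
      by (auto simp: start_tapes_def fun_eq_iff)
    moreover have "(\<lambda>j. if j = 0 then input_tape w
      else if j \<in> {} \<union> set [1..<K] then (\<lambda>i. if i = 0 then cell_of True False else Blank, 0)
      else (\<lambda>_. Blank, 0)) = conc K w (\<lambda>_. 0, \<lambda>_ _. False)"
      by (auto simp: conc_def fun_eq_iff input_tape_def cell_of_def)
    ultimately have "runs (2 * length [1..<K] + (N + 2) ^ e + 1) prog (start_tapes w)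
      (conc K w (\<lambda>_. 0, flag b1 (sem w N (tab N b1) m f [])))"
      using runs_Seq[OF runs_origins[of "[1..<K]" w "{}"]] unfolding R_def prog_def by simp
    moreover have "2 * length [1..<K] + (N + 2) ^ e + 1 \<le> 2 ^ poly p (length w)"
    proof -
      let ?n = "(length w + 1)\<^sup>2"
      have "N + 2 \<le> 2 ^ ?n * 4" unfolding N_def size_bound_def
        using one_le_power[of "2::nat" ?n] by linarith
      then have "N + 2 \<le> 2 ^ (?n + 2)" by (simp add: power_add)
      then have 1: "(N + 2) ^ e \<le> 2 ^ (e * (?n + 2))"
        by (metis power_mono power_mult mult.commute le0)
      have 2: "2 * length [1..<K] + 1 \<le> 2 * K"
        unfolding length_upt by (simp add: K_def)
      have 3: "2 * K < 2 ^ (2 * K)" by (rule less_exp)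
      have ge2: "2 \<le> (2::nat) ^ i" if "0 < i" for i
        using power_increasing[of 1 i "2::nat"] that by simp
      have 4: "(2::nat) ^ (e * (?n + 2)) + 2 ^ (2 * K) \<le> 2 ^ (e * (?n + 2)) * 2 ^ (2 * K)"
        by (intro add_le_mult ge2) (auto simp: e_def K_def)
      have "poly p (length w) = e * (?n + 2) + 2 * K"
        by (simp add: p_def power2_eq_square algebra_simps)
      then have "2 ^ poly p (length w) = (2::nat) ^ (e * (?n + 2)) * 2 ^ (2 * K)"
        by (simp only: power_add)
      then show ?thesis using 1 2 3 4 by linarith
    qed
    ultimately have "runs (2 ^ poly p (length w)) prog (start_tapes w)
      (conc K w (\<lambda>_. 0, flag b1 (sem w N (tab N b1) m f [])))" by (rule runs_mono)
    moreover have "bt 1 (heads (conc K w (\<lambda>_. 0, flag b1 (sem w N (tab N b1) m f [])))) \<longleftrightarrow>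
      w \<in> {w. \<exists>a\<le>size_bound w. A w (m - 1) [a]}"
      using b1(2) m by (auto simp: heads_conc K_def f_def N_def tuples_def)
    ultimately show "\<exists>T. runs (2 ^ poly p (length w)) prog (start_tapes w) T \<and>
      (bt 1 (heads T) \<longleftrightarrow> w \<in> {w. \<exists>a\<le>size_bound w. A w (m - 1) [a]})" by blast
  qed (use wf_prog in \<open>simp_all add: K_def cells4_def\<close>)
qed

section \<open>Tree models\<close>

primrec atoms :: "fm \<Rightarrow> (nat \<times> nat list) set" where
  "atoms (Eq x y) = {}"
| "atoms (Rel r vs) = {(r, vs)}"
| "atoms (Neg p) = atoms p"
| "atoms (Conj p q) = atoms p \<union> atoms q"
| "atoms (Disj p q) = atoms p \<union> atoms q"
| "atoms (Imp p q) = atoms p \<union> atoms q"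
| "atoms (Iff p q) = atoms p \<union> atoms q"
| "atoms (Ex v p) = atoms p"
| "atoms (All v p) = atoms p"

text \<open>Truth of a matrix without a structure: equality of codes under \<open>\<kappa>\<close>
  decides the equations, \<open>\<tau>\<close> the relational atoms.\<close>

primrec qev :: "(nat \<Rightarrow> nat) \<Rightarrow> (nat \<Rightarrow> nat list \<Rightarrow> bool) \<Rightarrow> fm \<Rightarrow> bool" where
  "qev \<kappa> \<tau> (Eq x y) = (\<kappa> x = \<kappa> y)"
| "qev \<kappa> \<tau> (Rel r vs) = \<tau> r vs"
| "qev \<kappa> \<tau> (Neg p) = (\<not> qev \<kappa> \<tau> p)"
| "qev \<kappa> \<tau> (Conj p q) = (qev \<kappa> \<tau> p \<and> qev \<kappa> \<tau> q)"
| "qev \<kappa> \<tau> (Disj p q) = (qev \<kappa> \<tau> p \<or> qev \<kappa> \<tau> q)"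
| "qev \<kappa> \<tau> (Imp p q) = (qev \<kappa> \<tau> p \<longrightarrow> qev \<kappa> \<tau> q)"
| "qev \<kappa> \<tau> (Iff p q) = (qev \<kappa> \<tau> p \<longleftrightarrow> qev \<kappa> \<tau> q)"
| "qev \<kappa> \<tau> (Ex v p) = undefined"
| "qev \<kappa> \<tau> (All v p) = undefined"

lemma map_eq_iff_list_all2: "map f vs = map g us \<longleftrightarrow> list_all2 (\<lambda>v u. f v = g u) vs us"
  by (simp add: list.rel_eq[symmetric] list.rel_map)

lemma eval_qev:
  assumes "qfree q" and "\<And>v v'. v \<in> fv q \<Longrightarrow> v' \<in> fv q \<Longrightarrow> e v = e v' \<longleftrightarrow> \<kappa> v = \<kappa> v'"
    and "\<And>r vs. (r, vs) \<in> atoms q \<Longrightarrow> I r (map e vs) = \<tau> r vs"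
  shows "eval D I e q = qev \<kappa> \<tau> q"
  using assms by (induction q) simp_all

text \<open>Of repeated variables in the block only the innermost binding counts, so one function on
  \<open>set ys\<close> describes all the witnesses at once.\<close>

lemma eval_foldr_Ex:
  "eval D I e (foldr Ex ys q) \<longleftrightarrow>
    (\<exists>f. (\<forall>y\<in>set ys. f y \<in> D) \<and> eval D I (\<lambda>v. if v \<in> set ys then f v else e v) q)"
proof (induction ys arbitrary: e)
  case Nil
  then show ?case by simp
next
  case (Cons y ys)
  show ?case
  proof
    assume "eval D I e (foldr Ex (y # ys) q)"
    then obtain a f where a: "a \<in> D" and f: "\<forall>y\<in>set ys. f y \<in> D"
      and ev: "eval D I (\<lambda>v. if v \<in> set ys then f v else (e(y := a)) v) q"
      using Cons.IH by auto
    have "(\<lambda>v. if v \<in> set ys then f v else (e(y := a)) v) =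
      (\<lambda>v. if v \<in> set (y # ys) then (if v \<in> set ys then f v else a) else e v)" by auto
    then show "\<exists>f. (\<forall>y\<in>set (y # ys). f y \<in> D) \<and>
        eval D I (\<lambda>v. if v \<in> set (y # ys) then f v else e v) q"
      using a f ev by (intro exI[of _ "\<lambda>v. if v \<in> set ys then f v else a"]) auto
  next
    assume "\<exists>f. (\<forall>y\<in>set (y # ys). f y \<in> D) \<and>
      eval D I (\<lambda>v. if v \<in> set (y # ys) then f v else e v) q"
    then obtain f where f: "\<forall>y\<in>set (y # ys). f y \<in> D"
      and ev: "eval D I (\<lambda>v. if v \<in> set (y # ys) then f v else e v) q" by blast
    have "(\<lambda>v. if v \<in> set (y # ys) then f v else e v) =
      (\<lambda>v. if v \<in> set ys then f v else (e(y := f y)) v)" by auto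
    then have "eval D I (e(y := f y)) (foldr Ex ys q)"
      unfolding Cons.IH using f ev by (intro exI[of _ f]) simp
    then show "eval D I e (foldr Ex (y # ys) q)"
      using f by auto
  qed
qed

text \<open>A configuration \<open>(K, \<kappa>, \<tau>)\<close> describes an element \<open>a\<close> of a model together with its witnesses:
  \<open>\<kappa>\<close> maps the variables to codes of elements and \<open>\<tau>\<close> gives the truth values of the atoms. Code 0
  stands for the element chosen for \<open>z\<close>, code \<open>K\<close> for \<open>a\<close> itself (\<open>K = 0\<close> if these coincide, otherwise
  \<open>K = 1\<close>), and the other codes for further witnesses.\<close>

type_synonym cfg = "nat \<times> (nat \<Rightarrow> nat) \<times> (nat \<Rightarrow> nat list \<Rightarrow> bool)"

text \<open>How codes correspond: with \<open>m = 0\<close> within one configuration, with \<open>m > 0\<close> between a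
  configuration and one for its witness with code \<open>m\<close>.\<close>

definition corr :: "nat \<Rightarrow> nat \<Rightarrow> nat \<Rightarrow> bool" where
  "corr m c c' \<longleftrightarrow> (if m = 0 then c = c' else c = 0 \<and> c' = 0 \<or> c = m \<and> c' = 1)"

text \<open>\<open>list_all2\<close> also compares lengths, so atoms are related only if both name
  and arity agree. For \<open>m = 0\<close> within one configuration this says that truth depends on
  the elements and not on the variables naming them. Against \<open>\<lambda>_. 0\<close> and
  \<open>\<gamma>\<close> it fixes the atoms all of whose arguments denote the value of
  \<open>z\<close>.\<close>

definition coh :: "(nat \<times> nat list) set \<Rightarrow> nat \<Rightarrow> (nat \<Rightarrow> nat) \<Rightarrow> (nat \<Rightarrow> nat list \<Rightarrow> bool) \<Rightarrow>
    (nat \<Rightarrow> nat) \<Rightarrow> (nat \<Rightarrow> nat list \<Rightarrow> bool) \<Rightarrow> bool" where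
  "coh At m \<kappa> \<tau> \<kappa>' \<tau>' \<longleftrightarrow> (\<forall>r vs us. (r, vs) \<in> At \<longrightarrow> (r, us) \<in> At \<longrightarrow>
    list_all2 (\<lambda>v u. corr m (\<kappa> v) (\<kappa>' u)) vs us \<longrightarrow> \<tau> r vs = \<tau>' r us)"

text \<open>The conditions on \<open>x\<close> and \<open>z\<close> account for shadowing: a
  variable is tied to its outer value only if no inner quantifier rebinds it.
  \<open>\<gamma>\<close> is the choice of the facts about the value of \<open>z\<close>
  alone.\<close>

definition valid :: "nat \<Rightarrow> nat \<Rightarrow> nat list \<Rightarrow> fm \<Rightarrow> (nat \<times> nat list) set \<Rightarrow>
    (nat \<Rightarrow> nat list \<Rightarrow> bool) \<Rightarrow> cfg \<Rightarrow> bool" where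
  "valid z x ys q At \<gamma> = (\<lambda>(K, \<kappa>, \<tau>). K \<le> 1 \<and> (x \<notin> set ys \<longrightarrow> \<kappa> x = K) \<and>
    (z \<notin> set ys \<longrightarrow> z \<noteq> x \<longrightarrow> \<kappa> z = 0) \<and> qev \<kappa> \<tau> q \<and>
    coh At 0 \<kappa> \<tau> \<kappa> \<tau> \<and> coh At 0 \<kappa> \<tau> (\<lambda>_. 0) \<gamma>)"

text \<open>Codes 0 and \<open>K\<close> name elements that already have their place in the tree.
  Any other witness differs from the value of \<open>z\<close>, so its configuration has
  \<open>K = 1\<close>.\<close>

definition closed_cfgs :: "nat set \<Rightarrow> (nat \<times> nat list) set \<Rightarrow> cfg set \<Rightarrow> bool" where
  "closed_cfgs V At S \<longleftrightarrow> (\<forall>(K, \<kappa>, \<tau>) \<in> S. \<forall>m \<in> \<kappa> ` V. m \<noteq> 0 \<longrightarrow> m \<noteq> K \<longrightarrow>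
    (\<exists>\<kappa>' \<tau>'. (1, \<kappa>', \<tau>') \<in> S \<and> coh At m \<kappa> \<tau> \<kappa>' \<tau>'))"

lemma closed_cfgsD:
  assumes "closed_cfgs V At S" "C \<in> S" "m \<in> fst (snd C) ` V" "m \<noteq> 0" "m \<noteq> fst C"
  shows "\<exists>C'. C' \<in> S \<and> fst C' = 1 \<and> coh At m (fst (snd C)) (snd (snd C)) (fst (snd C')) (snd (snd C'))"
proof -
  obtain K \<kappa> \<tau> where C: "C = (K, \<kappa>, \<tau>)" by (cases C)
  have "\<forall>m \<in> \<kappa> ` V. m \<noteq> 0 \<longrightarrow> m \<noteq> K \<longrightarrow> (\<exists>\<kappa>' \<tau>'. (1, \<kappa>', \<tau>') \<in> S \<and> coh At m \<kappa> \<tau> \<kappa>' \<tau>')"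
    using bspec[OF assms(1)[unfolded closed_cfgs_def] assms(2)] C by simp
  from bspec[OF this, of m] have "\<exists>\<kappa>' \<tau>'. (1, \<kappa>', \<tau>') \<in> S \<and> coh At m \<kappa> \<tau> \<kappa>' \<tau>'"
    using assms(3-5) C by simp
  then obtain \<kappa>' \<tau>' where "(1, \<kappa>', \<tau>') \<in> S" "coh At m \<kappa> \<tau> \<kappa>' \<tau>'" by (elim exE conjE)
  then show ?thesis using C by (intro exI[of _ "(1, \<kappa>', \<tau>')"]) simp
qed

inductive_set tree :: "nat set \<Rightarrow> (nat list \<Rightarrow> cfg) \<Rightarrow> nat list set" for V cf where
  root: "[] \<in> tree V cf"
| child: "u \<in> tree V cf \<Longrightarrow> m \<in> fst (snd (cf u)) ` V \<Longrightarrow> m \<noteq> 0 \<Longrightarrow> m \<noteq> fst (cf u) \<Longrightarrow> m # u \<in> tree V cf"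

text \<open>A node of the tree is the list of witness codes leading to it, the latest in front; the
  root interprets \<open>z\<close>. Two nodes name a common element other than the root only if they
  are equal or parent and child. So there are three ways in which a tuple can be named twice, and
  each is covered by one use of \<open>coh\<close>: within a configuration, along an edge, and with
  \<open>\<gamma>\<close>.\<close>

lemma satisfiable_if_cfgs:
  assumes q: "qfree q" "atoms q \<subseteq> At" "fv q \<subseteq> V" "fv q \<subseteq> {z, x} \<union> set ys" "set ys \<subseteq> V"
    and At: "\<And>r vs. (r, vs) \<in> At \<Longrightarrow> set vs \<subseteq> V"
    and \<gamma>: "coh At 0 (\<lambda>_. 0) \<gamma> (\<lambda>_. 0) \<gamma>"
    and valid: "\<And>C. C \<in> S \<Longrightarrow> valid z x ys q At \<gamma> C"
    and closed: "closed_cfgs V At S" and C0: "C0 \<in> S" "fst C0 = 0"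
  shows "satisfiable TYPE(nat list) (Ex z (All x (foldr Ex ys q)))"
proof -
  define nxt where "nxt C m = (SOME C'. C' \<in> S \<and> fst C' = 1 \<and>
    coh At m (fst (snd C)) (snd (snd C)) (fst (snd C')) (snd (snd C')))" for C :: cfg and m
  define cf where "cf = rec_list C0 (\<lambda>m u C. nxt C m)"
  have cf: "cf [] = C0" "cf (m # u) = nxt (cf u) m" for m u by (simp_all add: cf_def)
  define K where "K u = fst (cf u)" for u
  define \<kappa> where "\<kappa> u = fst (snd (cf u))" for u
  define \<tau> where "\<tau> u = snd (snd (cf u))" for u
  define D where "D = tree V cf"
  have cf_eq: "cf u = (K u, \<kappa> u, \<tau> u)" for u by (simp add: K_def \<kappa>_def \<tau>_def)
  have nxt: "nxt C m \<in> S \<and> fst (nxt C m) = 1 \<and>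
      coh At m (fst (snd C)) (snd (snd C)) (fst (snd (nxt C m))) (snd (snd (nxt C m)))"
    if "C \<in> S" "m \<in> fst (snd C) ` V" "m \<noteq> 0" "m \<noteq> fst C" for C m
    using someI_ex[OF closed_cfgsD[OF closed that]] by (simp add: nxt_def)
  have inS: "cf u \<in> S \<and> K u = (if u = [] then 0 else 1)" if "u \<in> D" for u
    using that unfolding D_def
    by (induction rule: tree.induct) (use C0 nxt in \<open>auto simp: cf K_def\<close>)
  have nxt_coh: "coh At m (\<kappa> u) (\<tau> u) (\<kappa> (m # u)) (\<tau> (m # u)) \<and> m \<noteq> 0 \<and> m \<noteq> K u"
    if "m # u \<in> D" for m u
  proof -
    have "u \<in> D" "m \<in> \<kappa> u ` V" "m \<noteq> 0" "m \<noteq> K u"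
      using that unfolding D_def K_def \<kappa>_def by (auto elim: tree.cases)
    then show ?thesis using nxt[of "cf u" m] inS[of u] by (simp add: cf K_def \<kappa>_def \<tau>_def)
  qed
  have val: "valid z x ys q At \<gamma> (K u, \<kappa> u, \<tau> u)" if "u \<in> D" for u
    using valid inS[OF that] cf_eq by metis
  define emb where "emb u c = (if c = 0 then [] else if c = K u then u else c # u)" for u c
  have emb_inj: "emb u c = emb u c' \<longleftrightarrow> c = c'" if "u \<in> D" for u c c'
    using inS[OF that] by (auto simp: emb_def)
  have emb_D: "emb u (\<kappa> u v) \<in> D" if "u \<in> D" "v \<in> V" for u v
    using that unfolding D_def emb_def K_def \<kappa>_def by (auto intro: tree.intros)
  \<comment> \<open>A tuple is true if some configuration naming it says so, and tuples that no
    configuration names are false. \<open>agree\<close> below shows that all configurations naming a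
    tuple say the same.\<close>
  define I where "I r as \<longleftrightarrow> (\<exists>u\<in>D. \<exists>vs. (r, vs) \<in> At \<and> as = map (\<lambda>v. emb u (\<kappa> u v)) vs \<and> \<tau> u r vs)"
    for r as
  have child: "\<tau> u r vs = \<tau> (m # u) r us"
    if D: "u \<in> D" "m # u \<in> D" and at: "(r, vs) \<in> At" "(r, us) \<in> At"
      and eq: "map (\<lambda>v. emb u (\<kappa> u v)) vs = map (\<lambda>v. emb (m # u) (\<kappa> (m # u) v)) us"
    for u m r vs us
  proof -
    have K: "K (m # u) = 1" using inS[OF D(2)] by simp
    note m = nxt_coh[OF D(2)]
    have corr: "corr m c c'" if "emb u c = emb (m # u) c'" for c c'
      using that K m inS[OF D(1)] by (auto simp: emb_def corr_def split: if_splits)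
    have "list_all2 (\<lambda>v v'. corr m (\<kappa> u v) (\<kappa> (m # u) v')) vs us"
      using eq[unfolded map_eq_iff_list_all2] by (rule list_all2_mono) (rule corr)
    then show ?thesis using m at unfolding coh_def by blast
  qed
  have const: "\<tau> u r vs = \<gamma> r vs" if u: "u \<in> D" and at: "(r, vs) \<in> At"
    and z: "\<And>v. v \<in> set vs \<Longrightarrow> emb u (\<kappa> u v) = []" for u r vs
  proof -
    have "\<kappa> u v = 0" if "v \<in> set vs" for v
      using emb_inj[OF u, of "\<kappa> u v" 0] z[OF that] by (simp add: emb_def)
    then have "list_all2 (\<lambda>v v'. corr 0 (\<kappa> u v) 0) vs vs"
      by (auto simp: corr_def list_all2_same)
    then show ?thesis using val[OF u] at unfolding valid_def coh_def by auto
  qed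
  have agree: "\<tau> u r vs = \<tau> u' r us"
    if D: "u \<in> D" "u' \<in> D" and at: "(r, vs) \<in> At" "(r, us) \<in> At"
      and eq: "map (\<lambda>v. emb u (\<kappa> u v)) vs = map (\<lambda>v. emb u' (\<kappa> u' v)) us" for u u' r vs us
  proof -
    consider "u = u'" | m where "u' = m # u" | m where "u = m # u'"
      | "u \<noteq> u'" "\<And>m. u' \<noteq> m # u" "\<And>m. u \<noteq> m # u'" by blast
    then show ?thesis
    proof cases
      case 1
      have "list_all2 (\<lambda>v v'. corr 0 (\<kappa> u v) (\<kappa> u v')) vs us"
        using eq[unfolded map_eq_iff_list_all2] by (simp add: 1[symmetric] emb_inj[OF D(1)] corr_def)
      then show ?thesis using val[OF D(1)] at 1 unfolding valid_def coh_def by auto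
    next
      case 2
      then show ?thesis using child D at eq by blast
    next
      case 3
      then show ?thesis using child[OF D(2), of m r us vs] D at eq by simp
    next
      case 4
      \<comment> \<open>Such nodes have only the root in common. Both argument lists are then
        constant, and both values equal the one prescribed by \<open>\<gamma>\<close>.\<close>
      have common: "emb u c = []" if "emb u c = emb u' c'" for c c'
        using that 4 by (auto simp: emb_def split: if_splits)
      have len: "length vs = length us" using eq by (metis length_map)
      have nth: "emb u (\<kappa> u (vs ! i)) = emb u' (\<kappa> u' (us ! i))" if "i < length us" for i
        using eq that len by (metis (no_types, lifting) nth_map)
      have z: "emb u (\<kappa> u v) = []" if "v \<in> set vs" for v
        using that nth len common by (metis in_set_conv_nth)
      have z': "emb u' (\<kappa> u' v) = []" if "v \<in> set us" for v
        using that nth len common by (metis in_set_conv_nth)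
      have "list_all2 (\<lambda>v v'. corr 0 0 0) vs us" using len by (simp add: corr_def list_all2_conv_all_nth)
      then have "\<gamma> r vs = \<gamma> r us" using \<gamma> at unfolding coh_def by blast
      then show ?thesis using const[OF D(1) at(1) z] const[OF D(2) at(2) z'] by simp
    qed
  qed
  have I: "I r (map (\<lambda>v. emb u (\<kappa> u v)) vs) = \<tau> u r vs" if "u \<in> D" "(r, vs) \<in> At" for u r vs
    unfolding I_def using that agree by blast
  have root: "[] \<in> D" by (simp add: D_def tree.root)
  have "eval D I e (Ex z (All x (foldr Ex ys q)))" if "range e \<subseteq> D" for e
  proof -
    have "eval D I (e(z := [], x := u)) (foldr Ex ys q)" if u: "u \<in> D" for u
    proof -
      define e' where "e' v = (if v \<in> set ys then emb u (\<kappa> u v) else (e(z := [], x := u)) v)" for v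
      have e': "e' v = emb u (\<kappa> u v)" if "v \<in> fv q" for v
      proof (cases "v \<in> set ys")
        case False
        have "emb u (K u) = u" using inS[OF u] by (auto simp: emb_def)
        then show ?thesis
          using False that q(4) val[OF u] by (auto simp: e'_def valid_def emb_def)
      qed (simp add: e'_def)
      have fvat: "v \<in> fv q" if "(r, vs) \<in> atoms q" "v \<in> set vs" for r vs v
        using that q(1) by (induction q) auto
      have "eval D I e' q = qev (\<kappa> u) (\<tau> u) q"
      proof (rule eval_qev[OF q(1)])
        show "e' v = e' v' \<longleftrightarrow> \<kappa> u v = \<kappa> u v'" if "v \<in> fv q" "v' \<in> fv q" for v v'
          using that e' emb_inj[OF u] by simp
        show "I r (map e' vs) = \<tau> u r vs" if "(r, vs) \<in> atoms q" for r vs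
        proof -
          have "map e' vs = map (\<lambda>v. emb u (\<kappa> u v)) vs" using fvat[OF that] e' by simp
          moreover have "(r, vs) \<in> At" using that q(2) by blast
          ultimately show ?thesis using I[OF u] by (simp only:)
        qed
      qed
      then have "eval D I e' q" using val[OF u] by (simp add: valid_def)
      then show ?thesis
        unfolding eval_foldr_Ex e'_def using emb_D[OF u] q(5)
        by (intro exI[of _ "\<lambda>v. emb u (\<kappa> u v)"]) auto
    qed
    then show ?thesis using root by auto
  qed
  then show ?thesis unfolding satisfiable_def using root by blast
qed

text \<open>Every element of a model, with a choice of its witnesses, is turned into a
  configuration. The codes \<open>g\<close> of the further witnesses are left open here; later they
  are derived from positions in the word, so that they fit into a digit.\<close>

lemma cfgs_if_satisfiable:
  assumes q: "qfree q" "atoms q \<subseteq> At" "fv q \<subseteq> V" "fv q \<subseteq> {z, x} \<union> set ys"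
    and At: "\<And>r vs. (r, vs) \<in> At \<Longrightarrow> set vs \<subseteq> V" and xz: "x \<in> V" "z \<in> V"
    and g: "inj_on g V" "\<And>v. v \<in> V \<Longrightarrow> (2 :: nat) \<le> g v"
    and sat: "satisfiable TYPE('u) (Ex z (All x (foldr Ex ys q)))"
  obtains \<gamma> S C0 where "coh At 0 (\<lambda>_. 0) \<gamma> (\<lambda>_. 0) \<gamma>"
    "\<And>C. C \<in> S \<Longrightarrow> valid z x ys q At \<gamma> C" "closed_cfgs V At S" "C0 \<in> S" "fst C0 = 0"
    "\<And>K \<kappa> \<tau> v. (K, \<kappa>, \<tau>) \<in> S \<Longrightarrow> v \<in> V \<Longrightarrow> \<kappa> v \<in> {0, 1} \<union> g ` V"
proof -
  obtain D :: "'u set" and I where D: "D \<noteq> {}"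
    and ev: "\<And>e. range e \<subseteq> D \<Longrightarrow> eval D I e (Ex z (All x (foldr Ex ys q)))"
    using sat unfolding satisfiable_def by blast
  obtain d where "d \<in> D" using D by blast
  then obtain c where c: "c \<in> D" and all: "\<And>a. a \<in> D \<Longrightarrow> eval D I ((\<lambda>_. d)(z := c, x := a)) (foldr Ex ys q)"
    using ev[of "\<lambda>_. d"] by auto
  have "\<exists>e. range e \<subseteq> D \<and> (x \<notin> set ys \<longrightarrow> e x = a) \<and> (z \<notin> set ys \<longrightarrow> z \<noteq> x \<longrightarrow> e z = c) \<and> eval D I e q"
    if a: "a \<in> D" for a
  proof -
    obtain f where "\<forall>y\<in>set ys. f y \<in> D"
      "eval D I (\<lambda>v. if v \<in> set ys then f v else ((\<lambda>_. d)(z := c, x := a)) v) q"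
      using all[OF a] unfolding eval_foldr_Ex by blast
    then show ?thesis using a c \<open>d \<in> D\<close>
      by (intro exI[of _ "\<lambda>v. if v \<in> set ys then f v else ((\<lambda>_. d)(z := c, x := a)) v"]) auto
  qed
  then obtain E where E: "\<And>a. a \<in> D \<Longrightarrow> range (E a) \<subseteq> D \<and> (x \<notin> set ys \<longrightarrow> E a x = a) \<and>
    (z \<notin> set ys \<longrightarrow> z \<noteq> x \<longrightarrow> E a z = c) \<and> eval D I (E a) q" by metis
  \<comment> \<open>Variables with equal values must receive equal codes, so the code is taken from
    a representative variable of each class.\<close>
  define rp where "rp a v = (SOME v'. v' \<in> V \<and> E a v' = E a v)" for a v
  have rp: "rp a v \<in> V \<and> E a (rp a v) = E a v" if "v \<in> V" for a v
    unfolding rp_def using that by (intro someI[of "\<lambda>v'. v' \<in> V \<and> E a v' = E a v"]) simp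
  have rp_eq: "rp a v = rp a v'" if "E a v = E a v'" for a v v' using that by (simp add: rp_def)
  define K where "K a = (if a = c then 0 else 1 :: nat)" for a
  define \<kappa> where "\<kappa> a v = (if E a v = c then 0 else if E a v = a then 1 else g (rp a v))" for a v
  define \<tau> where "\<tau> a r vs = I r (map (E a) vs)" for a r vs
  define \<gamma> where "\<gamma> r vs = I r (map (\<lambda>_. c) vs)" for r and vs :: "nat list"
  have \<kappa>_inj: "\<kappa> a v = \<kappa> a v' \<longleftrightarrow> E a v = E a v'" if "v \<in> V" "v' \<in> V" for a v v'
  proof
    show "\<kappa> a v = \<kappa> a v'" if "E a v = E a v'" using that rp_eq[OF that] by (simp add: \<kappa>_def)
  next
    assume "\<kappa> a v = \<kappa> a v'"
    moreover have "g (rp a v) \<ge> 2" "g (rp a v') \<ge> 2" using g(2) rp that by auto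
    moreover have "E a v = E a v'" if "g (rp a v) = g (rp a v')"
      using that g(1) rp[OF \<open>v \<in> V\<close>, of a] rp[OF \<open>v' \<in> V\<close>, of a] by (metis inj_onD)
    ultimately show "E a v = E a v'" by (auto simp: \<kappa>_def split: if_splits)
  qed
  have \<kappa>0: "\<kappa> a v = 0 \<longleftrightarrow> E a v = c" if "v \<in> V" for a v
    using g(2)[of "rp a v"] rp[OF that, of a] by (auto simp: \<kappa>_def)
  have \<kappa>1: "\<kappa> a v = 1 \<longleftrightarrow> E a v \<noteq> c \<and> E a v = a" if "v \<in> V" for a v
    using g(2)[of "rp a v"] rp[OF that, of a] by (auto simp: \<kappa>_def)
  define S where "S = (\<lambda>a. (K a, \<kappa> a, \<tau> a)) ` D"
  have coh_if: "coh At m (\<kappa> a) (\<tau> a) \<kappa>' \<tau>'"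
    if "\<And>v u. v \<in> V \<Longrightarrow> u \<in> V \<Longrightarrow> corr m (\<kappa> a v) (\<kappa>' u) \<Longrightarrow> E a v = e' u"
      and "\<And>r us. \<tau>' r us = I r (map e' us)" for m a \<kappa>' \<tau>' e'
    unfolding coh_def
  proof (intro allI impI)
    fix r vs us assume at: "(r, vs) \<in> At" "(r, us) \<in> At"
      and l: "list_all2 (\<lambda>v u. corr m (\<kappa> a v) (\<kappa>' u)) vs us"
    have "set vs \<subseteq> V" "set us \<subseteq> V" using At at by blast+
    then have "map (E a) vs = map e' us"
      using l that(1) by (auto simp: list_all2_conv_all_nth list_eq_iff_nth_eq subset_eq)
    then show "\<tau> a r vs = \<tau>' r us" by (simp add: \<tau>_def that(2))
  qed
  have S_valid: "valid z x ys q At \<gamma> C" if "C \<in> S" for C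
  proof -
    obtain a where a: "a \<in> D" "C = (K a, \<kappa> a, \<tau> a)" using \<open>C \<in> S\<close> by (auto simp: S_def)
    have "eval D I (E a) q = qev (\<kappa> a) (\<tau> a) q"
    proof (rule eval_qev[OF q(1)])
      show "E a v = E a v' \<longleftrightarrow> \<kappa> a v = \<kappa> a v'" if "v \<in> fv q" "v' \<in> fv q" for v v'
        using \<kappa>_inj[of v v' a] that q(3) by (simp add: subset_eq)
    qed (simp add: \<tau>_def)
    then have "qev (\<kappa> a) (\<tau> a) q" using E[OF a(1)] by simp
    moreover have "x \<notin> set ys \<longrightarrow> \<kappa> a x = K a"
      using E[OF a(1)] by (auto simp: \<kappa>_def K_def)
    moreover have "z \<notin> set ys \<longrightarrow> z \<noteq> x \<longrightarrow> \<kappa> a z = 0"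
      using E[OF a(1)] by (auto simp: \<kappa>_def)
    moreover have "coh At 0 (\<kappa> a) (\<tau> a) (\<kappa> a) (\<tau> a)"
      using \<kappa>_inj by (intro coh_if[where e' = "E a"]) (auto simp: corr_def \<tau>_def)
    moreover have "coh At 0 (\<kappa> a) (\<tau> a) (\<lambda>_. 0) \<gamma>"
      using \<kappa>0 by (intro coh_if[where e' = "\<lambda>_. c"]) (auto simp: corr_def \<gamma>_def)
    ultimately show ?thesis unfolding valid_def a(2) by (simp add: K_def)
  qed
  have S_closed: "closed_cfgs V At S"
    unfolding closed_cfgs_def S_def
  proof (clarsimp, goal_cases)
    \<comment> \<open>The successor is the configuration of the witness \<open>E a v\<close> itself:
      both configurations read their atoms off the same model.\<close>
    case (1 a v)
    let ?b = "E a v"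
    have b: "?b \<in> D" using E[OF 1(1)] by auto
    have ne: "?b \<noteq> c" using 1 \<kappa>0[of v a] by auto
    have "K ?b = 1" using ne by (simp add: K_def)
    moreover have "coh At (\<kappa> a v) (\<kappa> a) (\<tau> a) (\<kappa> ?b) (\<tau> ?b)"
    proof (rule coh_if[where e' = "E ?b"])
      fix v1 u assume "v1 \<in> V" "u \<in> V" "corr (\<kappa> a v) (\<kappa> a v1) (\<kappa> ?b u)"
      then show "E a v1 = E ?b u"
        using 1 \<kappa>0[of v1 a] \<kappa>0[of u ?b] \<kappa>1[of u ?b] \<kappa>_inj[of v1 v a]
        by (auto simp: corr_def split: if_splits)
    qed (simp add: \<tau>_def)
    ultimately show ?case using b by (metis (no_types, lifting) One_nat_def rev_image_eqI)
  qed
  have "coh At 0 (\<lambda>_. 0) \<gamma> (\<lambda>_. 0) \<gamma>"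
    by (auto simp: coh_def \<gamma>_def corr_def list_all2_conv_all_nth map_replicate_const)
  moreover have "(K c, \<kappa> c, \<tau> c) \<in> S" "fst (K c, \<kappa> c, \<tau> c) = 0" using c by (auto simp: S_def K_def)
  moreover have "\<kappa>' v \<in> {0, 1} \<union> g ` V" if "(K', \<kappa>', \<tau>') \<in> S" "v \<in> V" for K' \<kappa>' \<tau>' v
    using that rp by (auto simp: S_def \<kappa>_def)
  ultimately show thesis using S_valid S_closed by (intro that)
qed

section \<open>The decision procedure as a system of tables\<close>

text \<open>Positions in the word, names of variables and of relation symbols are numbers up to \<open>size_bound w\<close>.
  A configuration is a number whose digit \<open>i\<close> to the base \<open>length w + 1\<close> is the code of the variable
  if an occurrence of a variable starts at position \<open>i\<close>, the truth value of the atom if an atom starts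
  there, and the code \<open>K\<close> of the configuration for \<open>i = 0\<close>.\<close>

definition dig :: "letter list \<Rightarrow> nat \<Rightarrow> nat \<Rightarrow> nat" where
  "dig w i X = X div (length w + 1) ^ i mod (length w + 1)"

definition letter_at :: "letter list \<Rightarrow> letter \<Rightarrow> nat \<Rightarrow> bool" where
  "letter_at w a i \<longleftrightarrow> i < length w \<and> w ! i = a"

definition bit :: "letter list \<Rightarrow> nat \<Rightarrow> bool" where
  "bit w i \<longleftrightarrow> letter_at w (LBit True) i \<or> letter_at w (LBit False) i"

text \<open>The recursion follows \<open>bits\<close>, so numerals with redundant zeros are
  rejected, and the test at the end prevents a numeral from being read only in part. As the value is
  halved, it can serve as the stage of the table.\<close>

fun nat_at :: "letter list \<Rightarrow> nat \<Rightarrow> nat \<Rightarrow> nat \<Rightarrow> bool" where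
  "nat_at w v i k =
    (if v = 0 then i = k \<and> \<not> bit w i else letter_at w (LBit (odd v)) i \<and> nat_at w (v div 2) (Suc i) k)"

declare nat_at.simps [simp del]

definition var_at :: "letter list \<Rightarrow> nat \<Rightarrow> nat \<Rightarrow> nat \<Rightarrow> bool" where
  "var_at w v i k \<longleftrightarrow> letter_at w LVar i \<and> nat_at w v (Suc i) k"

text \<open>In a prenex sentence every quantifier stands in front of the matrix, so a variable of
  the matrix is bound iff it follows a quantifier letter anywhere in the word.\<close>

definition in_scope :: "letter list \<Rightarrow> nat \<Rightarrow> bool" where
  "in_scope w v \<longleftrightarrow> (\<exists>i\<le>size_bound w. (letter_at w LEx i \<or> letter_at w LAll i) \<and>
    (\<exists>k\<le>size_bound w. var_at w v (Suc i) k))"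

text \<open>The counterpart of \<open>no_arg\<close> for positions. Argument lists have no
  terminator in the word, so a reader must check that they are complete.\<close>

definition end_arg :: "letter list \<Rightarrow> nat \<Rightarrow> bool" where
  "end_arg w k \<longleftrightarrow> k \<le> length w \<and> \<not> bit w k \<and> \<not> letter_at w LVar k"

primrec vseq :: "letter list \<Rightarrow> nat \<Rightarrow> nat \<Rightarrow> nat \<Rightarrow> bool" where
  "vseq w 0 = (\<lambda>k j. k = j \<and> end_arg w k)"
| "vseq w (Suc t) = (\<lambda>k j. \<exists>v\<le>size_bound w. \<exists>k'\<le>size_bound w.
    var_at w v k k' \<and> in_scope w v \<and> vseq w t k' j)"

text \<open>Parsing and evaluation in one. The truth value is an argument, with 0 for false, because
  a part that does not parse must be told apart from one that is false. The fuel \<open>t\<close> is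
  at the same time the stage of the recursion.\<close>

primrec tr :: "letter list \<Rightarrow> nat \<Rightarrow> nat \<Rightarrow> nat \<Rightarrow> nat \<Rightarrow> nat \<Rightarrow> bool" where
  "tr w 0 = (\<lambda>X i j b. False)"
| "tr w (Suc t) = (\<lambda>X i j b.
    letter_at w LEq i \<and> (\<exists>v\<le>size_bound w. \<exists>k\<le>size_bound w. var_at w v (Suc i) k \<and>
      in_scope w v \<and> (\<exists>v'\<le>size_bound w. var_at w v' k j \<and> in_scope w v' \<and> end_arg w j \<and>
      (0 < b \<longleftrightarrow> dig w (Suc i) X = dig w k X))) \<or>
    letter_at w LRel i \<and> (\<exists>r\<le>size_bound w. \<exists>k\<le>size_bound w. nat_at w r (Suc i) k \<and>
      (\<exists>t'\<le>size_bound w. vseq w t' k j \<and> (0 < b \<longleftrightarrow> dig w i X = 1))) \<or>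
    letter_at w LNeg i \<and> (\<exists>b'\<le>size_bound w. tr w t X (Suc i) j b' \<and> (b = 0 \<longleftrightarrow> 0 < b')) \<or>
    (\<exists>k\<le>size_bound w. \<exists>b1\<le>size_bound w. tr w t X (Suc i) k b1 \<and> (\<exists>b2\<le>size_bound w. tr w t X k j b2 \<and>
      (letter_at w LConj i \<and> (0 < b \<longleftrightarrow> 0 < b1 \<and> 0 < b2) \<or>
       letter_at w LDisj i \<and> (0 < b \<longleftrightarrow> 0 < b1 \<or> 0 < b2) \<or>
       letter_at w LImp i \<and> (0 < b \<longleftrightarrow> (0 < b1 \<longrightarrow> 0 < b2)) \<or>
       letter_at w LIff i \<and> (0 < b \<longleftrightarrow> (0 < b1 \<longleftrightarrow> 0 < b2))))))"

primrec pre :: "letter list \<Rightarrow> nat \<Rightarrow> nat \<Rightarrow> nat \<Rightarrow> bool" where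
  "pre w 0 = (\<lambda>i s. i = s)"
| "pre w (Suc t) = (\<lambda>i s. letter_at w LEx i \<and>
    (\<exists>v\<le>size_bound w. \<exists>k\<le>size_bound w. var_at w v (Suc i) k \<and> pre w t k s))"

primrec argrel :: "letter list \<Rightarrow> nat \<Rightarrow> nat \<Rightarrow> nat \<Rightarrow> nat \<Rightarrow> nat \<Rightarrow> nat \<Rightarrow> bool" where
  "argrel w 0 = (\<lambda>m X k Y l. end_arg w k \<and> end_arg w l)"
| "argrel w (Suc t) = (\<lambda>m X k Y l.
    \<exists>v\<le>size_bound w. \<exists>k'\<le>size_bound w. var_at w v k k' \<and> (\<exists>v'\<le>size_bound w. \<exists>l'\<le>size_bound w.
      var_at w v' l l' \<and> corr m (dig w k X) (dig w l Y) \<and> argrel w t m X k' Y l'))"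

definition cohn :: "letter list \<Rightarrow> nat \<Rightarrow> nat \<Rightarrow> nat \<Rightarrow> bool" where
  "cohn w m X Y \<longleftrightarrow> (\<forall>i\<le>size_bound w. letter_at w LRel i \<longrightarrow>
    (\<forall>a\<le>size_bound w. letter_at w LRel a \<longrightarrow>
    (\<forall>r\<le>size_bound w. \<forall>k\<le>size_bound w. nat_at w r (Suc i) k \<longrightarrow>
    (\<forall>l\<le>size_bound w. nat_at w r (Suc a) l \<longrightarrow>
    (\<forall>t\<le>size_bound w. argrel w t m X k Y l \<longrightarrow> (dig w i X = 1 \<longleftrightarrow> dig w a Y = 1))))))"

definition vcons :: "letter list \<Rightarrow> nat \<Rightarrow> bool" where
  "vcons w X \<longleftrightarrow> (\<forall>v\<le>size_bound w. \<forall>i\<le>size_bound w. \<forall>k\<le>size_bound w. var_at w v i k \<longrightarrow>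
    (\<forall>j\<le>size_bound w. \<forall>l\<le>size_bound w. var_at w v j l \<longrightarrow> dig w j X = dig w i X))"

definition var_dig :: "letter list \<Rightarrow> nat \<Rightarrow> nat \<Rightarrow> nat \<Rightarrow> bool" where
  "var_dig w v X c \<longleftrightarrow> (\<forall>i\<le>size_bound w. \<forall>k\<le>size_bound w. var_at w v i k \<longrightarrow> dig w i X = c)"

text \<open>The choice of the facts about the value of \<open>z\<close> alone is stored like a
  configuration in which all variables denote that value, so \<open>cohn\<close> applies to it as
  well.\<close>

definition gok :: "letter list \<Rightarrow> nat \<Rightarrow> bool" where
  "gok w G \<longleftrightarrow> (\<forall>v\<le>size_bound w. var_dig w v G 0) \<and> cohn w 0 G G"

definition head :: "letter list \<Rightarrow> nat \<Rightarrow> nat \<Rightarrow> nat \<Rightarrow> bool" where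
  "head w z x e \<longleftrightarrow> letter_at w LEx 0 \<and> (\<exists>b\<le>size_bound w. var_at w z 1 b \<and> letter_at w LAll b \<and> var_at w x (Suc b) e)"

text \<open>The existential quantifier at position 0 is that of \<open>z\<close>; all others belong
  to the inner block.\<close>

definition ybound :: "letter list \<Rightarrow> nat \<Rightarrow> bool" where
  "ybound w v \<longleftrightarrow> (\<exists>k\<le>size_bound w. letter_at w LEx k \<and> 0 < k \<and> (\<exists>l\<le>size_bound w. var_at w v (Suc k) l))"

text \<open>Prefix and matrix are read off the word for each number anew, so for a word that is no
  sentence of the class no number is valid. The strict bound on \<open>X\<close> leaves at most
  \<open>size_bound w\<close> candidates and thus limits the number of elimination stages.\<close>

definition validn :: "letter list \<Rightarrow> nat \<Rightarrow> nat \<Rightarrow> bool" where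
  "validn w G X \<longleftrightarrow> X < size_bound w \<and> vcons w X \<and> (dig w 0 X = 0 \<or> dig w 0 X = 1) \<and>
    cohn w 0 X X \<and> cohn w 0 X G \<and>
    (\<exists>z\<le>size_bound w. \<exists>x\<le>size_bound w. \<exists>e\<le>size_bound w. head w z x e \<and>
      (ybound w x \<or> var_dig w x X (dig w 0 X)) \<and> (ybound w z \<or> z = x \<or> var_dig w z X 0) \<and>
      (\<exists>t\<le>size_bound w. \<exists>s\<le>size_bound w. pre w t e s \<and> (\<exists>t'\<le>size_bound w. tr w t' X s (length w) 1)))"

primrec elim :: "letter list \<Rightarrow> nat \<Rightarrow> nat \<Rightarrow> nat \<Rightarrow> bool" where
  "elim w 0 = (\<lambda>G X. validn w G X)"
| "elim w (Suc t) = (\<lambda>G X. elim w t G X \<and>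
    (\<forall>v\<le>size_bound w. \<forall>i\<le>size_bound w. \<forall>k\<le>size_bound w. var_at w v i k \<longrightarrow>
      dig w i X \<noteq> 0 \<and> dig w i X \<noteq> dig w 0 X \<longrightarrow>
      (\<exists>Y\<le>size_bound w. elim w t G Y \<and> dig w 0 Y = 1 \<and> cohn w (dig w i X) X Y)))"

text \<open>Stability is tested at a stage strictly below the bound so that the next stage is still
  an admissible table argument.\<close>

definition acc :: "letter list \<Rightarrow> bool" where
  "acc w \<longleftrightarrow> (\<exists>G\<le>size_bound w. gok w G \<and> (\<exists>t<size_bound w.
    (\<forall>X\<le>size_bound w. elim w t G X \<longrightarrow> elim w (Suc t) G X) \<and>
    (\<exists>X\<le>size_bound w. elim w t G X \<and> dig w 0 X = 0)))"

text \<open>The order matters, since a defining formula may call only tables with a smaller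
  index.\<close>

definition tables :: "letter list \<Rightarrow> nat \<Rightarrow> nat list \<Rightarrow> bool" where
  "tables w k us = [
    us ! 0 = 0,
    us ! 1 = Suc (us ! 0),
    us ! 0 = 1,
    us ! 0 + us ! 1 = us ! 2,
    us ! 0 * us ! 1 = us ! 2,
    us ! 0 = length w,
    dig w (us ! 0) (us ! 1) = us ! 2,
    nat_at w (us ! 0) (us ! 1) (us ! 2),
    var_at w (us ! 0) (us ! 1) (us ! 2),
    in_scope w (us ! 0),
    end_arg w (us ! 0),
    vseq w (us ! 0) (us ! 1) (us ! 2),
    dig w (us ! 0) (us ! 1) = 1,
    tr w (us ! 0) (us ! 1) (us ! 2) (us ! 3) (us ! 4),
    pre w (us ! 0) (us ! 1) (us ! 2),
    corr (us ! 0) (us ! 1) (us ! 2),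
    argrel w (us ! 0) (us ! 1) (us ! 2) (us ! 3) (us ! 4) (us ! 5),
    cohn w (us ! 0) (us ! 1) (us ! 2),
    vcons w (us ! 0),
    var_dig w (us ! 0) (us ! 1) (us ! 2),
    gok w (us ! 0),
    head w (us ! 0) (us ! 1) (us ! 2),
    ybound w (us ! 0),
    validn w (us ! 0) (us ! 1),
    elim w (us ! 0) (us ! 1) (us ! 2),
    acc w] ! k"

section \<open>The tables as bounded first-order formulas\<close>

definition arity :: "nat \<Rightarrow> nat" where
  "arity k = [1, 2, 1, 3, 3, 1, 3, 3, 3, 1, 1, 3, 2, 5, 3, 3, 6, 3, 1, 3, 1, 3, 1, 2, 3, 1] ! k"

definition FOr :: "'a fo \<Rightarrow> 'a fo \<Rightarrow> 'a fo" where
  "FOr f g = FNeg (FAnd (FNeg f) (FNeg g))"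
definition FImp :: "'a fo \<Rightarrow> 'a fo \<Rightarrow> 'a fo" where
  "FImp f g = FNeg (FAnd f (FNeg g))"
definition FIff :: "'a fo \<Rightarrow> 'a fo \<Rightarrow> 'a fo" where
  "FIff f g = FAnd (FImp f g) (FImp g f)"
definition FAll :: "'a fo \<Rightarrow> 'a fo" where
  "FAll f = FNeg (FEx (FNeg f))"
definition FEq :: "nat \<Rightarrow> nat \<Rightarrow> 'a fo" where
  "FEq x y = FAnd (FNeg (FLt x y)) (FNeg (FLt y x))"
definition FBit :: "nat \<Rightarrow> letter fo" where
  "FBit x = FOr (FIn (LBit True) x) (FIn (LBit False) x)"

primrec FAnds :: "'a fo \<Rightarrow> 'a fo list \<Rightarrow> 'a fo" where
  "FAnds f [] = f"
| "FAnds f (g # gs) = FAnd f (FAnds g gs)"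

lemma sem_derived [simp]:
  "sem w N A k (FOr f g) e \<longleftrightarrow> sem w N A k f e \<or> sem w N A k g e"
  "sem w N A k (FImp f g) e \<longleftrightarrow> (sem w N A k f e \<longrightarrow> sem w N A k g e)"
  "sem w N A k (FIff f g) e \<longleftrightarrow> (sem w N A k f e \<longleftrightarrow> sem w N A k g e)"
  "sem w N A k (FAll f) e \<longleftrightarrow> (\<forall>a\<le>N. sem w N A k f (e @ [a]))"
  "sem w N A k (FEq x y) e \<longleftrightarrow> e ! x = e ! y"
  by (auto simp: FOr_def FImp_def FIff_def FAll_def FEq_def)

lemma sem_FIns [simp]:
  "sem w N A k (foldr (\<lambda>a. FOr (FIn a x)) as (FIn b x)) e \<longleftrightarrow>
    e ! x < length w \<and> w ! (e ! x) \<in> insert b (set as)"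
  by (induction as) auto

lemma sem_FBit [simp]: "sem w N A k (FBit x) e \<longleftrightarrow> bit w (e ! x)"
  by (auto simp: FBit_def bit_def letter_at_def)

lemma wf_derived [simp]:
  "wf_fo ar k (FOr f g) d \<longleftrightarrow> wf_fo ar k f d \<and> wf_fo ar k g d"
  "wf_fo ar k (FImp f g) d \<longleftrightarrow> wf_fo ar k f d \<and> wf_fo ar k g d"
  "wf_fo ar k (FIff f g) d \<longleftrightarrow> wf_fo ar k f d \<and> wf_fo ar k g d"
  "wf_fo ar k (FAll f) d \<longleftrightarrow> wf_fo ar k f (Suc d)"
  "wf_fo ar k (FEq x y) d \<longleftrightarrow> x < d \<and> y < d"
  "wf_fo ar k (FBit x) d \<longleftrightarrow> x < d"
  by (auto simp: FOr_def FImp_def FIff_def FAll_def FEq_def FBit_def)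

abbreviation "cZero x \<equiv> FCall 0 [x]"
abbreviation "cSuc x y \<equiv> FCall 1 [x, y]"
abbreviation "cOne x \<equiv> FCall 2 [x]"
abbreviation "cAdd x y z \<equiv> FCall 3 [x, y, z]"
abbreviation "cMul x y z \<equiv> FCall 4 [x, y, z]"
abbreviation "cLen x \<equiv> FCall 5 [x]"
abbreviation "cDig i X d \<equiv> FCall 6 [i, X, d]"
abbreviation "cNatAt v i k \<equiv> FCall 7 [v, i, k]"
abbreviation "cVarAt v i k \<equiv> FCall 8 [v, i, k]"
abbreviation "cScope v \<equiv> FCall 9 [v]"
abbreviation "cEndArg k \<equiv> FCall 10 [k]"
abbreviation "cVSeq t k j \<equiv> FCall 11 [t, k, j]"
abbreviation "cTruth i X \<equiv> FCall 12 [i, X]"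
abbreviation "cTr t X i j b \<equiv> FCall 13 [t, X, i, j, b]"
abbreviation "cPre t i s \<equiv> FCall 14 [t, i, s]"
abbreviation "cCorr m c d \<equiv> FCall 15 [m, c, d]"
abbreviation "cArgRel t m X k Y l \<equiv> FCall 16 [t, m, X, k, Y, l]"
abbreviation "cCoh m X Y \<equiv> FCall 17 [m, X, Y]"
abbreviation "cVCons X \<equiv> FCall 18 [X]"
abbreviation "cVarDig v X c \<equiv> FCall 19 [v, X, c]"
abbreviation "cGok G \<equiv> FCall 20 [G]"
abbreviation "cHead z x e \<equiv> FCall 21 [z, x, e]"
abbreviation "cYBound v \<equiv> FCall 22 [v]"
abbreviation "cValid G X \<equiv> FCall 23 [G, X]"
abbreviation "cElim t G X \<equiv> FCall 24 [t, G, X]"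

abbreviation "FSome f g \<equiv> FEx (FAnd f g)"
abbreviation "FEvery f g \<equiv> FAll (FImp f g)"

text \<open>A number is a position of the word iff some letter stands there. This disjunction over
  the alphabet makes \<open>length w\<close> definable.\<close>

definition all_letters :: "letter list" where
  "all_letters = [LEq, LRel, LNeg, LConj, LDisj, LImp, LIff, LEx, LAll, LVar, LBit True, LBit False]"

lemma all_letters: "a \<in> set all_letters"
  by (cases a) (auto simp: all_letters_def)

text \<open>Formula \<open>k\<close> defines table \<open>k\<close> of \<open>tables\<close>. The levels below \<open>arity k\<close> are its arguments, and each
  \<open>FSome\<close>, \<open>FEvery\<close>, \<open>FEx\<close> or \<open>FAll\<close> around a subformula adds the next level.\<close>

definition bodies :: "nat \<Rightarrow> letter fo" where
  "bodies k = [
    FNeg (FEx (FLt 1 0)),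
    FAnd (FLt 0 1) (FNeg (FSome (FLt 0 2) (FLt 2 1))),
    FSome (cZero 1) (cSuc 1 0),
    FOr (FAnd (cZero 0) (FEq 1 2)) (FSome (cSuc 3 0) (FSome (cSuc 4 2) (FRec [3, 1, 4]))),
    FOr (FAnd (cZero 0) (cZero 2)) (FSome (cSuc 3 0) (FSome (FRec [3, 1, 4]) (cAdd 4 1 2))),
    FAll (FIff (FLt 1 0) (foldr (\<lambda>a. FOr (FIn a 1)) all_letters (FIn LEq 1))),
    FSome (cLen 3) (FSome (cSuc 3 4) (FEx (FSome (cMul 4 5 6) (FSome (cAdd 6 7 1) (FAnd (FLt 7 4)
      (FOr (FAnd (cZero 0) (FEq 2 7)) (FSome (cSuc 8 0) (FRec [8, 5, 2])))))))),
    FOr (FAnds (cZero 0) [FEq 1 2, FNeg (FBit 1)])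
      (FEx (FSome (cAdd 3 3 4) (FSome (cSuc 1 5) (FAnd (FRec [3, 5, 2])
        (FOr (FAnd (cSuc 4 0) (FIn (LBit True) 1)) (FAnd (FEq 4 0) (FIn (LBit False) 1))))))),
    FAnd (FIn LVar 1) (FSome (cSuc 1 3) (cNatAt 0 3 2)),
    FSome (FOr (FIn LEx 1) (FIn LAll 1)) (FSome (cSuc 1 2) (FEx (cVarAt 0 2 3))),
    FAnds (FNeg (FBit 0)) [FNeg (FIn LVar 0), FSome (cLen 1) (FNeg (FLt 1 0))],
    FOr (FAnds (cZero 0) [FEq 1 2, cEndArg 1])
      (FSome (cSuc 3 0) (FEx (FSome (cVarAt 4 1 5) (FAnd (cScope 4) (FRec [3, 5, 2]))))),
    FSome (cOne 2) (cDig 0 1 2),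
    FSome (cSuc 5 0) (FSome (cSuc 2 6)
      (FOr (FAnd (FIn LEq 2) (FEx (FSome (cVarAt 7 6 8) (FAnd (cScope 7) (FSome (cVarAt 9 8 3)
        (FAnds (cScope 9) [cEndArg 3, FSome (cDig 6 1 10) (FSome (cDig 8 1 11)
          (FIff (FNeg (cZero 4)) (FEq 10 11)))]))))))
      (FOr (FAnd (FIn LRel 2) (FEx (FSome (cNatAt 7 6 8) (FSome (cVSeq 9 8 3)
        (FIff (FNeg (cZero 4)) (cTruth 2 1))))))
      (FOr (FAnd (FIn LNeg 2) (FSome (FRec [5, 1, 6, 3, 7]) (FIff (cZero 4) (FNeg (cZero 7)))))
      (FEx (FSome (FRec [5, 1, 6, 7, 8]) (FSome (FRec [5, 1, 7, 3, 9])
        (FOr (FAnd (FIn LConj 2) (FIff (FNeg (cZero 4)) (FAnd (FNeg (cZero 8)) (FNeg (cZero 9)))))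
        (FOr (FAnd (FIn LDisj 2) (FIff (FNeg (cZero 4)) (FOr (FNeg (cZero 8)) (FNeg (cZero 9)))))
        (FOr (FAnd (FIn LImp 2) (FIff (FNeg (cZero 4)) (FImp (FNeg (cZero 8)) (FNeg (cZero 9)))))
          (FAnd (FIn LIff 2) (FIff (FNeg (cZero 4)) (FIff (FNeg (cZero 8)) (FNeg (cZero 9))))))))))))))),
    FOr (FAnd (cZero 0) (FEq 1 2)) (FAnd (FIn LEx 1)
      (FSome (cSuc 3 0) (FSome (cSuc 1 4) (FEx (FSome (cVarAt 5 4 6) (FRec [3, 6, 2])))))),
    FOr (FAnd (cZero 0) (FEq 1 2))
      (FAnd (FNeg (cZero 0)) (FOr (FAnd (cZero 1) (cZero 2)) (FAnd (FEq 1 0) (cOne 2)))),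
    FOr (FAnds (cZero 0) [cEndArg 3, cEndArg 5])
      (FSome (cSuc 6 0) (FEx (FSome (cVarAt 7 3 8) (FEx (FSome (cVarAt 9 5 10) (FSome (cDig 3 2 11)
        (FSome (cDig 5 4 12) (FAnd (cCorr 1 11 12) (FRec [6, 1, 2, 8, 4, 10]))))))))),
    FEvery (FIn LRel 3) (FEvery (FIn LRel 4) (FEvery (cSuc 3 5) (FEvery (cSuc 4 6) (FAll
      (FEvery (cNatAt 7 5 8) (FEvery (cNatAt 7 6 9) (FEvery (cArgRel 10 0 1 8 2 9)
        (FIff (cTruth 3 1) (cTruth 4 2))))))))),
    FAll (FAll (FEvery (cVarAt 1 2 3) (FAll (FEvery (cVarAt 1 4 5) (FSome (cDig 2 0 6) (cDig 4 0 6)))))),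
    FAll (FEvery (cVarAt 0 3 4) (cDig 3 1 2)),
    FSome (cZero 1) (FAnd (FAll (cVarDig 2 0 1)) (cCoh 1 0 0)),
    FSome (cZero 3) (FSome (cOne 4) (FAnd (FIn LEx 3) (FSome (cVarAt 0 4 5) (FAnd (FIn LAll 5)
      (FSome (cSuc 5 6) (cVarAt 1 6 2)))))),
    FSome (FIn LEx 1) (FAnd (FNeg (cZero 1)) (FSome (cSuc 1 2) (FEx (cVarAt 0 2 3)))),
    FAnds (FEx (FLt 1 2)) [cVCons 1, FSome (cZero 2) (FSome (cDig 2 1 3) (FAnds (FOr (cZero 3) (cOne 3))
      [cCoh 2 1 1, cCoh 2 1 0, FEx (FEx (FSome (cHead 4 5 6) (FAnds (FOr (cYBound 5) (cVarDig 5 1 3))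
        [FOr (cYBound 4) (FOr (FEq 4 5) (cVarDig 4 1 2)),
        FEx (FSome (cPre 7 6 8) (FSome (cLen 9) (FSome (cOne 10) (FEx (cTr 11 1 8 9 10)))))])))]))],
    FOr (FAnd (cZero 0) (cValid 1 2)) (FSome (cSuc 3 0) (FAnd (FRec [3, 1, 2])
      (FSome (cZero 4) (FSome (cDig 4 2 5) (FAll (FAll (FEvery (cVarAt 6 7 8) (FSome (cDig 7 2 9)
        (FImp (FAnd (FNeg (cZero 9)) (FNeg (FEq 9 5)))
          (FSome (FRec [3, 1, 10]) (FSome (cOne 11) (FAnd (cDig 4 10 11) (cCoh 9 2 10))))))))))))),
    FSome (cGok 1) (FEx (FSome (cSuc 2 3) (FAnd (FEvery (cElim 2 1 4) (cElim 3 1 4))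
      (FSome (cElim 2 1 4) (FSome (cZero 5) (cDig 5 4 5))))))] ! k"

section \<open>The formulas define the intended tables\<close>

lemma less_26_cases: "k < 26 \<Longrightarrow> k \<in> {0, 1, 2, 3, 4, 5, 6, 7, 8, 9, 10, 11, 12, 13, 14, 15, 16, 17, 18,
    19, 20, 21, 22, 23, 24, 25 :: nat}"
  unfolding insert_iff empty_iff by presburger

lemma wf_bodies: "k < 26 \<Longrightarrow> wf_fo arity k (bodies k) (arity k) \<and> 0 < arity k"
  by (drule less_26_cases, elim insertE emptyE)
    (simp_all add: bodies_def arity_def all_letters_def)

lemma tables_simps:
  "tables w 0 [a] \<longleftrightarrow> a = 0"
  "tables w 1 [a, b] \<longleftrightarrow> b = Suc a"
  "tables w (Suc 0) [a, b] \<longleftrightarrow> b = Suc a"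
  "tables w 2 [a] \<longleftrightarrow> a = 1"
  "tables w 3 [a, b, c] \<longleftrightarrow> a + b = c"
  "tables w 4 [a, b, c] \<longleftrightarrow> a * b = c"
  "tables w 5 [a] \<longleftrightarrow> a = length w"
  "tables w 6 [a, b, c] \<longleftrightarrow> dig w a b = c"
  "tables w 7 [a, b, c] \<longleftrightarrow> nat_at w a b c"
  "tables w 8 [a, b, c] \<longleftrightarrow> var_at w a b c"
  "tables w 9 [a] \<longleftrightarrow> in_scope w a"
  "tables w 10 [a] \<longleftrightarrow> end_arg w a"
  "tables w 11 [a, b, c] \<longleftrightarrow> vseq w a b c"
  "tables w 12 [a, b] \<longleftrightarrow> dig w a b = 1"
  "tables w 13 [a, b, c, d, e] \<longleftrightarrow> tr w a b c d e"
  "tables w 14 [a, b, c] \<longleftrightarrow> pre w a b c"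
  "tables w 15 [a, b, c] \<longleftrightarrow> corr a b c"
  "tables w 16 [a, b, c, d, e, f] \<longleftrightarrow> argrel w a b c d e f"
  "tables w 17 [a, b, c] \<longleftrightarrow> cohn w a b c"
  "tables w 18 [a] \<longleftrightarrow> vcons w a"
  "tables w 19 [a, b, c] \<longleftrightarrow> var_dig w a b c"
  "tables w 20 [a] \<longleftrightarrow> gok w a"
  "tables w 21 [a, b, c] \<longleftrightarrow> head w a b c"
  "tables w 22 [a] \<longleftrightarrow> ybound w a"
  "tables w 23 [a, b] \<longleftrightarrow> validn w a b"
  "tables w 24 [a, b, c] \<longleftrightarrow> elim w a b c"
  "tables w 25 [a] \<longleftrightarrow> acc w"
  by (simp_all add: tables_def)

text \<open>Formulas introduce a successor through a bounded quantifier. At positions of the word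
  this loses nothing, because the successor is within the bound.\<close>

lemma letter_at_le: "letter_at w a i \<Longrightarrow> Suc i \<le> size_bound w"
  using length_less_size_bound[of w] by (simp add: letter_at_def)

lemma dig_0: "dig w 0 X = X mod Suc (length w)"
  and dig_Suc: "dig w (Suc i) X = dig w i (X div Suc (length w))"
  unfolding dig_def power_Suc div_mult2_eq by simp_all

lemma dig_le: "dig w i X \<le> length w"
  by (simp add: dig_def less_Suc_eq_le[symmetric])

lemma dig_le_bound [simp]: "dig w i X \<le> size_bound w"
  using dig_le[of w i X] length_less_size_bound[of w] by simp

lemma length_le_bound [simp]: "length w \<le> size_bound w" "Suc (length w) \<le> size_bound w"
    "0 < size_bound w" "Suc 0 \<le> size_bound w" "length w < size_bound w"
  using length_less_size_bound[of w] by simp_all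

abbreviation "tsem w k us \<equiv> sem w (size_bound w) (tables w) k (bodies k) us"

lemmas tsimps = tables_simps bodies_def letter_at_def[symmetric]

lemma teq0: "a \<le> size_bound w \<Longrightarrow> tsem w 0 [a] \<longleftrightarrow> a = 0"
  by (auto simp: bodies_def)

lemma teq1: "a \<le> size_bound w \<Longrightarrow> b \<le> size_bound w \<Longrightarrow> tsem w 1 [a, b] \<longleftrightarrow> b = Suc a"
proof -
  assume "a \<le> size_bound w" "b \<le> size_bound w"
  then have "tsem w 1 [a, b] \<longleftrightarrow> a < b \<and> \<not> (\<exists>c\<le>size_bound w. a < c \<and> c < b)" by (simp add: bodies_def)
  also have "(\<exists>c\<le>size_bound w. a < c \<and> c < b) \<longleftrightarrow> Suc a < b"
    using \<open>b \<le> _\<close> by (auto intro: exI[of _ "Suc a"])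
  finally show ?thesis by linarith
qed

lemma teq2: "a \<le> size_bound w \<Longrightarrow> tsem w 2 [a] \<longleftrightarrow> a = 1"
  by (auto simp: bodies_def tables_simps)

lemma teq3: "t \<le> size_bound w \<Longrightarrow> x \<le> size_bound w \<Longrightarrow> y \<le> size_bound w \<Longrightarrow>
    tsem w 3 [t, x, y] \<longleftrightarrow> t + x = y"
  by (cases t; cases y) (auto simp: bodies_def tables_simps)

lemma teq4: "t \<le> size_bound w \<Longrightarrow> x \<le> size_bound w \<Longrightarrow> y \<le> size_bound w \<Longrightarrow>
    tsem w 4 [t, x, y] \<longleftrightarrow> t * x = y"
  by (cases t) (auto simp: bodies_def tables_simps)

lemma teq5: "a \<le> size_bound w \<Longrightarrow> tsem w 5 [a] \<longleftrightarrow> a = length w"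
proof -
  assume a: "a \<le> size_bound w"
  have "tsem w 5 [a] \<longleftrightarrow> (\<forall>b\<le>size_bound w. b < a \<longleftrightarrow> b < length w)"
    by (simp add: bodies_def all_letters)
  also have "\<dots> \<longleftrightarrow> a = length w"
  proof (intro iffI)
    assume *: "\<forall>b\<le>size_bound w. b < a \<longleftrightarrow> b < length w"
    show "a = length w"
      using spec[OF *, of a] spec[OF *, of "length w"] a length_le_bound(1)[of w] by auto
  qed simp
  finally show ?thesis .
qed

text \<open>Division with remainder: for \<open>X = B * Q + r\<close> with \<open>r < B\<close>,
  digit 0 of \<open>X\<close> is \<open>r\<close> and digit \<open>Suc j\<close> is digit
  \<open>j\<close> of \<open>Q\<close>. Quotient and product do not exceed \<open>X\<close>, so the
  bounded quantifiers find them.\<close>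

lemma teq6: "i \<le> size_bound w \<Longrightarrow> X \<le> size_bound w \<Longrightarrow> d \<le> size_bound w \<Longrightarrow>
    tsem w 6 [i, X, d] \<longleftrightarrow> dig w i X = d"
proof -
  assume le: "i \<le> size_bound w" "X \<le> size_bound w" "d \<le> size_bound w"
  let ?N = "size_bound w" and ?B = "Suc (length w)"
  have "tsem w 6 [i, X, d] \<longleftrightarrow> (\<exists>Q\<le>?N. \<exists>M\<le>?N. ?B * Q = M \<and> (\<exists>r\<le>?N. M + r = X \<and> r < ?B \<and>
      (i = 0 \<and> d = r \<or> (\<exists>j\<le>?N. i = Suc j \<and> dig w j Q = d))))"
    using le by (auto simp: bodies_def tables_simps)
  also have "\<dots> \<longleftrightarrow> (\<exists>Q r. ?B * Q + r = X \<and> r < ?B \<and> (i = 0 \<and> d = r \<or> (\<exists>j. i = Suc j \<and> dig w j Q = d)))"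
    (is "?L \<longleftrightarrow> ?R")
  proof
    show "?L \<Longrightarrow> ?R" by blast
    assume ?R
    then obtain Q r where Q: "?B * Q + r = X" "r < ?B" "i = 0 \<and> d = r \<or> (\<exists>j. i = Suc j \<and> dig w j Q = d)" by blast
    have "Q \<le> ?B * Q" by simp
    then have "Q \<le> ?N" "?B * Q \<le> ?N" "r \<le> ?N" using Q(1) le(2) by linarith+
    moreover have "\<exists>r\<le>?N. ?B * Q + r = X \<and> r < ?B \<and> (i = 0 \<and> d = r \<or> (\<exists>j\<le>?N. i = Suc j \<and> dig w j Q = d))"
      using Q le(1) \<open>r \<le> ?N\<close> by (intro exI[of _ r]) auto
    ultimately show ?L by blast
  qed
  also have "\<dots> \<longleftrightarrow> (i = 0 \<and> d = X mod ?B \<or> (\<exists>j. i = Suc j \<and> dig w j (X div ?B) = d))"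
    (is "?L \<longleftrightarrow> ?R")
  proof
    assume ?L
    then obtain Q r where Q: "?B * Q + r = X" "r < ?B" "i = 0 \<and> d = r \<or> (\<exists>j. i = Suc j \<and> dig w j Q = d)" by blast
    have "(?B * Q + r) div ?B = Q" "(?B * Q + r) mod ?B = r"
      using Q(2) by (simp_all only: div_mult_self4[OF nat.distinct(2)] mod_mult_self4 div_less mod_less add_0_right)
    then have "X div ?B = Q" "X mod ?B = r" unfolding Q(1) by blast+
    then show ?R using Q(3) by simp
  next
    assume ?R
    show ?L
      by (rule exI[of _ "X div ?B"], rule exI[of _ "X mod ?B"])
        (use \<open>?R\<close> in \<open>simp only: mult_div_mod_eq, auto\<close>)
  qed
  also have "\<dots> \<longleftrightarrow> dig w i X = d"
    by (cases i) (auto simp: dig_0 dig_Suc)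
  finally show ?thesis .
qed

text \<open>Halving is expressed through doubling, which stays within the bound as the result is at
  most \<open>v\<close>.\<close>

lemma teq7: "v \<le> size_bound w \<Longrightarrow> i \<le> size_bound w \<Longrightarrow> k \<le> size_bound w \<Longrightarrow>
    tsem w 7 [v, i, k] \<longleftrightarrow> nat_at w v i k"
proof -
  assume le: "v \<le> size_bound w" "i \<le> size_bound w" "k \<le> size_bound w"
  let ?N = "size_bound w"
  have "tsem w 7 [v, i, k] \<longleftrightarrow> v = 0 \<and> i = k \<and> \<not> bit w i \<or> (\<exists>h\<le>?N. h + h \<le> ?N \<and> Suc i \<le> ?N \<and> h < v \<and>
      nat_at w h (Suc i) k \<and> (v = Suc (h + h) \<and> letter_at w (LBit True) i \<or> h + h = v \<and> letter_at w (LBit False) i))"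
    using le by (auto simp: tsimps)
  also have "\<dots> \<longleftrightarrow> nat_at w v i k"
  proof (cases "v = 0")
    case True
    then show ?thesis by (simp add: nat_at.simps)
  next
    case False
    have *: "h + h \<le> ?N" "h \<le> ?N" if "v = Suc (h + h) \<or> h + h = v" for h using that le by auto
    have "nat_at w v i k \<longleftrightarrow> letter_at w (LBit (odd v)) i \<and> nat_at w (v div 2) (Suc i) k"
      using False by (subst nat_at.simps) simp
    also have "\<dots> \<longleftrightarrow> (\<exists>h. h < v \<and> nat_at w h (Suc i) k \<and>
        (v = Suc (h + h) \<and> letter_at w (LBit True) i \<or> h + h = v \<and> letter_at w (LBit False) i))"
    proof
      have "odd v \<Longrightarrow> v = Suc (v div 2 + v div 2)" "even v \<Longrightarrow> v div 2 + v div 2 = v" by presburger+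
      then show "\<exists>h. h < v \<and> nat_at w h (Suc i) k \<and>
          (v = Suc (h + h) \<and> letter_at w (LBit True) i \<or> h + h = v \<and> letter_at w (LBit False) i)"
        if "letter_at w (LBit (odd v)) i \<and> nat_at w (v div 2) (Suc i) k"
        using that False by (intro exI[of _ "v div 2"]) (cases "odd v"; simp)
    qed (auto simp flip: mult_2)
    finally show ?thesis using False * letter_at_le[of w "LBit True" i] letter_at_le[of w "LBit False" i]
      by (simp del: length_le_bound) blast
  qed
  finally show ?thesis .
qed

lemma letter_at_Suc [simp]:
  "letter_at w a i \<and> Suc i \<le> size_bound w \<and> P \<longleftrightarrow> letter_at w a i \<and> P"
  "(letter_at w a i \<or> letter_at w b i) \<and> Suc i \<le> size_bound w \<and> P \<longleftrightarrow>
    (letter_at w a i \<or> letter_at w b i) \<and> P"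
  using letter_at_le by blast+

lemma teq8: "v \<le> size_bound w \<Longrightarrow> i \<le> size_bound w \<Longrightarrow> k \<le> size_bound w \<Longrightarrow>
    tsem w 8 [v, i, k] \<longleftrightarrow> var_at w v i k"
  by (simp add: tsimps var_at_def)

lemma teq9: "v \<le> size_bound w \<Longrightarrow> tsem w 9 [v] \<longleftrightarrow> in_scope w v"
  by (simp add: tsimps in_scope_def)

lemma teq10: "k \<le> size_bound w \<Longrightarrow> tsem w 10 [k] \<longleftrightarrow> end_arg w k"
  by (auto simp: tsimps end_arg_def not_less)

lemma teq11: "t \<le> size_bound w \<Longrightarrow> k \<le> size_bound w \<Longrightarrow> j \<le> size_bound w \<Longrightarrow>
    tsem w 11 [t, k, j] \<longleftrightarrow> vseq w t k j"
  by (cases t) (simp_all add: tsimps)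

lemma teq12: "i \<le> size_bound w \<Longrightarrow> X \<le> size_bound w \<Longrightarrow> tsem w 12 [i, X] \<longleftrightarrow> dig w i X = 1"
  by (simp add: tsimps)

lemma teq14: "t \<le> size_bound w \<Longrightarrow> i \<le> size_bound w \<Longrightarrow> s \<le> size_bound w \<Longrightarrow>
    tsem w 14 [t, i, s] \<longleftrightarrow> pre w t i s"
  by (cases t) (simp_all add: tsimps)

lemma teq15: "m \<le> size_bound w \<Longrightarrow> c \<le> size_bound w \<Longrightarrow> d \<le> size_bound w \<Longrightarrow>
    tsem w 15 [m, c, d] \<longleftrightarrow> corr m c d"
  by (auto simp: tsimps corr_def)

lemma teq16: "t \<le> size_bound w \<Longrightarrow> m \<le> size_bound w \<Longrightarrow> X \<le> size_bound w \<Longrightarrow> k \<le> size_bound w \<Longrightarrow>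
    Y \<le> size_bound w \<Longrightarrow> l \<le> size_bound w \<Longrightarrow> tsem w 16 [t, m, X, k, Y, l] \<longleftrightarrow> argrel w t m X k Y l"
  by (cases t) (simp_all add: tsimps)

lemma teq17: "m \<le> size_bound w \<Longrightarrow> X \<le> size_bound w \<Longrightarrow> Y \<le> size_bound w \<Longrightarrow>
    tsem w 17 [m, X, Y] \<longleftrightarrow> cohn w m X Y"
proof -
  assume le: "m \<le> size_bound w" "X \<le> size_bound w" "Y \<le> size_bound w"
  have "tsem w 17 [m, X, Y] \<longleftrightarrow> (\<forall>i\<le>size_bound w. letter_at w LRel i \<longrightarrow>
    (\<forall>a\<le>size_bound w. letter_at w LRel a \<longrightarrow> Suc i \<le> size_bound w \<longrightarrow> Suc a \<le> size_bound w \<longrightarrow>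
    (\<forall>r\<le>size_bound w. \<forall>k\<le>size_bound w. nat_at w r (Suc i) k \<longrightarrow>
    (\<forall>l\<le>size_bound w. nat_at w r (Suc a) l \<longrightarrow>
    (\<forall>t\<le>size_bound w. argrel w t m X k Y l \<longrightarrow> (dig w i X = 1 \<longleftrightarrow> dig w a Y = 1))))))"
    by (simp add: tsimps)
  also have "\<dots> \<longleftrightarrow> cohn w m X Y"
    unfolding cohn_def using letter_at_le[of w LRel] by (meson order_refl)
  finally show ?thesis .
qed

lemma teq18: "X \<le> size_bound w \<Longrightarrow> tsem w 18 [X] \<longleftrightarrow> vcons w X"
  by (simp add: tsimps vcons_def)

lemma teq19: "v \<le> size_bound w \<Longrightarrow> X \<le> size_bound w \<Longrightarrow> c \<le> size_bound w \<Longrightarrow>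
    tsem w 19 [v, X, c] \<longleftrightarrow> var_dig w v X c"
  by (simp add: tsimps var_dig_def)

lemma teq20: "G \<le> size_bound w \<Longrightarrow> tsem w 20 [G] \<longleftrightarrow> gok w G"
  by (simp add: tsimps gok_def)

lemma teq21: "z \<le> size_bound w \<Longrightarrow> x \<le> size_bound w \<Longrightarrow> e \<le> size_bound w \<Longrightarrow>
    tsem w 21 [z, x, e] \<longleftrightarrow> head w z x e"
  by (simp add: tsimps head_def)

lemma teq22: "v \<le> size_bound w \<Longrightarrow> tsem w 22 [v] \<longleftrightarrow> ybound w v"
  using letter_at_le[of w LEx] by (simp add: tsimps ybound_def) blast

lemma teq23: "G \<le> size_bound w \<Longrightarrow> X \<le> size_bound w \<Longrightarrow> tsem w 23 [G, X] \<longleftrightarrow> validn w G X"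
proof -
  assume le: "G \<le> size_bound w" "X \<le> size_bound w"
  have "(\<exists>b\<le>size_bound w. X < b) \<longleftrightarrow> X < size_bound w" by (meson le_refl less_le_trans)
  then show ?thesis using le by (simp add: tsimps validn_def)
qed

lemma teq24: "t \<le> size_bound w \<Longrightarrow> G \<le> size_bound w \<Longrightarrow> X \<le> size_bound w \<Longrightarrow>
    tsem w 24 [t, G, X] \<longleftrightarrow> elim w t G X"
  by (cases t) (simp_all add: tsimps)

lemma teq25: "a \<le> size_bound w \<Longrightarrow> tsem w 25 [a] \<longleftrightarrow> acc w"
proof -
  have *: "(\<exists>t\<le>size_bound w. t < size_bound w \<and> P t) \<longleftrightarrow> (\<exists>t<size_bound w. P t)" for P
    using less_imp_le by blast
  show ?thesis by (simp add: tsimps acc_def Suc_le_eq * del: elim.simps)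
qed

text \<open>The formula begins by introducing \<open>Suc i\<close> and fails if that exceeds the
  bound. Then there is no letter at position \<open>i\<close>, and \<open>tr\<close> fails
  too.\<close>

lemma teq13: "t \<le> size_bound w \<Longrightarrow> X \<le> size_bound w \<Longrightarrow> i \<le> size_bound w \<Longrightarrow> j \<le> size_bound w \<Longrightarrow>
    b \<le> size_bound w \<Longrightarrow> tsem w 13 [t, X, i, j, b] \<longleftrightarrow> tr w t X i j b"
proof (cases t)
  case 0
  then show ?thesis by (simp add: tsimps)
next
  case (Suc t')
  assume le: "t \<le> size_bound w" "X \<le> size_bound w" "i \<le> size_bound w" "j \<le> size_bound w" "b \<le> size_bound w"
  show ?thesis
  proof (cases "Suc i \<le> size_bound w")
    case True
    then show ?thesis using le Suc by (simp add: tsimps)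
  next
    case False
    then have "\<not> letter_at w a i" for a using letter_at_le by blast
    then show ?thesis using le Suc False by (simp add: tsimps)
  qed
qed

lemma tuples_simps:
  "us \<in> tuples (Suc 0) N \<longleftrightarrow> (\<exists>a\<le>N. us = [a])"
  "us \<in> tuples 2 N \<longleftrightarrow> (\<exists>a\<le>N. \<exists>b\<le>N. us = [a, b])"
  "us \<in> tuples 3 N \<longleftrightarrow> (\<exists>a\<le>N. \<exists>b\<le>N. \<exists>c\<le>N. us = [a, b, c])"
  "us \<in> tuples 5 N \<longleftrightarrow> (\<exists>a\<le>N. \<exists>b\<le>N. \<exists>c\<le>N. \<exists>d\<le>N. \<exists>e\<le>N. us = [a, b, c, d, e])"
  "us \<in> tuples 6 N \<longleftrightarrow> (\<exists>a\<le>N. \<exists>b\<le>N. \<exists>c\<le>N. \<exists>d\<le>N. \<exists>e\<le>N. \<exists>f\<le>N. us = [a, b, c, d, e, f])"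
  by (auto simp: tuples_def length_Suc_conv numeral_eq_Suc)

lemma tables_sem:
  assumes "k < 26" and us: "us \<in> tuples (arity k) (size_bound w)"
  shows "tables w k us = tsem w k us"
proof -
  note teqs = teq0 teq1 teq2 teq3 teq4 teq5 teq6 teq7 teq8 teq9 teq10 teq11 teq12 teq13 teq14 teq15
    teq16 teq17 teq18 teq19 teq20 teq21 teq22 teq23 teq24 teq25
  from less_26_cases[OF assms(1)] us show ?thesis
    by (elim insertE emptyE)
      (auto simp: tuples_simps arity_def tables_simps teqs teq1[unfolded One_nat_def])
qed

theorem acc_EXPTIME: "{w. acc w} \<in> EXPTIME"
proof -
  have "{w. \<exists>a\<le>size_bound w. tables w (26 - 1) [a]} \<in> EXPTIME"
  proof (rule EXPTIME_tables[of 26 arity bodies tables])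
    show "wf_fo arity k (bodies k) (arity k) \<and> 0 < arity k" if "k < 26" for k
      using that by (rule wf_bodies)
    show "tables w k us = tsem w k us" if "k < 26" "us \<in> tuples (arity k) (size_bound w)" for w k us
      using that by (rule tables_sem)
  qed (simp_all add: arity_def)
  moreover have "(\<exists>a\<le>size_bound w. tables w (26 - 1) [a]) \<longleftrightarrow> acc w" for w
    by (auto simp: tables_simps)
  ultimately show ?thesis by simp
qed

section \<open>Correctness of the decision procedure\<close>

subsection \<open>Parsing\<close>

lemma letter_at_iff: "letter_at w a i \<longleftrightarrow> i < length w \<and> drop i w = a # drop (Suc i) w"
proof (cases "i < length w")
  case True
  then show ?thesis using Cons_nth_drop_Suc[OF True] by (auto simp: letter_at_def)
qed (simp add: letter_at_def)

lemma letter_at_if_drop: "drop i w = a # u \<Longrightarrow> letter_at w a i \<and> u = drop (Suc i) w \<and> i < length w"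
proof -
  assume *: "drop i w = a # u"
  then have "i < length w" by (metis drop_all linorder_not_le list.distinct(1))
  then show ?thesis using * Cons_nth_drop_Suc[of i w] by (auto simp: letter_at_def)
qed

lemma drop_append_shift:
  "drop k w = A @ B \<Longrightarrow> k \<le> length w \<Longrightarrow> drop (k + length A) w = B \<and> k + length A \<le> length w"
proof -
  assume *: "drop k w = A @ B" "k \<le> length w"
  have "drop (k + length A) w = drop (length A) (drop k w)" by (simp add: add.commute)
  moreover have "length w - k = length A + length B" using arg_cong[OF *(1), of length] by simp
  then have "k + length A \<le> length w" using *(2) by linarith
  ultimately show ?thesis using * by auto
qed

lemma drop_eq_drop:
  assumes "i \<le> length w" "j \<le> length w"
  shows "drop i w = drop j w \<longleftrightarrow> i = j"
proof
  assume "drop i w = drop j w"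
  then have "length (drop i w) = length (drop j w)" by (rule arg_cong)
  then show "i = j" using assms by simp
qed simp

lemma drop_letter_iff: "(\<exists>u. drop i w = a # u) \<longleftrightarrow> letter_at w a i"
  using letter_at_if_drop[of i w a] letter_at_iff[of w a i] by blast

lemma no_bit_drop: "no_bit (drop i w) \<longleftrightarrow> \<not> bit w i"
proof -
  have "no_bit (drop i w) \<longleftrightarrow> \<not> (\<exists>b. \<exists>u. drop i w = LBit b # u)" by (auto simp: no_bit_def)
  also have "\<dots> \<longleftrightarrow> \<not> bit w i" unfolding drop_letter_iff bit_def ex_bool_eq by blast
  finally show ?thesis .
qed

lemma end_arg_iff: "end_arg w k \<longleftrightarrow> k \<le> length w \<and> no_arg (drop k w)"
  unfolding end_arg_def no_arg_def no_bit_drop using drop_letter_iff[of k w LVar] by blast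

lemma encode_nat_0: "encode_nat 0 = []"
  by (simp add: encode_nat_def bits_0)

lemma encode_nat_pos: "v \<noteq> 0 \<Longrightarrow> encode_nat v = LBit (odd v) # encode_nat (v div 2)"
  by (simp add: encode_nat_def bits_pos)

text \<open>Replaces positions by suffixes of the word, the form to which unique readability
  applies. The other parsing predicates are treated in the same way.\<close>

lemma nat_at_iff:
  "i \<le> length w \<Longrightarrow> nat_at w v i k \<longleftrightarrow>
    k \<le> length w \<and> drop i w = encode_nat v @ drop k w \<and> no_bit (drop k w)"
proof (induction v arbitrary: i rule: less_induct)
  case (less v)
  show ?case
  proof (cases "v = 0")
    case True
    then show ?thesis using less.prems
      by (subst nat_at.simps) (auto simp: encode_nat_0 no_bit_drop drop_eq_drop)
  next
    case False
    show ?thesis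
    proof (cases "letter_at w (LBit (odd v)) i")
      case True
      then have d: "drop i w = LBit (odd v) # drop (Suc i) w" and "Suc i \<le> length w"
        by (auto simp: letter_at_iff)
      then have "nat_at w (v div 2) (Suc i) k \<longleftrightarrow>
          k \<le> length w \<and> drop (Suc i) w = encode_nat (v div 2) @ drop k w \<and> no_bit (drop k w)"
        using False by (intro less.IH) auto
      then show ?thesis using False True by (subst nat_at.simps) (simp add: encode_nat_pos d)
    next
      case 2: False
      then have "drop i w \<noteq> encode_nat v @ drop k w"
        using False letter_at_if_drop[of i w "LBit (odd v)"] by (auto simp: encode_nat_pos)
      then show ?thesis using False 2 by (subst nat_at.simps) simp
    qed
  qed
qed

lemma var_at_iff:
  "var_at w v i k \<longleftrightarrow> k \<le> length w \<and> drop i w = encode_var v @ drop k w \<and> no_bit (drop k w)"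
proof (cases "letter_at w LVar i")
  case True
  then show ?thesis
    using nat_at_iff[of "Suc i" w v k] by (auto simp: var_at_def letter_at_iff encode_var_def)
next
  case False
  then show ?thesis
    using letter_at_if_drop[of i w LVar] by (auto simp: var_at_def encode_var_def)
qed

lemma less_power_length_bits: "v < 2 ^ length (bits v)"
proof (induction v rule: less_induct)
  case (less v)
  show ?case
  proof (cases "v = 0")
    case False
    then have "v div 2 < 2 ^ length (bits (v div 2))" by (intro less.IH) simp
    then show ?thesis using False by (simp add: bits_pos)
  qed (simp add: bits_0)
qed

text \<open>A numeral in the word has at most \<open>length w\<close> bits. Names may exceed the
  length of the word, but not the exponential bound of the quantifiers.\<close>

lemma nat_at_bound: "i \<le> length w \<Longrightarrow> nat_at w v i k \<Longrightarrow> v \<le> size_bound w"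
proof -
  assume "i \<le> length w" "nat_at w v i k"
  then have eq: "drop i w = encode_nat v @ drop k w" by (simp add: nat_at_iff)
  have "length w - i = length (bits v) + (length w - k)"
    using arg_cong[OF eq, of length] by (simp add: encode_nat_def)
  then have "length (bits v) \<le> length w" by linarith
  then have "length (bits v) \<le> (length w + 1)\<^sup>2" by (simp add: power2_eq_square)
  then have "(2::nat) ^ length (bits v) \<le> size_bound w"
    unfolding size_bound_def by (intro power_increasing) auto
  then show ?thesis using less_power_length_bits[of v] by simp
qed

lemma var_at_bound:
  assumes "var_at w v i k"
  shows "v \<le> size_bound w" "i \<le> size_bound w" "k \<le> size_bound w" "i < length w" "k \<le> length w"
proof -
  have *: "letter_at w LVar i" "nat_at w v (Suc i) k" using assms by (auto simp: var_at_def)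
  then show "i < length w" by (simp add: letter_at_def)
  then show "i \<le> size_bound w" using length_le_bound(1)[of w] by linarith
  show "v \<le> size_bound w" using nat_at_bound[of "Suc i" w v k] * \<open>i < length w\<close> by simp
  show "k \<le> length w" using assms by (simp add: var_at_iff)
  then show "k \<le> size_bound w" using length_le_bound(1)[of w] by linarith
qed

lemma var_at_unique:
  assumes "var_at w v i k" "var_at w v' i k'"
  shows "v = v' \<and> k = k'"
proof -
  note * = assms[unfolded var_at_iff]
  have "encode_var v @ drop k w = encode_var v' @ drop k' w" using * by metis
  from encode_var_append_inject[OF this] have "v = v'" "drop k w = drop k' w" using * by blast+
  then show ?thesis using * drop_eq_drop by blast
qed

lemma in_scope_iff:
  "in_scope w v \<longleftrightarrow> (\<exists>i k. (letter_at w LEx i \<or> letter_at w LAll i) \<and> var_at w v (Suc i) k)"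
proof
  assume "\<exists>i k. (letter_at w LEx i \<or> letter_at w LAll i) \<and> var_at w v (Suc i) k"
  then obtain i k where *: "letter_at w LEx i \<or> letter_at w LAll i" "var_at w v (Suc i) k" by blast
  then have "i \<le> size_bound w" "k \<le> size_bound w" using var_at_bound[OF *(2)] by auto
  then show "in_scope w v" unfolding in_scope_def using * by blast
qed (auto simp: in_scope_def)

lemma ybound_iff: "ybound w v \<longleftrightarrow> (\<exists>i k. 0 < i \<and> letter_at w LEx i \<and> var_at w v (Suc i) k)"
proof
  assume "\<exists>i k. 0 < i \<and> letter_at w LEx i \<and> var_at w v (Suc i) k"
  then obtain i k where *: "0 < i" "letter_at w LEx i" "var_at w v (Suc i) k" by blast
  then have "i \<le> size_bound w" "k \<le> size_bound w" using var_at_bound[OF *(3)] by auto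
  then show "ybound w v" unfolding ybound_def using * by blast
qed (auto simp: ybound_def)

text \<open>Some occurrence of the variable; for numbers satisfying \<open>vcons\<close> all
  occurrences have the same digit.\<close>

definition var_pos :: "letter list \<Rightarrow> nat \<Rightarrow> nat" where
  "var_pos w v = (SOME i. \<exists>k. var_at w v i k)"

definition vars :: "letter list \<Rightarrow> nat set" where
  "vars w = {v. \<exists>i k. var_at w v i k}"

lemma var_pos: "v \<in> vars w \<Longrightarrow> \<exists>k. var_at w v (var_pos w v) k"
  unfolding vars_def var_pos_def mem_Collect_eq by (rule someI_ex)

lemma vseq_sound:
  "k \<le> length w \<Longrightarrow> vseq w t k j \<Longrightarrow> end_arg w j \<and> (\<exists>vs. length vs = t \<and>
    drop k w = concat (map encode_var vs) @ drop j w \<and> (\<forall>v\<in>set vs. in_scope w v))"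
proof (induction t arbitrary: k)
  case 0
  then show ?case by auto
next
  case (Suc t)
  then obtain v k' where v: "var_at w v k k'" "in_scope w v" "vseq w t k' j" by auto
  then obtain vs where "end_arg w j" "length vs = t" "drop k' w = concat (map encode_var vs) @ drop j w"
    "\<forall>v\<in>set vs. in_scope w v" using Suc.IH[of k'] by (auto simp: var_at_iff)
  then show ?case using v by (intro conjI exI[of _ "v # vs"]) (auto simp: var_at_iff)
qed

lemma next_var:
  assumes "k \<le> length w" "drop k w = concat (map encode_var (v # vs)) @ drop j w" "end_arg w j"
  obtains k' where "var_at w v k k'" "k' \<le> length w" "drop k' w = concat (map encode_var vs) @ drop j w"
proof
  let ?k = "k + length (encode_var v)"
  have *: "drop ?k w = concat (map encode_var vs) @ drop j w" "?k \<le> length w"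
    using drop_append_shift[of k w "encode_var v" "concat (map encode_var vs) @ drop j w"] assms by auto
  then show "?k \<le> length w" "drop ?k w = concat (map encode_var vs) @ drop j w" by auto
  have "no_bit (drop j w)" using assms(3) by (simp add: end_arg_iff no_arg_def)
  then show "var_at w v k ?k" using * assms no_bit_encode_vars[of "drop j w" vs] by (simp add: var_at_iff)
qed

lemma vseq_complete:
  "k \<le> length w \<Longrightarrow> drop k w = concat (map encode_var vs) @ drop j w \<Longrightarrow> end_arg w j \<Longrightarrow>
    (\<forall>v\<in>set vs. in_scope w v) \<Longrightarrow> vseq w (length vs) k j"
proof (induction vs arbitrary: k)
  case Nil
  then show ?case by (auto simp: end_arg_iff drop_eq_drop)
next
  case (Cons v vs)
  obtain k' where k': "var_at w v k k'" "k' \<le> length w" "drop k' w = concat (map encode_var vs) @ drop j w"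
    by (rule next_var[OF Cons.prems(1-3)])
  then have "vseq w (length vs) k' j" using Cons by simp
  then show ?case using k' var_at_bound[OF k'(1)] Cons.prems(4) by auto
qed

definition atom_at :: "letter list \<Rightarrow> nat \<Rightarrow> nat \<Rightarrow> nat list \<Rightarrow> bool" where
  "atom_at w i r vs \<longleftrightarrow> (\<exists>j. drop i w = encode (Rel r vs) @ drop j w \<and> end_arg w j)"

text \<open>The atoms are collected from the word and not from the matrix, so they are available
  before the word is known to be a formula.\<close>

definition ats :: "letter list \<Rightarrow> (nat \<times> nat list) set" where
  "ats w = {(r, vs). \<exists>i. atom_at w i r vs}"

lemma args_vars:
  "k \<le> length w \<Longrightarrow> drop k w = concat (map encode_var vs) @ drop j w \<Longrightarrow> end_arg w j \<Longrightarrow> set vs \<subseteq> vars w"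
proof (induction vs arbitrary: k)
  case (Cons v vs)
  obtain k' where k': "var_at w v k k'" "k' \<le> length w" "drop k' w = concat (map encode_var vs) @ drop j w"
    by (rule next_var[OF Cons.prems(1-3)])
  then show ?case using Cons.IH[of k'] Cons.prems(3) by (auto simp: vars_def)
qed simp

lemma atom_at_iff:
  "atom_at w i r vs \<longleftrightarrow> letter_at w LRel i \<and> (\<exists>k j. nat_at w r (Suc i) k \<and> k \<le> length w \<and>
    drop k w = concat (map encode_var vs) @ drop j w \<and> end_arg w j)"
proof
  assume "atom_at w i r vs"
  then obtain j where j: "drop i w = LRel # encode_nat r @ concat (map encode_var vs) @ drop j w" "end_arg w j"
    by (auto simp: atom_at_def)
  then have i: "letter_at w LRel i" "i < length w" "drop (Suc i) w = encode_nat r @ concat (map encode_var vs) @ drop j w"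
    using letter_at_if_drop by auto
  let ?k = "Suc i + length (encode_nat r)"
  have k: "drop ?k w = concat (map encode_var vs) @ drop j w" "?k \<le> length w"
    using drop_append_shift[OF i(3)] i(2) by auto
  have "no_bit (drop j w)" using j(2) by (simp add: end_arg_iff no_arg_def)
  then have "nat_at w r (Suc i) ?k"
    using k i no_bit_encode_vars[of "drop j w" vs] by (simp add: nat_at_iff)
  then show "letter_at w LRel i \<and> (\<exists>k j. nat_at w r (Suc i) k \<and> k \<le> length w \<and>
    drop k w = concat (map encode_var vs) @ drop j w \<and> end_arg w j)" using k i j by blast
next
  assume "letter_at w LRel i \<and> (\<exists>k j. nat_at w r (Suc i) k \<and> k \<le> length w \<and>
    drop k w = concat (map encode_var vs) @ drop j w \<and> end_arg w j)"
  then show "atom_at w i r vs"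
    by (auto simp: atom_at_def letter_at_iff nat_at_iff)
qed

lemma atom_at_unique:
  assumes "atom_at w i r vs" "atom_at w i r' vs'"
  shows "r = r' \<and> vs = vs'"
proof -
  obtain j j' where *: "drop i w = encode (Rel r vs) @ drop j w" "end_arg w j"
    "drop i w = encode (Rel r' vs') @ drop j' w" "end_arg w j'"
    using assms unfolding atom_at_def by blast
  then have "encode (Rel r vs) @ drop j w = encode (Rel r' vs') @ drop j' w" by metis
  from encode_append_inject[OF this] * show ?thesis by (simp add: end_arg_iff)
qed

lemma ats_vars: "(r, vs) \<in> ats w \<Longrightarrow> set vs \<subseteq> vars w"
  unfolding ats_def atom_at_iff using args_vars by blast

lemma split_binary:
  assumes "drop i w = a # encode p @ encode q @ drop j w"
  obtains k where "drop (Suc i) w = encode p @ drop k w" "drop k w = encode q @ drop j w" "end_arg w k"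
    "letter_at w a i"
proof
  have *: "drop (Suc i) w = encode p @ encode q @ drop j w" "Suc i \<le> length w" "letter_at w a i"
    using letter_at_if_drop[OF assms] by auto
  let ?k = "Suc i + length (encode p)"
  have k: "drop ?k w = encode q @ drop j w" "?k \<le> length w"
    using drop_append_shift[OF *(1,2)] by auto
  show "drop ?k w = encode q @ drop j w" by (rule k(1))
  show "drop (Suc i) w = encode p @ drop ?k w" using *(1) by (simp only: k(1))
  show "end_arg w ?k" unfolding end_arg_iff k(1) using k(2) no_arg_encode by blast
  show "letter_at w a i" by (rule *(3))
qed

lemma sub_formula:
  assumes "qfree p" "drop i w = encode p @ drop j w" "end_arg w j"
  shows "atoms p \<subseteq> ats w \<and> fv p \<subseteq> vars w"
proof -
  have binary: "atoms p \<union> atoms q \<subseteq> ats w \<and> fv p \<union> fv q \<subseteq> vars w"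
    if d: "drop i w = a # encode p @ encode q @ drop j w" and e: "end_arg w j"
      and 1: "\<And>i j. drop i w = encode p @ drop j w \<Longrightarrow> end_arg w j \<Longrightarrow> atoms p \<subseteq> ats w \<and> fv p \<subseteq> vars w"
      and 2: "\<And>i j. drop i w = encode q @ drop j w \<Longrightarrow> end_arg w j \<Longrightarrow> atoms q \<subseteq> ats w \<and> fv q \<subseteq> vars w"
    for i j a p q
  proof -
    obtain k where k: "drop (Suc i) w = encode p @ drop k w" "drop k w = encode q @ drop j w"
        "end_arg w k" "letter_at w a i"
      by (rule split_binary[OF d])
    from 1[OF k(1,3)] 2[OF k(2) e] show ?thesis by simp
  qed
  show ?thesis using assms
  proof (induction p arbitrary: i j)
    case (Eq x y)
    have *: "drop (Suc i) w = concat (map encode_var [x, y]) @ drop j w" "Suc i \<le> length w"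
      using letter_at_if_drop[of i w LEq] Eq.prems(2) by auto
    show ?case using args_vars[OF *(2,1) Eq.prems(3)] by simp
  next
    case (Rel r vs)
    then have "atom_at w i r vs" by (auto simp: atom_at_def)
    then have "(r, vs) \<in> ats w" by (auto simp: ats_def)
    then show ?case using ats_vars by auto
  next
    case (Neg p)
    then have "drop i w = LNeg # encode p @ drop j w" by simp
    then have "drop (Suc i) w = encode p @ drop j w" using letter_at_if_drop by metis
    from Neg.IH[OF _ this] Neg.prems show ?case by simp
  next
    case (Conj p q)
    show ?case using binary[of i LConj p q j] Conj by simp
  next
    case (Disj p q)
    show ?case using binary[of i LDisj p q j] Disj by simp
  next
    case (Imp p q)
    show ?case using binary[of i LImp p q j] Imp by simp
  next
    case (Iff p q)
    show ?case using binary[of i LIff p q j] Iff by simp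
  qed simp_all
qed

subsection \<open>Configurations as numbers\<close>

definition kap :: "letter list \<Rightarrow> nat \<Rightarrow> nat \<Rightarrow> nat" where
  "kap w X v = dig w (var_pos w v) X"

text \<open>An atom has a digit at each of its occurrences. One occurrence is picked, and
  \<open>tau_ok\<close> expresses that the choice is immaterial.\<close>

definition tau :: "letter list \<Rightarrow> nat \<Rightarrow> nat \<Rightarrow> nat list \<Rightarrow> bool" where
  "tau w X r vs \<longleftrightarrow> dig w (SOME i. atom_at w i r vs) X = 1"

definition tau_ok :: "letter list \<Rightarrow> nat \<Rightarrow> bool" where
  "tau_ok w X \<longleftrightarrow> (\<forall>i r vs. atom_at w i r vs \<longrightarrow> (dig w i X = 1 \<longleftrightarrow> tau w X r vs))"

lemma kap:
  assumes "vcons w X" "var_at w v i k"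
  shows "dig w i X = kap w X v"
proof -
  obtain k' where k': "var_at w v (var_pos w v) k'" using var_pos[of v w] assms(2) by (auto simp: vars_def)
  show ?thesis
    using assms var_at_bound[OF assms(2)] var_at_bound[OF k'] k' unfolding vcons_def kap_def by blast
qed

lemma end_arg_cong: "drop k w = drop j w \<Longrightarrow> k \<le> length w \<Longrightarrow> end_arg w j \<Longrightarrow> end_arg w k"
  by (simp add: end_arg_iff)

lemma argrel_sound:
  assumes "vcons w X" "vcons w Y"
  shows "k \<le> length w \<Longrightarrow> l \<le> length w \<Longrightarrow> argrel w t m X k Y l \<Longrightarrow>
    \<exists>vs us j j'. drop k w = concat (map encode_var vs) @ drop j w \<and> end_arg w j \<and>
      drop l w = concat (map encode_var us) @ drop j' w \<and> end_arg w j' \<and>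
      list_all2 (\<lambda>v u. corr m (kap w X v) (kap w Y u)) vs us"
proof (induction t arbitrary: k l)
  case 0
  then show ?case by (intro exI[of _ "[]"]) auto
next
  case (Suc t)
  then obtain v k' v' l' where *: "var_at w v k k'" "var_at w v' l l'" "corr m (dig w k X) (dig w l Y)"
    "argrel w t m X k' Y l'" by auto
  have "k' \<le> length w" "l' \<le> length w" using var_at_bound * by blast+
  from Suc.IH[OF this *(4)] obtain vs us j j' where
    "drop k' w = concat (map encode_var vs) @ drop j w" "end_arg w j"
    "drop l' w = concat (map encode_var us) @ drop j' w" "end_arg w j'"
    "list_all2 (\<lambda>v u. corr m (kap w X v) (kap w Y u)) vs us" by blast
  moreover have "corr m (kap w X v) (kap w Y v')"
    using *(3) kap[OF assms(1) *(1)] kap[OF assms(2) *(2)] by simp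
  moreover have "drop k w = encode_var v @ drop k' w" "drop l w = encode_var v' @ drop l' w"
    using * by (simp_all add: var_at_iff)
  ultimately have "drop k w = concat (map encode_var (v # vs)) @ drop j w \<and> end_arg w j \<and>
      drop l w = concat (map encode_var (v' # us)) @ drop j' w \<and> end_arg w j' \<and>
      list_all2 (\<lambda>v u. corr m (kap w X v) (kap w Y u)) (v # vs) (v' # us)" by simp
  then show ?case by blast
qed

lemma argrel_complete:
  assumes "vcons w X" "vcons w Y" "end_arg w j" "end_arg w j'"
  shows "list_all2 (\<lambda>v u. corr m (kap w X v) (kap w Y u)) vs us \<Longrightarrow> k \<le> length w \<Longrightarrow> l \<le> length w \<Longrightarrow>
    drop k w = concat (map encode_var vs) @ drop j w \<Longrightarrow>
    drop l w = concat (map encode_var us) @ drop j' w \<Longrightarrow> argrel w (length vs) m X k Y l"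
proof (induction arbitrary: k l rule: list_all2_induct)
  case Nil
  then show ?case using end_arg_cong[of k w j] end_arg_cong[of l w j'] assms(3,4) by simp
next
  case (Cons v vs u us)
  obtain k' where k': "var_at w v k k'" "k' \<le> length w" "drop k' w = concat (map encode_var vs) @ drop j w"
    by (rule next_var[OF Cons.prems(1,3) assms(3)])
  obtain l' where l': "var_at w u l l'" "l' \<le> length w" "drop l' w = concat (map encode_var us) @ drop j' w"
    by (rule next_var[OF Cons.prems(2,4) assms(4)])
  have "argrel w (length vs) m X k' Y l'" using Cons.IH[OF k'(2) l'(2) k'(3) l'(3)] .
  moreover have "corr m (dig w k X) (dig w l Y)"
    using Cons.hyps(1) kap[OF assms(1) k'(1)] kap[OF assms(2) l'(1)] by simp
  ultimately show ?case using k'(1) l'(1) var_at_bound[OF k'(1)] var_at_bound[OF l'(1)] by auto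
qed

lemma length_args:
  assumes "k \<le> length w" "drop k w = concat (map encode_var vs) @ u"
  shows "length vs \<le> length w"
proof -
  have "length vs \<le> length (concat (map encode_var vs))"
    by (induction vs) (auto simp: encode_var_def)
  moreover have "length w - k = length (concat (map encode_var vs)) + length u"
    using arg_cong[OF assms(2), of length] by simp
  ultimately show ?thesis by linarith
qed

lemma cohn_iff:
  assumes X: "vcons w X" and Y: "vcons w Y"
  shows "cohn w m X Y \<longleftrightarrow> (\<forall>i a r vs us. atom_at w i r vs \<longrightarrow> atom_at w a r us \<longrightarrow>
    list_all2 (\<lambda>v u. corr m (kap w X v) (kap w Y u)) vs us \<longrightarrow> (dig w i X = 1 \<longleftrightarrow> dig w a Y = 1))"
proof (intro iffI)
  assume coh: "cohn w m X Y"
  show "\<forall>i a r vs us. atom_at w i r vs \<longrightarrow> atom_at w a r us \<longrightarrow>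
    list_all2 (\<lambda>v u. corr m (kap w X v) (kap w Y u)) vs us \<longrightarrow> (dig w i X = 1 \<longleftrightarrow> dig w a Y = 1)"
  proof (intro allI impI)
    fix i a r vs us
    assume at: "atom_at w i r vs" "atom_at w a r us"
      and l: "list_all2 (\<lambda>v u. corr m (kap w X v) (kap w Y u)) vs us"
    obtain k j where k: "letter_at w LRel i" "nat_at w r (Suc i) k" "k \<le> length w"
      "drop k w = concat (map encode_var vs) @ drop j w" "end_arg w j"
      using at(1) unfolding atom_at_iff by blast
    obtain k' j' where k': "letter_at w LRel a" "nat_at w r (Suc a) k'" "k' \<le> length w"
      "drop k' w = concat (map encode_var us) @ drop j' w" "end_arg w j'"
      using at(2) unfolding atom_at_iff by blast
    have ar: "argrel w (length vs) m X k Y k'"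
      by (rule argrel_complete[OF X Y k(5) k'(5) l k(3) k'(3) k(4) k'(4)])
    have "i < length w" "a < length w" using k(1) k'(1) by (auto simp: letter_at_def)
    then have "i \<le> size_bound w" "a \<le> size_bound w" "r \<le> size_bound w" "k \<le> size_bound w" "k' \<le> size_bound w"
      "length vs \<le> size_bound w"
      using length_le_bound(1)[of w] nat_at_bound[OF _ k(2)] k(3) k'(3) length_args[OF k(3,4)] by linarith+
    then show "dig w i X = 1 \<longleftrightarrow> dig w a Y = 1"
      using coh k(1,2) k'(1,2) ar unfolding cohn_def by blast
  qed
next
  assume *: "\<forall>i a r vs us. atom_at w i r vs \<longrightarrow> atom_at w a r us \<longrightarrow>
    list_all2 (\<lambda>v u. corr m (kap w X v) (kap w Y u)) vs us \<longrightarrow> (dig w i X = 1 \<longleftrightarrow> dig w a Y = 1)"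
  show "cohn w m X Y"
    unfolding cohn_def
  proof (intro allI impI)
    fix i a r k l t
    assume at: "letter_at w LRel i" "letter_at w LRel a" "nat_at w r (Suc i) k" "nat_at w r (Suc a) l"
      "argrel w t m X k Y l"
    have "k \<le> length w" "l \<le> length w" using at by (auto simp: letter_at_def nat_at_iff)
    moreover from argrel_sound[OF X Y this at(5)] obtain vs us j j' where
      "drop k w = concat (map encode_var vs) @ drop j w" "end_arg w j"
      "drop l w = concat (map encode_var us) @ drop j' w" "end_arg w j'"
      "list_all2 (\<lambda>v u. corr m (kap w X v) (kap w Y u)) vs us" by blast
    ultimately have "atom_at w i r vs" "atom_at w a r us" "list_all2 (\<lambda>v u. corr m (kap w X v) (kap w Y u)) vs us"
      using at(1-4) unfolding atom_at_iff by blast+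
    then show "dig w i X = 1 \<longleftrightarrow> dig w a Y = 1" using * by blast
  qed
qed

text \<open>Two occurrences of an atom have the same arguments, and each argument corresponds to
  itself, so coherence of \<open>X\<close> with itself equates their digits.\<close>

lemma tau_okI:
  assumes "vcons w X" "cohn w 0 X X"
  shows "tau_ok w X"
  unfolding tau_ok_def
proof (intro allI impI)
  fix i r vs assume at: "atom_at w i r vs"
  have "atom_at w (SOME i. atom_at w i r vs) r vs" using at by (rule someI)
  moreover have "list_all2 (\<lambda>v u. corr 0 (kap w X v) (kap w X u)) vs vs"
    by (simp add: list_all2_same corr_def)
  ultimately show "dig w i X = 1 \<longleftrightarrow> tau w X r vs"
    using assms(2) at unfolding cohn_iff[OF assms(1,1)] tau_def by blast
qed

lemma coh_iff:
  assumes "vcons w X" "vcons w Y" "tau_ok w X" "tau_ok w Y"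
  shows "coh (ats w) m (kap w X) (tau w X) (kap w Y) (tau w Y) \<longleftrightarrow> cohn w m X Y"
  using assms(3,4) unfolding cohn_iff[OF assms(1,2)] coh_def ats_def tau_ok_def by blast

lemma tr_sound:
  assumes X: "vcons w X" "tau_ok w X"
  shows "tr w t X i j b \<Longrightarrow> \<exists>p. qfree p \<and> drop i w = encode p @ drop j w \<and> end_arg w j \<and>
    (\<forall>v\<in>fv p. in_scope w v) \<and> (0 < b \<longleftrightarrow> qev (kap w X) (tau w X) p)"
proof (induction t arbitrary: i j b)
  case 0
  then show ?case by simp
next
  case (Suc t)
  from Suc.prems consider
    (Eq) v k v' where "letter_at w LEq i" "var_at w v (Suc i) k" "in_scope w v" "var_at w v' k j"
      "in_scope w v'" "end_arg w j" "0 < b \<longleftrightarrow> dig w (Suc i) X = dig w k X"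
  | (Rel) r k t' where "letter_at w LRel i" "nat_at w r (Suc i) k" "vseq w t' k j" "0 < b \<longleftrightarrow> dig w i X = 1"
  | (Neg) b' where "letter_at w LNeg i" "tr w t X (Suc i) j b'" "b = 0 \<longleftrightarrow> 0 < b'"
  | (binary) k b1 b2 where "tr w t X (Suc i) k b1" "tr w t X k j b2"
      "letter_at w LConj i \<and> (0 < b \<longleftrightarrow> 0 < b1 \<and> 0 < b2) \<or>
       letter_at w LDisj i \<and> (0 < b \<longleftrightarrow> 0 < b1 \<or> 0 < b2) \<or>
       letter_at w LImp i \<and> (0 < b \<longleftrightarrow> (0 < b1 \<longrightarrow> 0 < b2)) \<or>
       letter_at w LIff i \<and> (0 < b \<longleftrightarrow> (0 < b1 \<longleftrightarrow> 0 < b2))"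
    unfolding tr.simps by blast
  then show ?case
  proof cases
    case Eq
    have "drop i w = encode (fm.Eq v v') @ drop j w"
      using Eq(1,2,4) by (simp add: letter_at_iff var_at_iff)
    moreover have "0 < b \<longleftrightarrow> kap w X v = kap w X v'"
      using Eq(7) kap[OF X(1) Eq(2)] kap[OF X(1) Eq(4)] by simp
    ultimately show ?thesis using Eq by (intro exI[of _ "fm.Eq v v'"]) simp
  next
    case Rel
    then have k: "Suc i \<le> length w" "k \<le> length w" by (auto simp: letter_at_def nat_at_iff)
    from vseq_sound[OF k(2) Rel(3)] obtain vs where vs: "end_arg w j"
      "drop k w = concat (map encode_var vs) @ drop j w" "\<forall>v\<in>set vs. in_scope w v" by blast
    have "drop (Suc i) w = encode_nat r @ drop k w" using Rel(2) k by (simp add: nat_at_iff)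
    moreover have "drop i w = LRel # drop (Suc i) w" using Rel(1) by (simp add: letter_at_iff)
    ultimately have d: "drop i w = encode (fm.Rel r vs) @ drop j w" by (simp add: vs(2))
    then have "atom_at w i r vs" using vs(1) by (auto simp: atom_at_def simp del: encode.simps)
    then have "dig w i X = 1 \<longleftrightarrow> tau w X r vs" using X(2) by (simp add: tau_ok_def)
    then show ?thesis using d vs Rel(4) by (intro exI[of _ "fm.Rel r vs"]) simp
  next
    case Neg
    from Suc.IH[OF Neg(2)] obtain p where "qfree p" "drop (Suc i) w = encode p @ drop j w" "end_arg w j"
      "\<forall>v\<in>fv p. in_scope w v" "0 < b' \<longleftrightarrow> qev (kap w X) (tau w X) p" by blast
    moreover have "drop i w = LNeg # drop (Suc i) w" using Neg(1) by (simp add: letter_at_iff)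
    ultimately show ?thesis using Neg(3) by (intro exI[of _ "fm.Neg p"]) auto
  next
    case binary
    from Suc.IH[OF binary(1)] obtain p where p: "qfree p" "drop (Suc i) w = encode p @ drop k w"
      "\<forall>v\<in>fv p. in_scope w v" "0 < b1 \<longleftrightarrow> qev (kap w X) (tau w X) p" by blast
    from Suc.IH[OF binary(2)] obtain q where q: "qfree q" "drop k w = encode q @ drop j w" "end_arg w j"
      "\<forall>v\<in>fv q. in_scope w v" "0 < b2 \<longleftrightarrow> qev (kap w X) (tau w X) q" by blast
    have d: "drop (Suc i) w = encode p @ encode q @ drop j w" using p(2) q(2) by simp
    have i: "letter_at w a i \<Longrightarrow> drop i w = a # encode p @ encode q @ drop j w" for a
      using d by (simp add: letter_at_iff)
    from binary(3) show ?thesis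
    proof (elim disjE conjE)
      assume "letter_at w LConj i" "0 < b \<longleftrightarrow> 0 < b1 \<and> 0 < b2"
      then show ?thesis using i p q by (intro exI[of _ "Conj p q"]) auto
    next
      assume "letter_at w LDisj i" "0 < b \<longleftrightarrow> 0 < b1 \<or> 0 < b2"
      then show ?thesis using i p q by (intro exI[of _ "Disj p q"]) auto
    next
      assume "letter_at w LImp i" "0 < b \<longleftrightarrow> (0 < b1 \<longrightarrow> 0 < b2)"
      then show ?thesis using i p q by (intro exI[of _ "Imp p q"]) auto
    next
      assume "letter_at w LIff i" "0 < b \<longleftrightarrow> (0 < b1 \<longleftrightarrow> 0 < b2)"
      then show ?thesis using i p q by (intro exI[of _ "Iff p q"]) auto
    qed
  qed
qed

lemma tr_binaryI:
  assumes "tr w t X (Suc i) k (of_bool P)" "tr w t X k j (of_bool Q)" "end_arg w k"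
    and "letter_at w LConj i \<and> (0 < b \<longleftrightarrow> P \<and> Q) \<or> letter_at w LDisj i \<and> (0 < b \<longleftrightarrow> P \<or> Q) \<or>
       letter_at w LImp i \<and> (0 < b \<longleftrightarrow> (P \<longrightarrow> Q)) \<or> letter_at w LIff i \<and> (0 < b \<longleftrightarrow> (P \<longleftrightarrow> Q))"
  shows "tr w (Suc t) X i j b"
proof -
  have k: "k \<le> size_bound w" using assms(3) length_le_bound(1)[of w] unfolding end_arg_iff by linarith
  have b: "of_bool P \<le> size_bound w" for P using length_le_bound(4)[of w] by (cases P) auto
  show ?thesis
    unfolding tr.simps
    by (rule disjI2, rule disjI2, rule disjI2, rule exI[of _ k], rule conjI, rule k,
        rule exI[of _ "of_bool P"], rule conjI, rule b, rule conjI, rule assms(1),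
        rule exI[of _ "of_bool Q"], rule conjI, rule b, rule conjI, rule assms(2),
        unfold zero_less_of_bool_iff, rule assms(4))
qed

text \<open>The length of the encoding is enough fuel, since every level of the recursion consumes
  at least one letter.\<close>

lemma tr_complete:
  assumes X: "vcons w X" "tau_ok w X"
  shows "qfree p \<Longrightarrow> drop i w = encode p @ drop j w \<Longrightarrow> end_arg w j \<Longrightarrow> \<forall>v\<in>fv p. in_scope w v \<Longrightarrow>
    length (encode p) \<le> t \<Longrightarrow> (0 < b \<longleftrightarrow> qev (kap w X) (tau w X) p) \<Longrightarrow> tr w t X i j b"
proof (induction p arbitrary: i j t b)
  case (Eq x y)
  then obtain t' where t: "t = Suc t'" by (cases t) auto
  have d: "drop i w = LEq # encode_var x @ encode_var y @ drop j w" using Eq.prems(2) by simp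
  have *: "drop (Suc i) w = concat (map encode_var [x, y]) @ drop j w" "Suc i \<le> length w" "letter_at w LEq i"
    using letter_at_if_drop[OF d] by auto
  obtain k where k: "var_at w x (Suc i) k" "k \<le> length w" "drop k w = concat (map encode_var [y]) @ drop j w"
    by (rule next_var[OF *(2,1) Eq.prems(3)])
  obtain l where l: "var_at w y k l" "l \<le> length w" "drop l w = concat (map encode_var []) @ drop j w"
    by (rule next_var[OF k(2,3) Eq.prems(3)])
  have "l = j" using l(2,3) Eq.prems(3) by (simp add: end_arg_iff drop_eq_drop)
  moreover have "0 < b \<longleftrightarrow> dig w (Suc i) X = dig w k X"
    using Eq.prems(6) kap[OF X(1) k(1)] kap[OF X(1) l(1)] by simp
  ultimately show ?case
    unfolding t tr.simps
    using *(3) k(1) l(1) var_at_bound(1-3)[OF k(1)] var_at_bound(1)[OF l(1)] Eq.prems(3,4) by auto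
next
  case (Rel r vs)
  then obtain t' where t: "t = Suc t'" by (cases t) auto
  have at: "atom_at w i r vs" using Rel.prems(2,3) by (auto simp: atom_at_def)
  then obtain k j' where k: "letter_at w LRel i" "nat_at w r (Suc i) k" "k \<le> length w"
    unfolding atom_at_iff by blast
  have i: "Suc i \<le> length w" using k(1) by (simp add: letter_at_def)
  have "drop i w = LRel # encode_nat r @ concat (map encode_var vs) @ drop j w" using Rel.prems(2) by simp
  from letter_at_if_drop[OF this]
  have "drop (Suc i) w = encode_nat r @ concat (map encode_var vs) @ drop j w" by simp
  moreover have "drop (Suc i) w = encode_nat r @ drop k w" using k(2) i by (simp add: nat_at_iff)
  ultimately have dk: "drop k w = concat (map encode_var vs) @ drop j w" by simp
  have "vseq w (length vs) k j"
    using vseq_complete[OF k(3) dk Rel.prems(3)] Rel.prems(4) by simp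
  moreover have "length vs \<le> size_bound w"
    using length_args[OF k(3) dk] length_le_bound(1)[of w] by linarith
  moreover have "0 < b \<longleftrightarrow> dig w i X = 1" using X(2) at Rel.prems(6) by (simp add: tau_ok_def)
  moreover have "r \<le> size_bound w" "k \<le> size_bound w"
    using nat_at_bound[OF i k(2)] k(3) length_le_bound(1)[of w] by linarith+
  ultimately show ?case unfolding t tr.simps using k(1,2) by blast
next
  case (Neg p)
  then obtain t' where t: "t = Suc t'" by (cases t) auto
  have "drop i w = LNeg # encode p @ drop j w" using Neg.prems(2) by simp
  from letter_at_if_drop[OF this] have *: "letter_at w LNeg i" "drop (Suc i) w = encode p @ drop j w" by auto
  have "tr w t' X (Suc i) j (of_bool (b = 0))"
    using Neg.prems t by (intro Neg.IH *(2)) auto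
  then have "letter_at w LNeg i \<and> (\<exists>b'\<le>size_bound w. tr w t' X (Suc i) j b' \<and> (b = 0 \<longleftrightarrow> 0 < b'))"
    using *(1) by (intro conjI exI[of _ "of_bool (b = 0)"]) auto
  then show ?case unfolding t tr.simps by blast
next
  case (Ex v p)
  then show ?case by simp
next
  case (All v p)
  then show ?case by simp
next
  case (Conj p q)
  then obtain t' where t: "t = Suc t'" by (cases t) auto
  have "drop i w = LConj # encode p @ encode q @ drop j w" using Conj.prems(2) by simp
  from split_binary[OF this] obtain k where k: "drop (Suc i) w = encode p @ drop k w"
    "drop k w = encode q @ drop j w" "end_arg w k" "letter_at w LConj i" by blast
  have 1: "tr w t' X (Suc i) k (of_bool (qev (kap w X) (tau w X) p))"
    using Conj.prems t by (intro Conj.IH(1) k) auto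
  have 2: "tr w t' X k j (of_bool (qev (kap w X) (tau w X) q))"
    using Conj.prems t by (intro Conj.IH(2) k) auto
  show ?case
    unfolding t
    by (rule tr_binaryI[OF 1 2 k(3)]) (use k(4) Conj.prems(6)[unfolded qev.simps] in blast)
next
  case (Disj p q)
  then obtain t' where t: "t = Suc t'" by (cases t) auto
  have "drop i w = LDisj # encode p @ encode q @ drop j w" using Disj.prems(2) by simp
  from split_binary[OF this] obtain k where k: "drop (Suc i) w = encode p @ drop k w"
    "drop k w = encode q @ drop j w" "end_arg w k" "letter_at w LDisj i" by blast
  have 1: "tr w t' X (Suc i) k (of_bool (qev (kap w X) (tau w X) p))"
    using Disj.prems t by (intro Disj.IH(1) k) auto
  have 2: "tr w t' X k j (of_bool (qev (kap w X) (tau w X) q))"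
    using Disj.prems t by (intro Disj.IH(2) k) auto
  show ?case
    unfolding t
    by (rule tr_binaryI[OF 1 2 k(3)]) (use k(4) Disj.prems(6)[unfolded qev.simps] in blast)
next
  case (Imp p q)
  then obtain t' where t: "t = Suc t'" by (cases t) auto
  have "drop i w = LImp # encode p @ encode q @ drop j w" using Imp.prems(2) by simp
  from split_binary[OF this] obtain k where k: "drop (Suc i) w = encode p @ drop k w"
    "drop k w = encode q @ drop j w" "end_arg w k" "letter_at w LImp i" by blast
  have 1: "tr w t' X (Suc i) k (of_bool (qev (kap w X) (tau w X) p))"
    using Imp.prems t by (intro Imp.IH(1) k) auto
  have 2: "tr w t' X k j (of_bool (qev (kap w X) (tau w X) q))"
    using Imp.prems t by (intro Imp.IH(2) k) auto
  show ?case
    unfolding t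
    by (rule tr_binaryI[OF 1 2 k(3)]) (use k(4) Imp.prems(6)[unfolded qev.simps] in blast)
next
  case (Iff p q)
  then obtain t' where t: "t = Suc t'" by (cases t) auto
  have "drop i w = LIff # encode p @ encode q @ drop j w" using Iff.prems(2) by simp
  from split_binary[OF this] obtain k where k: "drop (Suc i) w = encode p @ drop k w"
    "drop k w = encode q @ drop j w" "end_arg w k" "letter_at w LIff i" by blast
  have 1: "tr w t' X (Suc i) k (of_bool (qev (kap w X) (tau w X) p))"
    using Iff.prems t by (intro Iff.IH(1) k) auto
  have 2: "tr w t' X k j (of_bool (qev (kap w X) (tau w X) q))"
    using Iff.prems t by (intro Iff.IH(2) k) auto
  show ?case
    unfolding t
    by (rule tr_binaryI[OF 1 2 k(3)]) (use k(4) Iff.prems(6)[unfolded qev.simps] in blast)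
qed

section \<open>Reading the prefix and its binders\<close>

abbreviation "encode_exs ys \<equiv> concat (map (\<lambda>y. LEx # encode_var y) ys)"

lemma encode_foldr_Ex: "encode (foldr Ex ys q) = encode_exs ys @ encode q"
  by (induction ys) auto

lemma pre_sound:
  "i \<le> length w \<Longrightarrow> pre w t i s \<Longrightarrow> s \<le> length w \<and> (\<exists>ys. drop i w = encode_exs ys @ drop s w)"
proof (induction t arbitrary: i)
  case 0
  then show ?case by (auto intro: exI[of _ "[]"])
next
  case (Suc t)
  then obtain v k where *: "letter_at w LEx i" "var_at w v (Suc i) k" "pre w t k s" by auto
  then obtain ys where "s \<le> length w" "drop k w = encode_exs ys @ drop s w"
    using Suc.IH[of k] by (auto simp: var_at_iff)
  moreover have "drop i w = LEx # encode_var v @ drop k w"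
    using * by (simp add: letter_at_iff var_at_iff)
  ultimately have "s \<le> length w \<and> drop i w = encode_exs (v # ys) @ drop s w" by simp
  then show ?case by blast
qed

lemma no_bit_exs: "no_bit u \<Longrightarrow> no_bit (encode_exs ys @ u)"
  by (cases ys) (auto simp: no_bit_def)

lemma pre_complete:
  "i \<le> length w \<Longrightarrow> drop i w = encode_exs ys @ drop s w \<Longrightarrow> s \<le> length w \<Longrightarrow> no_bit (drop s w) \<Longrightarrow>
    pre w (length ys) i s"
proof (induction ys arbitrary: i)
  case Nil
  then show ?case by (simp add: drop_eq_drop)
next
  case (Cons y ys)
  then have "drop i w = LEx # encode_var y @ encode_exs ys @ drop s w" by simp
  from letter_at_if_drop[OF this] have *: "letter_at w LEx i" "Suc i \<le> length w"
    "drop (Suc i) w = encode_var y @ encode_exs ys @ drop s w" by auto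
  let ?k = "Suc i + length (encode_var y)"
  have k: "drop ?k w = encode_exs ys @ drop s w" "?k \<le> length w"
    using drop_append_shift[OF *(3,2)] by auto
  have v: "var_at w y (Suc i) ?k"
    using *(3) k Cons.prems(4) no_bit_exs[of "drop s w" ys] by (simp add: var_at_iff)
  have "pre w (length ys) ?k s" using k Cons.prems by (intro Cons.IH) auto
  then have "letter_at w LEx i \<and> (\<exists>v\<le>size_bound w. \<exists>k\<le>size_bound w. var_at w v (Suc i) k \<and> pre w (length ys) k s)"
    using *(1) v var_at_bound(1,3)[OF v] by blast
  then show ?case by simp
qed

lemma parse:
  assumes X: "vcons w X" "tau_ok w X" and "head w z x e" "pre w t e s" "tr w t' X s (length w) 1"
  obtains ys q where "w = encode (Ex z (All x (foldr Ex ys q)))" "qfree q" "\<forall>v\<in>fv q. in_scope w v"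
    "qev (kap w X) (tau w X) q" "atoms q \<subseteq> ats w" "fv q \<subseteq> vars w"
proof -
  obtain b where b: "letter_at w LEx 0" "var_at w z 1 b" "letter_at w LAll b" "var_at w x (Suc b) e"
    using assms(3) by (auto simp: head_def)
  have "e \<le> length w" using var_at_bound[OF b(4)] by simp
  from pre_sound[OF this assms(4)] obtain ys where ys: "s \<le> length w" "drop e w = encode_exs ys @ drop s w" by blast
  from tr_sound[OF X assms(5)] obtain q where q: "qfree q" "drop s w = encode q @ drop (length w) w"
    "end_arg w (length w)" "\<forall>v\<in>fv q. in_scope w v" "qev (kap w X) (tau w X) q" by auto
  have "w = LEx # drop 1 w" using b(1) by (simp add: letter_at_iff)
  moreover have "drop 1 w = encode_var z @ drop b w" using b(2) by (simp add: var_at_iff)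
  moreover have "drop b w = LAll # drop (Suc b) w" using b(3) by (simp add: letter_at_iff)
  moreover have "drop (Suc b) w = encode_var x @ drop e w" using b(4) by (simp add: var_at_iff)
  moreover have "drop s w = encode q" using q(2) by simp
  ultimately have "w = encode (Ex z (All x (foldr Ex ys q)))"
    using ys(2) by (simp add: encode_foldr_Ex)
  then show thesis using sub_formula[OF q(1-3)] q by (intro that) auto
qed

lemma end_arg_length: "end_arg w (length w)"
  by (simp add: end_arg_iff no_arg_def no_bit_def)

lemma unparse:
  assumes w: "w = encode (Ex z (All x (foldr Ex ys q)))"
  obtains e s where "head w z x e" "pre w (length ys) e s" "e \<le> length w" "s \<le> length w" "drop s w = encode q"
proof -
  let ?r = "encode_exs ys @ encode q"
  have "drop 0 w = LEx # encode_var z @ LAll # encode_var x @ ?r"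
    using w by (simp add: encode_foldr_Ex)
  from letter_at_if_drop[OF this] have 1: "letter_at w LEx 0" "1 \<le> length w"
    "drop 1 w = encode_var z @ LAll # encode_var x @ ?r" by (auto simp: Suc_leI)
  let ?b = "1 + length (encode_var z)"
  have 2: "drop ?b w = LAll # encode_var x @ ?r" "?b \<le> length w" using drop_append_shift[OF 1(3,2)] by auto
  have z: "var_at w z 1 ?b" using 1 2 by (simp add: var_at_iff no_bit_def)
  from letter_at_if_drop[OF 2(1)] have 3: "letter_at w LAll ?b" "Suc ?b \<le> length w"
    "drop (Suc ?b) w = encode_var x @ ?r" by auto
  let ?e = "Suc ?b + length (encode_var x)"
  have 4: "drop ?e w = ?r" "?e \<le> length w" using drop_append_shift[OF 3(3,2)] by auto
  have nb: "no_bit (encode q)" using no_bit_encode[of q "[]"] by simp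
  then have x: "var_at w x (Suc ?b) ?e" using 3 4 no_bit_exs[OF nb] by (simp add: var_at_iff)
  let ?s = "?e + length (encode_exs ys)"
  have 5: "drop ?s w = encode q" "?s \<le> length w" using drop_append_shift[OF 4] by auto
  have "head w z x ?e" using 1 z 3 x var_at_bound(3)[OF z] by (auto simp: head_def)
  moreover have "pre w (length ys) ?e ?s"
    using 4 5 nb by (intro pre_complete) auto
  ultimately show thesis using that 4 5 by blast
qed

text \<open>Neither variables nor the rest \<open>u\<close> contain quantifier letters, so each such
  letter opens one of the binders in \<open>bs\<close>. Whether it is the first one is recorded to
  separate \<open>z\<close> from the inner block.\<close>

lemma binder_sound:
  assumes u: "LEx \<notin> set u" "LAll \<notin> set u" and a: "a = LEx \<or> a = LAll"
  shows "drop i (concat (map (\<lambda>(a, v). a # encode_var v) bs) @ u) = a # Q \<Longrightarrow>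
    \<exists>n<length bs. \<exists>v. bs ! n = (a, v) \<and> (i = 0 \<longleftrightarrow> n = 0) \<and>
      Q = encode_var v @ concat (map (\<lambda>(a, v). a # encode_var v) (drop (Suc n) bs)) @ u"
proof (induction bs arbitrary: i)
  case Nil
  then have "a \<in> set u" using in_set_dropD[of a i u] by simp
  then show ?case using u a by auto
next
  case (Cons b bs)
  obtain c v where b: "b = (c, v)" by fastforce
  let ?rest = "concat (map (\<lambda>(a, v). a # encode_var v) bs) @ u"
  show ?case
  proof (cases i)
    case 0
    then show ?thesis using Cons.prems b by (intro exI[of _ 0]) auto
  next
    case (Suc i')
    then have d: "drop i' (encode_var v @ ?rest) = a # Q" using Cons.prems b by simp
    show ?thesis
    proof (cases "i' < length (encode_var v)")
      case True
      then obtain c cs where c: "drop i' (encode_var v) = c # cs" by (metis Cons_nth_drop_Suc)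
      then have "c = a" using d True by simp
      then have "a \<in> set (encode_var v)" using c in_set_dropD[of a i' "encode_var v"] by simp
      then show ?thesis using a by (auto simp: encode_var_def encode_nat_def)
    next
      case False
      then have "drop (i' - length (encode_var v)) ?rest = a # Q" using d by simp
      from Cons.IH[OF this] obtain n v' where "n < length bs" "bs ! n = (a, v')"
        "Q = encode_var v' @ concat (map (\<lambda>(a, v). a # encode_var v) (drop (Suc n) bs)) @ u" by blast
      then show ?thesis using Suc by (intro exI[of _ "Suc n"]) auto
    qed
  qed
qed

lemma binder_complete:
  assumes "n < length bs" "bs ! n = (a, v)"
  shows "\<exists>i. drop i (concat (map (\<lambda>(a, v). a # encode_var v) bs) @ u) =
    a # encode_var v @ concat (map (\<lambda>(a, v). a # encode_var v) (drop (Suc n) bs)) @ u \<and> (i = 0 \<longleftrightarrow> n = 0)"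
proof -
  let ?f = "\<lambda>(a, v). a # encode_var v"
  have "bs = take n bs @ (a, v) # drop (Suc n) bs" using id_take_nth_drop[OF assms(1)] assms(2) by simp
  from arg_cong[OF this, of "\<lambda>bs. concat (map ?f bs)"]
  have "concat (map ?f bs) = concat (map ?f (take n bs)) @ a # encode_var v @ concat (map ?f (drop (Suc n) bs))"
    by simp
  moreover have "length (concat (map ?f (take n bs))) = 0 \<longleftrightarrow> n = 0"
    using assms(1) by (cases bs; cases n) (auto simp: case_prod_beta)
  ultimately show ?thesis by (intro exI[of _ "length (concat (map ?f (take n bs)))"]) simp
qed

lemma binders:
  assumes w: "w = encode (Ex z (All x (foldr Ex ys q)))" and q: "qfree q"
  shows "in_scope w v \<longleftrightarrow> v \<in> {z, x} \<union> set ys" and "ybound w v \<longleftrightarrow> v \<in> set ys"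
proof -
  define bs where "bs = (LEx, z) # (LAll, x) # map (Pair LEx) ys"
  let ?f = "\<lambda>(a, v). a # encode_var v"
  have eq: "w = concat (map ?f bs) @ encode q"
    unfolding w bs_def by (simp add: encode_foldr_Ex comp_def)
  have u: "LEx \<notin> set (encode q) \<and> LAll \<notin> set (encode q)"
    using q by (induction q) (auto simp: encode_var_def encode_nat_def)
  have nb: "no_bit (concat (map ?f (drop n bs)) @ encode q)" for n
  proof -
    have "set (drop n bs) \<subseteq> set bs" by (rule set_drop_subset)
    then have "\<forall>b\<in>set (drop n bs). fst b = LEx \<or> fst b = LAll" by (auto simp: bs_def)
    then show ?thesis using no_bit_encode[of q "[]"]
      by (cases "drop n bs") (auto simp: no_bit_def case_prod_beta)
  qed
  have sound: "\<exists>n<length bs. bs ! n = (a, v) \<and> (i = 0 \<longleftrightarrow> n = 0)"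
    if a: "a = LEx \<or> a = LAll" and at: "letter_at w a i" "var_at w v (Suc i) k" for a v i k
  proof -
    have "drop i w = a # drop (Suc i) w" using at(1) by (simp add: letter_at_iff)
    then obtain n v' where n: "n < length bs" "bs ! n = (a, v')" "i = 0 \<longleftrightarrow> n = 0"
      "drop (Suc i) w = encode_var v' @ concat (map ?f (drop (Suc n) bs)) @ encode q"
      using binder_sound[of "encode q" a i bs] u a unfolding eq by blast
    have "encode_var v @ drop k w = encode_var v' @ concat (map ?f (drop (Suc n) bs)) @ encode q"
      using at(2) n(4) by (metis var_at_iff)
    from encode_var_append_inject[OF this _ nb] have "v = v'" using at(2) by (simp add: var_at_iff)
    then show ?thesis using n by blast
  qed
  have complete: "\<exists>i k. letter_at w a i \<and> var_at w v (Suc i) k \<and> (i = 0 \<longleftrightarrow> n = 0)"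
    if n: "n < length bs" "bs ! n = (a, v)" for a v n
  proof -
    obtain i where i: "drop i w = a # encode_var v @ concat (map ?f (drop (Suc n) bs)) @ encode q" "i = 0 \<longleftrightarrow> n = 0"
      using binder_complete[OF n, of "encode q"] unfolding eq by blast
    from letter_at_if_drop[OF i(1)] have *: "letter_at w a i" "Suc i \<le> length w"
      "drop (Suc i) w = encode_var v @ concat (map ?f (drop (Suc n) bs)) @ encode q" by auto
    have "var_at w v (Suc i) (Suc i + length (encode_var v))"
      using drop_append_shift[OF *(3,2)] nb * by (simp add: var_at_iff)
    then show ?thesis using * i by blast
  qed
  have bs_nth: "(\<exists>n<length bs. bs ! n = (a, v)) \<longleftrightarrow> (a, v) \<in> set bs" for a v
    by (auto simp: in_set_conv_nth)
  have "in_scope w v \<longleftrightarrow> (\<exists>a. (a = LEx \<or> a = LAll) \<and> (\<exists>n<length bs. bs ! n = (a, v)))"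
  proof
    assume "in_scope w v"
    then obtain i k a where a: "a = LEx \<or> a = LAll" and i: "letter_at w a i" "var_at w v (Suc i) k"
      unfolding in_scope_iff by blast
    from sound[OF a i] a show "\<exists>a. (a = LEx \<or> a = LAll) \<and> (\<exists>n<length bs. bs ! n = (a, v))" by auto
  next
    assume "\<exists>a. (a = LEx \<or> a = LAll) \<and> (\<exists>n<length bs. bs ! n = (a, v))"
    then obtain a n where a: "a = LEx \<or> a = LAll" and n: "n < length bs" "bs ! n = (a, v)" by blast
    from complete[OF n] a show "in_scope w v" unfolding in_scope_iff by auto
  qed
  then show "in_scope w v \<longleftrightarrow> v \<in> {z, x} \<union> set ys" unfolding bs_nth by (auto simp: bs_def)
  have "ybound w v \<longleftrightarrow> (\<exists>n<length bs. 0 < n \<and> bs ! n = (LEx, v))"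
    unfolding ybound_iff
  proof
    assume "\<exists>i k. 0 < i \<and> letter_at w LEx i \<and> var_at w v (Suc i) k"
    then obtain i k where i: "0 < i" "letter_at w LEx i" "var_at w v (Suc i) k" by blast
    from sound[OF disjI1[OF refl] i(2,3)] i(1) show "\<exists>n<length bs. 0 < n \<and> bs ! n = (LEx, v)" by auto
  next
    assume "\<exists>n<length bs. 0 < n \<and> bs ! n = (LEx, v)"
    then obtain n where n: "n < length bs" "0 < n" "bs ! n = (LEx, v)" by blast
    from complete[OF n(1,3)] n(2) show "\<exists>i k. 0 < i \<and> letter_at w LEx i \<and> var_at w v (Suc i) k" by auto
  qed
  also have "\<dots> \<longleftrightarrow> (\<exists>n<length ys. ys ! n = v)"
  proof
    assume "\<exists>n<length bs. 0 < n \<and> bs ! n = (LEx, v)"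
    then obtain n where n: "n < length bs" "0 < n" "bs ! n = (LEx, v)" by blast
    then obtain n' where "n = Suc (Suc n')" by (cases n; cases "n - 1") (auto simp: bs_def)
    then show "\<exists>n<length ys. ys ! n = v" using n by (auto simp: bs_def)
  next
    assume "\<exists>n<length ys. ys ! n = v"
    then obtain n where "n < length ys" "ys ! n = v" by blast
    then show "\<exists>n<length bs. 0 < n \<and> bs ! n = (LEx, v)"
      by (intro exI[of _ "Suc (Suc n)"]) (auto simp: bs_def)
  qed
  also have "\<dots> \<longleftrightarrow> v \<in> set ys" by (auto simp: in_set_conv_nth)
  finally show "ybound w v \<longleftrightarrow> v \<in> set ys" .
qed

subsection \<open>Coding configurations\<close>

definition code :: "letter list \<Rightarrow> (nat \<Rightarrow> nat) \<Rightarrow> nat" where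
  "code w f = (\<Sum>i<length w. f i * (length w + 1) ^ i)"

lemma digits_less:
  fixes B :: nat
  assumes "\<And>i. i < m \<Longrightarrow> f i < B"
  shows "(\<Sum>i<m. f i * B ^ i) < B ^ m"
  using assms
proof (induction m)
  case (Suc m)
  have "(\<Sum>i<Suc m. f i * B ^ i) < B ^ m + f m * B ^ m" using Suc by simp
  also have "\<dots> = Suc (f m) * B ^ m" by simp
  also have "\<dots> \<le> B * B ^ m" using Suc.prems[of m] by (intro mult_right_mono) auto
  finally show ?case by simp
qed simp

lemma digits_nth:
  fixes B :: nat
  assumes f: "\<And>i. i < m \<Longrightarrow> f i < B" and i: "i < m"
  shows "(\<Sum>i<m. f i * B ^ i) div B ^ i mod B = f i"
proof -
  \<comment> \<open>The numeral splits into the part below digit \<open>i\<close>, the digit itself,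
    and a multiple of the next power; division and remainder then isolate the digit.\<close>
  have "\<exists>r. (\<Sum>j<Suc i + d. f j * B ^ j) = (\<Sum>j<i. f j * B ^ j) + B ^ i * (f i + B * r)" for d
  proof (induction d)
    case 0
    show ?case by (intro exI[of _ 0]) simp
  next
    case (Suc d)
    then obtain r where "(\<Sum>j<Suc i + d. f j * B ^ j) = (\<Sum>j<i. f j * B ^ j) + B ^ i * (f i + B * r)" by blast
    then show ?case
      by (intro exI[of _ "r + f (Suc i + d) * B ^ d"]) (simp add: algebra_simps power_add)
  qed
  from this[of "m - Suc i"] i obtain r where
    r: "(\<Sum>j<m. f j * B ^ j) = (\<Sum>j<i. f j * B ^ j) + B ^ i * (f i + B * r)" by auto
  have lt: "(\<Sum>j<i. f j * B ^ j) < B ^ i" using f i by (intro digits_less) auto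
  have nz: "B ^ i \<noteq> 0" by (rule gr_implies_not0[OF lt])
  have "(\<Sum>j<m. f j * B ^ j) div B ^ i = f i + B * r"
    unfolding r div_mult_self2[OF nz] using lt by simp
  then show ?thesis using f[OF i] by simp
qed

lemma dig_code: "i < length w \<Longrightarrow> (\<And>i. f i \<le> length w) \<Longrightarrow> dig w i (code w f) = f i"
  unfolding dig_def code_def by (rule digits_nth) (auto simp: less_Suc_eq_le)

lemma code_less: "(\<And>i. f i \<le> length w) \<Longrightarrow> code w f < size_bound w"
proof -
  assume "\<And>i. f i \<le> length w"
  then have "code w f < (length w + 1) ^ length w"
    unfolding code_def by (intro digits_less) (auto simp: less_Suc_eq_le)
  also have "\<dots> \<le> (2 ^ (length w + 1)) ^ length w"
    by (rule power_mono[OF less_imp_le[OF less_exp]]) simp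
  also have "\<dots> = 2 ^ ((length w + 1) * length w)" by (simp only: power_mult)
  also have "\<dots> \<le> size_bound w"
    unfolding size_bound_def power2_eq_square by (intro power_increasing mult_le_mono) auto
  finally show ?thesis .
qed

text \<open>Otherwise each of the first \<open>N\<close> stages would lose an element, and
  \<open>S N\<close> would be empty.\<close>

lemma chain_stable:
  fixes S :: "nat \<Rightarrow> nat set"
  assumes dec: "\<And>t. S (Suc t) \<subseteq> S t" and S0: "S 0 \<subseteq> {..<N}" and ne: "\<And>t. S t \<noteq> {}"
  shows "\<exists>t<N. S t \<subseteq> S (Suc t)"
proof (rule ccontr)
  assume contr: "\<not> (\<exists>t<N. S t \<subseteq> S (Suc t))"
  have sub: "S t \<subseteq> {..<N}" for t by (induction t) (use S0 order_trans[OF dec] in blast)+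
  have "card (S t) + t \<le> N" if "t \<le> N" for t
    using that
  proof (induction t)
    case 0
    then show ?case using card_mono[OF _ S0] by simp
  next
    case (Suc t)
    then have "\<not> S t \<subseteq> S (Suc t)" using contr by auto
    then have "S (Suc t) \<subset> S t" using dec[of t] by blast
    then have "card (S (Suc t)) < card (S t)" using sub[of t] by (meson finite_lessThan finite_subset psubset_card_mono)
    then show ?case using Suc by simp
  qed
  from this[of N] have "card (S N) = 0" by simp
  then show False using sub[of N] ne[of N] by (meson card_eq_0_iff finite_lessThan finite_subset)
qed

lemma coh_mono:
  assumes "coh (ats w) m \<kappa> \<tau> \<kappa>' \<tau>'" and "\<And>v. v \<in> vars w \<Longrightarrow> \<kappa> v = \<kappa>1 v" "\<And>v. v \<in> vars w \<Longrightarrow> \<kappa>' v = \<kappa>1' v"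
    and "\<And>r vs. (r, vs) \<in> ats w \<Longrightarrow> \<tau> r vs = \<tau>1 r vs" "\<And>r vs. (r, vs) \<in> ats w \<Longrightarrow> \<tau>' r vs = \<tau>1' r vs"
  shows "coh (ats w) m \<kappa>1 \<tau>1 \<kappa>1' \<tau>1'"
  unfolding coh_def
proof (intro allI impI)
  fix r vs us
  assume at: "(r, vs) \<in> ats w" "(r, us) \<in> ats w" and l: "list_all2 (\<lambda>v u. corr m (\<kappa>1 v) (\<kappa>1' u)) vs us"
  have "list_all2 (\<lambda>v u. corr m (\<kappa> v) (\<kappa>' u)) vs us"
    using l ats_vars[OF at(1)] ats_vars[OF at(2)] assms(2,3)
    by (auto simp: list_all2_conv_all_nth subset_eq)
  then have "\<tau> r vs = \<tau>' r us" using assms(1) at unfolding coh_def by blast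
  then show "\<tau>1 r vs = \<tau>1' r us" using assms(4,5) at by simp
qed

lemma qev_cong:
  "qfree q \<Longrightarrow> \<forall>v\<in>fv q. \<kappa> v = \<kappa>' v \<Longrightarrow> \<forall>(r, vs)\<in>atoms q. \<tau> r vs = \<tau>' r vs \<Longrightarrow>
    qev \<kappa> \<tau> q = qev \<kappa>' \<tau>' q"
  by (induction q) (simp_all add: ball_Un)

lemma qfree_not_Ex: "qfree q \<Longrightarrow> q \<noteq> Ex y p" by (cases q) simp_all
lemma foldr_Ex_inject:
  "foldr Ex ys q = foldr Ex ys' q' \<Longrightarrow> qfree q \<Longrightarrow> qfree q' \<Longrightarrow> ys = ys' \<and> q = q'"
proof (induction ys arbitrary: ys')
  case Nil
  then show ?case using qfree_not_Ex[of q] by (cases ys') simp_all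
next
  case (Cons y ys)
  then obtain y' ys1 where "ys' = y' # ys1" using qfree_not_Ex[of q' y "foldr Ex ys q"] by (cases ys') simp_all
  then show ?case using Cons.prems Cons.IH[of ys1] by simp
qed

section \<open>Acceptance and satisfiability\<close>

lemma elim_valid: "elim w t G X \<Longrightarrow> validn w G X"
  by (induction t) simp_all

lemma var_dig_kap: "var_dig w v X c \<Longrightarrow> v \<in> vars w \<Longrightarrow> kap w X v = c"
  using var_pos[of v w] var_at_bound(2,3) unfolding var_dig_def kap_def by blast

text \<open>Position 0 of a sentence of the class holds \<open>LEx\<close>, where neither a variable
  nor an atom starts; its digit is therefore free for \<open>K\<close>.\<close>

definition cfg_dig :: "letter list \<Rightarrow> cfg \<Rightarrow> nat \<Rightarrow> nat" where
  "cfg_dig w = (\<lambda>(K, \<kappa>, \<tau>) i. if i = 0 then K else if \<exists>v k. var_at w v i k then \<kappa> (THE v. \<exists>k. var_at w v i k)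
    else of_bool (\<exists>r vs. atom_at w i r vs \<and> \<tau> r vs))"

lemma code_cfg:
  fixes \<tau> :: "nat \<Rightarrow> nat list \<Rightarrow> bool"
  assumes LEx: "letter_at w LEx 0" and K: "K \<le> 1" and \<kappa>: "\<And>v. v \<in> vars w \<Longrightarrow> \<kappa> v \<le> length w"
  defines "X \<equiv> code w (cfg_dig w (K, \<kappa>, \<tau>))"
  shows "X < size_bound w" "dig w 0 X = K" "vcons w X" "tau_ok w X"
    and "v \<in> vars w \<Longrightarrow> kap w X v = \<kappa> v" "(r, vs) \<in> ats w \<Longrightarrow> tau w X r vs = \<tau> r vs"
proof -
  have len: "0 < length w" using LEx by (auto simp: letter_at_def)
  then have K_le: "K \<le> length w" "Suc 0 \<le> length w" using K by linarith+
  have the: "(THE v. \<exists>k. var_at w v i k) = v" if "var_at w v i k" for v i k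
    by (rule the_equality) (use that var_at_unique in blast)+
  have le: "cfg_dig w (K, \<kappa>, \<tau>) i \<le> length w" for i
  proof (cases "\<exists>v k. var_at w v i k")
    case True
    then obtain v k where v: "var_at w v i k" by blast
    then have "v \<in> vars w" by (auto simp: vars_def)
    then show ?thesis using v K_le \<kappa> by (auto simp: cfg_dig_def the[OF v])
  qed (use K_le in \<open>auto simp: cfg_dig_def\<close>)
  note dig = dig_code[of _ w "cfg_dig w (K, \<kappa>, \<tau>)", OF _ le, folded X_def]
  show "X < size_bound w" unfolding X_def by (rule code_less) (rule le)
  show "dig w 0 X = K" using dig[OF len] by (simp add: cfg_dig_def)
  have nz: "i \<noteq> 0" if "letter_at w a i" "a \<noteq> LEx" for a i using that LEx unfolding letter_at_def by metis
  have var: "dig w i X = \<kappa> v" if v: "var_at w v i k" for v i k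
  proof -
    have "i \<noteq> 0" using v nz[of LVar i] by (auto simp: var_at_def)
    then show ?thesis using dig[OF var_at_bound(4)[OF v]] v by (auto simp: cfg_dig_def the[OF v])
  qed
  have atom: "dig w i X = 1 \<longleftrightarrow> \<tau> r vs" if a: "atom_at w i r vs" for i r vs
  proof -
    have l: "letter_at w LRel i" using a by (simp add: atom_at_iff)
    then have "i \<noteq> 0" and no_var: "\<not> (\<exists>v k. var_at w v i k)"
      using nz[of LRel i] by (auto simp: var_at_def letter_at_def)
    then have "cfg_dig w (K, \<kappa>, \<tau>) i = of_bool (\<exists>r vs. atom_at w i r vs \<and> \<tau> r vs)"
      unfolding cfg_dig_def prod.case if_not_P[OF no_var] by simp
    moreover have "i < length w" using l by (simp add: letter_at_def)
    ultimately have "dig w i X = of_bool (\<exists>r vs. atom_at w i r vs \<and> \<tau> r vs)"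
      using dig by simp
    then show ?thesis using a by (auto dest: atom_at_unique[OF a])
  qed
  show "vcons w X" unfolding vcons_def by (metis var)
  have tau: "tau w X r vs = \<tau> r vs" if at: "(r, vs) \<in> ats w" for r vs
  proof -
    obtain i where "atom_at w i r vs" using at unfolding ats_def by blast
    then have "atom_at w (SOME i. atom_at w i r vs) r vs" by (rule someI)
    then show ?thesis unfolding tau_def using atom[of "SOME i. atom_at w i r vs" r vs] by simp
  qed
  show "tau_ok w X"
    unfolding tau_ok_def
  proof (intro allI impI)
    fix i r vs assume a: "atom_at w i r vs"
    then have "(r, vs) \<in> ats w" unfolding ats_def by blast
    then show "dig w i X = 1 \<longleftrightarrow> tau w X r vs" using atom[OF a] tau by simp
  qed
  show "kap w X v = \<kappa> v" if "v \<in> vars w" for v unfolding kap_def using var_pos[OF that] var[of v "var_pos w v"] by blast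
  show "tau w X r vs = \<tau> r vs" if "(r, vs) \<in> ats w" for r vs using that by (rule tau)
qed

text \<open>At a stable stage every surviving number has its matches among the survivors, so these
  decode to a closed set of configurations. \<open>X0\<close> provides the configuration of the
  root.\<close>

lemma acc_sound:
  assumes "acc w"
  shows "\<exists>p\<in>prefix_EAEs. w = encode p \<and> satisfiable TYPE(nat list) p"
proof -
  obtain G t X0 where G: "gok w G" and stable: "\<And>X. X \<le> size_bound w \<Longrightarrow> elim w t G X \<Longrightarrow> elim w (Suc t) G X"
    and X0: "elim w t G X0" "dig w 0 X0 = 0" "X0 \<le> size_bound w"
    using assms unfolding acc_def by blast
  have G0: "dig w i G = 0" if "var_at w v i k" for v i k
    using G that var_at_bound[OF that] unfolding gok_def var_dig_def by blast
  have G_vcons: "vcons w G" unfolding vcons_def using G0 by simp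
  have G_tau: "tau_ok w G" using G by (intro tau_okI G_vcons) (simp add: gok_def)
  have G_kap: "kap w G v = 0" if "v \<in> vars w" for v
    using var_pos[OF that] G0 unfolding kap_def by blast
  have tau: "vcons w X \<and> tau_ok w X" if "validn w G X" for X
    using that tau_okI[of w X] by (simp add: validn_def)
  have parsed: "\<exists>z x ys q. w = encode (Ex z (All x (foldr Ex ys q))) \<and> qfree q \<and> (\<forall>v\<in>fv q. in_scope w v) \<and>
      qev (kap w X) (tau w X) q \<and> atoms q \<subseteq> ats w \<and> fv q \<subseteq> vars w \<and> z \<in> vars w \<and> x \<in> vars w \<and>
      (ybound w x \<or> kap w X x = dig w 0 X) \<and> (ybound w z \<or> z = x \<or> kap w X z = 0)"
    if val: "validn w G X" for X
  proof -
    obtain z x e s t1 t2 where *: "head w z x e" "ybound w x \<or> var_dig w x X (dig w 0 X)"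
      "ybound w z \<or> z = x \<or> var_dig w z X 0" "pre w t1 e s" "tr w t2 X s (length w) 1"
      using val unfolding validn_def by blast
    have V: "z \<in> vars w" "x \<in> vars w" using *(1) by (auto simp: head_def vars_def)
    obtain ys q where "w = encode (Ex z (All x (foldr Ex ys q)))" "qfree q" "\<forall>v\<in>fv q. in_scope w v"
      "qev (kap w X) (tau w X) q" "atoms q \<subseteq> ats w" "fv q \<subseteq> vars w"
      by (rule parse[OF _ _ *(1,4,5)]) (use tau[OF val] in auto)
    moreover have "ybound w x \<or> kap w X x = dig w 0 X" "ybound w z \<or> z = x \<or> kap w X z = 0"
      using *(2,3) var_dig_kap[OF _ V(1)] var_dig_kap[OF _ V(2)] by auto
    ultimately show ?thesis using V by blast
  qed
  obtain z x ys q where w: "w = encode (Ex z (All x (foldr Ex ys q)))" and q: "qfree q" "\<forall>v\<in>fv q. in_scope w v"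
    "atoms q \<subseteq> ats w" "fv q \<subseteq> vars w"
    using parsed[OF elim_valid[OF X0(1)]] by blast
  note binders = binders[OF w q(1)]
  define S where "S = (\<lambda>X. (dig w 0 X, kap w X, tau w X)) ` {X. X \<le> size_bound w \<and> elim w t G X}"
  have fv: "fv q \<subseteq> {z, x} \<union> set ys" using q(2) binders(1) by blast
  have "satisfiable TYPE(nat list) (Ex z (All x (foldr Ex ys q)))"
  proof (rule satisfiable_if_cfgs[OF q(1,3,4) fv, of "tau w G" S "(dig w 0 X0, kap w X0, tau w X0)"])
    have "v \<in> vars w" if "in_scope w v" for v using that unfolding in_scope_iff vars_def by blast
    then show "set ys \<subseteq> vars w" using binders(1) by blast
    show "set vs \<subseteq> vars w" if "(r, vs) \<in> ats w" for r vs using that by (rule ats_vars)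
    have "coh (ats w) 0 (kap w G) (tau w G) (kap w G) (tau w G)"
      using G coh_iff[OF G_vcons G_vcons G_tau G_tau] by (simp add: gok_def)
    then show "coh (ats w) 0 (\<lambda>_. 0) (tau w G) (\<lambda>_. 0) (tau w G)"
      by (rule coh_mono) (simp_all add: G_kap)
    show "valid z x ys q (ats w) (tau w G) C" if C: "C \<in> S" for C
    proof -
      obtain X where X: "C = (dig w 0 X, kap w X, tau w X)" "elim w t G X" using C by (auto simp: S_def)
      note val = elim_valid[OF X(2)]
      have vt: "vcons w X" "tau_ok w X" using tau[OF val] by auto
      obtain z' x' ys' q' where p: "w = encode (Ex z' (All x' (foldr Ex ys' q')))" "qfree q'"
        "qev (kap w X) (tau w X) q'" "ybound w x' \<or> kap w X x' = dig w 0 X" "ybound w z' \<or> z' = x' \<or> kap w X z' = 0"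
        using parsed[OF val] by blast
      \<comment> \<open>Each number was validated against its own reading of the word; injectivity
        of \<open>encode\<close> shows that all these readings coincide.\<close>
      have "Ex z' (All x' (foldr Ex ys' q')) = Ex z (All x (foldr Ex ys q))"
        using p(1) w inj_encode by (metis injD)
      then have eq: "z' = z" "x' = x" "q' = q" using foldr_Ex_inject[of ys' q' ys q] p(2) q(1) by auto
      have "coh (ats w) 0 (kap w X) (tau w X) (kap w X) (tau w X)"
        using coh_iff[OF vt(1,1) vt(2,2)] val by (simp add: validn_def)
      moreover have "coh (ats w) 0 (kap w X) (tau w X) (kap w G) (tau w G)"
        using coh_iff[OF vt(1) G_vcons vt(2) G_tau] val by (simp add: validn_def)
      then have "coh (ats w) 0 (kap w X) (tau w X) (\<lambda>_. 0) (tau w G)"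
        by (rule coh_mono) (simp_all add: G_kap)
      moreover have "dig w 0 X \<le> 1" using val by (auto simp: validn_def)
      ultimately show ?thesis
        using p(3-5) binders(2) unfolding valid_def X(1) eq by auto
    qed
    show "closed_cfgs (vars w) (ats w) S"
      unfolding closed_cfgs_def
    proof
      fix C assume "C \<in> S"
      then obtain X where C: "C = (dig w 0 X, kap w X, tau w X)" and X: "X \<le> size_bound w" "elim w t G X"
        unfolding S_def by blast
      show "case C of (K, \<kappa>, \<tau>) \<Rightarrow> \<forall>m\<in>\<kappa> ` vars w. m \<noteq> 0 \<longrightarrow> m \<noteq> K \<longrightarrow>
        (\<exists>\<kappa>' \<tau>'. (1, \<kappa>', \<tau>') \<in> S \<and> coh (ats w) m \<kappa> \<tau> \<kappa>' \<tau>')"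
        unfolding C prod.case
      proof (intro ballI impI)
        fix m assume m: "m \<in> kap w X ` vars w" "m \<noteq> 0" "m \<noteq> dig w 0 X"
        then obtain v where v: "v \<in> vars w" "m = kap w X v" by blast
        obtain k where k: "var_at w v (var_pos w v) k" using var_pos[OF v(1)] by blast
        have "elim w (Suc t) G X" using stable X by blast
        then obtain Y where Y: "Y \<le> size_bound w" "elim w t G Y" "dig w 0 Y = 1" "cohn w m X Y"
          using k var_at_bound(1-3)[OF k] m(2,3) unfolding v(2) kap_def elim.simps by blast
        have "coh (ats w) m (kap w X) (tau w X) (kap w Y) (tau w Y)"
          using coh_iff tau[OF elim_valid[OF X(2)]] tau[OF elim_valid[OF Y(2)]] Y(4) by blast
        moreover have "(1, kap w Y, tau w Y) \<in> S"
          unfolding S_def using Y(1,2) by (intro image_eqI[of _ _ Y]) (simp_all add: Y(3))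
        ultimately show "\<exists>\<kappa>' \<tau>'. (1, \<kappa>', \<tau>') \<in> S \<and> coh (ats w) m (kap w X) (tau w X) \<kappa>' \<tau>'" by blast
      qed
    qed
    show "(dig w 0 X0, kap w X0, tau w X0) \<in> S" unfolding S_def using X0 by blast
  qed (use X0 in simp)
  moreover have "fv (foldr Ex ys q) = fv q - set ys" for ys by (induction ys) auto
  then have "Ex z (All x (foldr Ex ys q)) \<in> prefix_EAEs"
    unfolding prefix_EAEs_def using fv q(1) by auto
  ultimately show ?thesis using w by blast
qed

lemma var_digI:
  assumes "vcons w X" "v \<in> vars w \<Longrightarrow> kap w X v = c"
  shows "var_dig w v X c"
  unfolding var_dig_def
proof (intro allI impI)
  fix i k assume v: "var_at w v i k"
  then have "v \<in> vars w" unfolding vars_def by blast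
  then show "dig w i X = c" using kap[OF assms(1) v] assms(2) by simp
qed

text \<open>The configurations of a model support one another, so none of them is ever eliminated.
  The stages never become empty and must be stable at some point below the bound.\<close>

lemma acc_complete:
  assumes p: "p \<in> prefix_EAEs" and sat: "satisfiable TYPE('u) p" and w: "w = encode p"
  shows "acc w"
proof -
  obtain z x ys q where p_eq: "p = Ex z (All x (foldr Ex ys q))" and q: "qfree q" and closed: "fv p = {}"
    using p unfolding prefix_EAEs_def by blast
  have w_eq: "w = encode (Ex z (All x (foldr Ex ys q)))" using w p_eq by simp
  note binders = binders[OF w_eq q]
  have "fv (foldr Ex ys q) = fv q - set ys" for ys by (induction ys) auto
  then have fv: "fv q \<subseteq> {z, x} \<union> set ys" using closed unfolding p_eq by auto
  obtain e s where es: "head w z x e" "pre w (length ys) e s" "e \<le> length w" "s \<le> length w" "drop s w = encode q"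
    by (rule unparse[OF w_eq])
  have d: "drop s w = encode q @ drop (length w) w" using es(5) by simp
  have sub: "atoms q \<subseteq> ats w" "fv q \<subseteq> vars w" using sub_formula[OF q d end_arg_length] by auto
  have xz: "x \<in> vars w" "z \<in> vars w" using es(1) by (auto simp: head_def vars_def)
  have LEx: "letter_at w LEx 0" using es(1) by (simp add: head_def)
  \<comment> \<open>Position 0 holds \<open>LEx\<close>, so variables occur at positions from 1 on.
    Their successors avoid the reserved codes 0 and 1 and do not exceed \<open>length w\<close>, the
    largest digit.\<close>
  define g where "g = (\<lambda>v. Suc (var_pos w v))"
  have inj: "inj_on g (vars w)"
    using var_pos var_at_unique unfolding inj_on_def g_def by (metis Suc_inject)
  have g: "2 \<le> g v" "g v \<le> length w" if v: "v \<in> vars w" for v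
  proof -
    obtain k where k: "var_at w v (var_pos w v) k" using var_pos[OF v] by blast
    then have "var_pos w v \<noteq> 0" using LEx by (intro notI) (simp add: var_at_def letter_at_def)
    then show "2 \<le> g v" "g v \<le> length w" using var_at_bound(4)[OF k] by (auto simp: g_def)
  qed
  obtain \<gamma> S C0 where \<gamma>: "coh (ats w) 0 (\<lambda>_. 0) \<gamma> (\<lambda>_. 0) \<gamma>"
    and valid: "\<And>C. C \<in> S \<Longrightarrow> valid z x ys q (ats w) \<gamma> C" and closed: "closed_cfgs (vars w) (ats w) S"
    and C0: "C0 \<in> S" "fst C0 = 0" and codes: "\<And>K \<kappa> \<tau> v. (K, \<kappa>, \<tau>) \<in> S \<Longrightarrow> v \<in> vars w \<Longrightarrow> \<kappa> v \<in> {0, 1} \<union> g ` vars w"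
    by (rule cfgs_if_satisfiable[OF q sub fv ats_vars xz inj g(1) sat[unfolded p_eq]]) blast+
  define X where "X C = code w (cfg_dig w C)" for C
  define G where "G = X (0, \<lambda>_. 0, \<gamma>)"
  have X: "X (K, \<kappa>, \<tau>) < size_bound w" "dig w 0 (X (K, \<kappa>, \<tau>)) = K" "vcons w (X (K, \<kappa>, \<tau>))" "tau_ok w (X (K, \<kappa>, \<tau>))"
    "\<And>v. v \<in> vars w \<Longrightarrow> kap w (X (K, \<kappa>, \<tau>)) v = \<kappa> v"
    "\<And>r vs. (r, vs) \<in> ats w \<Longrightarrow> tau w (X (K, \<kappa>, \<tau>)) r vs = \<tau> r vs" if C: "(K, \<kappa>, \<tau>) \<in> S" for K \<kappa> \<tau>
  proof -
    have K: "K \<le> 1" using valid[OF C] by (simp add: valid_def)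
    have \<kappa>: "\<kappa> v \<le> length w" if "v \<in> vars w" for v
      using codes[OF C that] g[OF that] g(2) by auto
    note * = code_cfg[where \<kappa> = \<kappa> and \<tau> = \<tau>, OF LEx K \<kappa>, folded X_def]
    show "X (K, \<kappa>, \<tau>) < size_bound w" "dig w 0 (X (K, \<kappa>, \<tau>)) = K" "vcons w (X (K, \<kappa>, \<tau>))" "tau_ok w (X (K, \<kappa>, \<tau>))"
      "\<And>v. v \<in> vars w \<Longrightarrow> kap w (X (K, \<kappa>, \<tau>)) v = \<kappa> v"
      "\<And>r vs. (r, vs) \<in> ats w \<Longrightarrow> tau w (X (K, \<kappa>, \<tau>)) r vs = \<tau> r vs"
      by (simp_all add: *)
  qed
  have G: "G < size_bound w" "vcons w G" "tau_ok w G" "\<And>v. v \<in> vars w \<Longrightarrow> kap w G v = 0"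
    "\<And>r vs. (r, vs) \<in> ats w \<Longrightarrow> tau w G r vs = \<gamma> r vs"
    unfolding G_def X_def by (rule code_cfg[OF LEx]; simp)+
  have "coh (ats w) 0 (kap w G) (tau w G) (kap w G) (tau w G)"
    using \<gamma> by (rule coh_mono) (simp_all add: G)
  then have "cohn w 0 G G" using coh_iff[OF G(2,2,3,3)] by simp
  moreover have "var_dig w v G 0" for v by (rule var_digI[OF G(2) G(4)])
  ultimately have gok: "gok w G" by (simp add: gok_def)
  have "validn w G (X C)" if "C \<in> S" for C
  proof -
    obtain K \<kappa> \<tau> where C: "C = (K, \<kappa>, \<tau>)" by (cases C)
    note X = X[OF that[unfolded C], folded C]
    have val: "K \<le> 1" "x \<notin> set ys \<Longrightarrow> \<kappa> x = K" "z \<notin> set ys \<Longrightarrow> z \<noteq> x \<Longrightarrow> \<kappa> z = 0" "qev \<kappa> \<tau> q"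
      "coh (ats w) 0 \<kappa> \<tau> \<kappa> \<tau>" "coh (ats w) 0 \<kappa> \<tau> (\<lambda>_. 0) \<gamma>"
      using valid[OF that] unfolding C valid_def prod.case by blast+
    have "coh (ats w) 0 (kap w (X C)) (tau w (X C)) (kap w (X C)) (tau w (X C))"
      by (rule coh_mono[of w 0 \<kappa> \<tau> \<kappa> \<tau>]) (simp_all add: val(5) X(5,6))
    then have 1: "cohn w 0 (X C) (X C)" using coh_iff[OF X(3,3,4,4)] by simp
    have "coh (ats w) 0 (kap w (X C)) (tau w (X C)) (kap w G) (tau w G)"
      by (rule coh_mono[of w 0 \<kappa> \<tau> "\<lambda>_. 0" \<gamma>]) (simp_all add: val(6) X(5,6) G(4,5))
    then have 2: "cohn w 0 (X C) G" using coh_iff[OF X(3) G(2) X(4) G(3)] by simp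
    have vd: "var_dig w v (X C) (\<kappa> v)" for v by (rule var_digI[OF X(3,5)])
    have 3: "ybound w x \<or> var_dig w x (X C) (dig w 0 (X C))" "ybound w z \<or> z = x \<or> var_dig w z (X C) 0"
      using val(2,3) vd[of x] vd[of z] X(2) unfolding binders(2) by metis+
    have "kap w (X C) v = \<kappa> v" if "v \<in> fv q" for v using that sub(2) by (intro X(5)) blast
    moreover have "tau w (X C) r vs = \<tau> r vs" if "(r, vs) \<in> atoms q" for r vs
      using that sub(1) by (intro X(6)) blast
    ultimately have "qev (kap w (X C)) (tau w (X C)) q = qev \<kappa> \<tau> q"
      by (intro qev_cong[OF q]) auto
    then have tr: "tr w (length w) (X C) s (length w) 1"
      using val(4) fv binders(1) arg_cong[OF es(5), of length]
      by (intro tr_complete[OF X(3,4) q d end_arg_length]) auto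
    have "length ys \<le> length (encode_exs ys)" by (induction ys) simp_all
    then have "length ys \<le> length w" using w_eq by (simp add: encode_foldr_Ex)
    then have le: "length ys \<le> size_bound w" "e \<le> size_bound w" "s \<le> size_bound w" "length w \<le> size_bound w"
      using es(3,4) length_le_bound(1)[of w] by linarith+
    have prefix: "\<exists>t\<le>size_bound w. \<exists>s\<le>size_bound w. pre w t e s \<and> (\<exists>t'\<le>size_bound w. tr w t' (X C) s (length w) 1)"
      using es(2) tr le by blast
    have xz_le: "x \<le> size_bound w" "z \<le> size_bound w"
      using var_pos[OF xz(1)] var_pos[OF xz(2)] var_at_bound(1) by blast+
    have ex: "\<exists>z\<le>size_bound w. \<exists>x\<le>size_bound w. \<exists>e\<le>size_bound w. head w z x e \<and>
      (ybound w x \<or> var_dig w x (X C) (dig w 0 (X C))) \<and> (ybound w z \<or> z = x \<or> var_dig w z (X C) 0) \<and>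
      (\<exists>t\<le>size_bound w. \<exists>s\<le>size_bound w. pre w t e s \<and> (\<exists>t'\<le>size_bound w. tr w t' (X C) s (length w) 1))"
      by (rule exI[of _ z], rule conjI[OF xz_le(2)], rule exI[of _ x], rule conjI[OF xz_le(1)],
        rule exI[of _ e], intro conjI le(2) es(1) 3 prefix)
    have "dig w 0 (X C) = 0 \<or> dig w 0 (X C) = 1" using val(1) X(2) by linarith
    then show ?thesis unfolding validn_def by (intro conjI X(1,3) 1 2 ex)
  qed
  \<comment> \<open>The claim is made for all of \<open>S\<close> at once, because surviving the
    next stage requires the matches to have survived this one.\<close>
  then have elim: "elim w t G (X C)" if "C \<in> S" for t C
    using that
  proof (induction t arbitrary: C)
    case (Suc t)
    obtain K \<kappa> \<tau> where C: "C = (K, \<kappa>, \<tau>)" by (cases C)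
    note X_C = X[OF Suc.prems(2)[unfolded C], folded C]
    have succ: "\<exists>Y\<le>size_bound w. elim w t G Y \<and> dig w 0 Y = 1 \<and> cohn w (dig w i (X C)) (X C) Y"
      if v: "var_at w v i k" and m: "dig w i (X C) \<noteq> 0" "dig w i (X C) \<noteq> dig w 0 (X C)" for v i k
    proof -
      have "v \<in> vars w" using v by (auto simp: vars_def)
      then have dig: "dig w i (X C) = \<kappa> v" using kap[OF X_C(3) v] X_C(5) by simp
      then have "\<kappa> v \<noteq> 0" "\<kappa> v \<noteq> K" "\<kappa> v \<in> \<kappa> ` vars w" using m X_C(2) \<open>v \<in> vars w\<close> by auto
      then obtain \<kappa>' \<tau>' where C': "(1, \<kappa>', \<tau>') \<in> S" "coh (ats w) (\<kappa> v) \<kappa> \<tau> \<kappa>' \<tau>'"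
        using closed Suc.prems(2) unfolding closed_cfgs_def C by blast
      note X_C' = X[OF C'(1)]
      have "coh (ats w) (\<kappa> v) (kap w (X C)) (tau w (X C)) (kap w (X (1, \<kappa>', \<tau>'))) (tau w (X (1, \<kappa>', \<tau>')))"
        using C'(2) by (rule coh_mono) (simp_all only: X_C(5,6) X_C'(5,6))
      then have "cohn w (\<kappa> v) (X C) (X (1, \<kappa>', \<tau>'))" using coh_iff[OF X_C(3) X_C'(3) X_C(4) X_C'(4)] by simp
      then show ?thesis
        unfolding dig by (intro exI[of _ "X (1, \<kappa>', \<tau>')"] conjI less_imp_le[OF X_C'(1)] X_C'(2)
          Suc.IH[OF Suc.prems(1) C'(1)])
    qed
    show ?case
      unfolding elim.simps
    proof (intro conjI allI impI)
      show "elim w t G (X C)" by (rule Suc.IH[OF Suc.prems])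
      show "\<exists>Y\<le>size_bound w. elim w t G Y \<and> dig w 0 Y = 1 \<and> cohn w (dig w i (X C)) (X C) Y"
        if "var_at w v i k" "dig w i (X C) \<noteq> 0 \<and> dig w i (X C) \<noteq> dig w 0 (X C)" for v i k
        using that by (intro succ[of v i k]) blast+
    qed
  qed simp
  have "\<exists>t<size_bound w. {Y. elim w t G Y} \<subseteq> {Y. elim w (Suc t) G Y}"
  proof (rule chain_stable)
    show "{Y. elim w (Suc t) G Y} \<subseteq> {Y. elim w t G Y}" for t unfolding elim.simps by blast
    show "{Y. elim w 0 G Y} \<subseteq> {..<size_bound w}" unfolding elim.simps validn_def by blast
    show "{Y. elim w t G Y} \<noteq> {}" for t using elim[OF C0(1)] by blast
  qed
  then obtain t where t: "t < size_bound w" "{Y. elim w t G Y} \<subseteq> {Y. elim w (Suc t) G Y}" by blast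
  obtain \<kappa> \<tau> where C0_eq: "C0 = (0, \<kappa>, \<tau>)" using C0(2) by (cases C0) simp
  note X_C0 = X[OF C0(1)[unfolded C0_eq], folded C0_eq]
  have initial: "\<exists>X\<le>size_bound w. elim w t G X \<and> dig w 0 X = 0"
    using X_C0(1,2) elim[OF C0(1), of t] less_imp_le by blast
  have stable: "\<forall>X\<le>size_bound w. elim w t G X \<longrightarrow> elim w (Suc t) G X" using t(2) by blast
  show ?thesis
    unfolding acc_def
    by (rule exI[of _ G], rule conjI[OF less_imp_le[OF G(1)]], rule conjI[OF gok], rule exI[of _ t],
        intro conjI t(1) stable initial)
qed

theorem theorem1p1:
  assumes "infinite (UNIV :: 'u set)"
  shows "encode ` {p \<in> prefix_EAEs. satisfiable TYPE('u) p} \<in> EXPTIME"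
proof -
  have "encode ` {p \<in> prefix_EAEs. satisfiable TYPE('u) p} = {w. acc w}"
  proof (intro equalityI subsetI)
    fix w assume "w \<in> encode ` {p \<in> prefix_EAEs. satisfiable TYPE('u) p}"
    then show "w \<in> {w. acc w}" using acc_complete by blast
  next
    fix w assume "w \<in> {w. acc w}"
    then obtain p where p: "p \<in> prefix_EAEs" "w = encode p" "satisfiable TYPE(nat list) p"
      using acc_sound by blast
    \<comment> \<open>The tree model has lists of numbers as elements; independence of the universe
      carries it over to any infinite type.\<close>
    then have "satisfiable TYPE('u) p"
      using satisfiable_universe[OF assms _ p(3)] by (simp add: prefix_EAEs_def)
    then show "w \<in> encode ` {p \<in> prefix_EAEs. satisfiable TYPE('u) p}" using p by blast
  qed
  then show ?thesis using acc_EXPTIME by simp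
qed

end
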